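(* Let $d\geq 2$ be an integer. Then there exists a Delone set $Y\subset\mathbb{R}^d$ such that (a) there is no bijection $f:Y\to\mathbb{Z}^d$ that is Lipschitz and pointwise co-Lipschitz, and (b) there is no bijection $f:Y\to\mathbb{Z}^d$ that is pointwise Lipschitz and co-Lipschitz.
   Context: $\|\cdot\|$ is the Euclidean norm. A set $Y\subset\mathbb{R}^d$ is a Delone set if there is $s>0$ such that every closed ball of radius $s$ in $\mathbb{R}^d$ contains at most one point of $Y$, and there is $S>0$ such that every closed ball of radius $S$ in $\mathbb{R}^d$ contains at least one point of $Y$. For $K,X\subseteq\mathbb{R}^d$ and $f:K\to X$: $f$ is Lipschitz if there is $L>0$ with $\|f(x)-f(y)\|\le L\|x-y\|$ for all $x,y\in K$. $f$ is Lipschitz at $y\in K$ if there is $L=L(y)>0$ with $\|f(x)-f(y)\|\le L\|x-y\|$ for every $x\in K$. $f$ is pointwise Lipschitz if it is Lipschitz at every $y\in K$ (the constant may depend on $y$). $f$ is co-Lipschitz (resp. pointwise co-Lipschitz) if $f$ is a bijection and $f^{-1}:X\to K$ is Lipschitz (resp. pointwise Lipschitz). *)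

theory Defs
  imports "HOL-Analysis.Analysis"
begin

definition delone :: "'a::metric_space set \<Rightarrow> bool" where
  "delone Y \<longleftrightarrow>
     (\<exists>s>0. \<forall>c. \<forall>x \<in> Y \<inter> cball c s. \<forall>y \<in> Y \<inter> cball c s. x = y) \<and>
     (\<exists>S>0. \<forall>c. Y \<inter> cball c S \<noteq> {})"

definition integer_points :: "(real ^ 'n) set" where
  "integer_points = {x. \<forall>i. x $ i \<in> \<int>}"

text \<open>
  A map \<open>f : K \<rightarrow> X\<close> is a total function of which only the values on \<open>K\<close> matter.
\<close>

definition lipschitz_map :: "'a::metric_space set \<Rightarrow> ('a \<Rightarrow> 'b::metric_space) \<Rightarrow> bool" where
  "lipschitz_map K f \<longleftrightarrow> (\<exists>L>0. L-lipschitz_on K f)"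

definition lipschitz_at ::
    "'a::metric_space set \<Rightarrow> ('a \<Rightarrow> 'b::metric_space) \<Rightarrow> 'a \<Rightarrow> bool" where
  "lipschitz_at K f y \<longleftrightarrow> (\<exists>L>0. \<forall>x\<in>K. dist (f x) (f y) \<le> L * dist x y)"

definition pointwise_lipschitz ::
    "'a::metric_space set \<Rightarrow> ('a \<Rightarrow> 'b::metric_space) \<Rightarrow> bool" where
  "pointwise_lipschitz K f \<longleftrightarrow> (\<forall>y\<in>K. lipschitz_at K f y)"

definition co_lipschitz ::
    "'a::metric_space set \<Rightarrow> 'b::metric_space set \<Rightarrow> ('a \<Rightarrow> 'b) \<Rightarrow> bool" where
  "co_lipschitz K X f \<longleftrightarrow> bij_betw f K X \<and> lipschitz_map X (inv_into K f)"

definition pointwise_co_lipschitz ::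
    "'a::metric_space set \<Rightarrow> 'b::metric_space set \<Rightarrow> ('a \<Rightarrow> 'b) \<Rightarrow> bool" where
  "pointwise_co_lipschitz K X f \<longleftrightarrow>
     bij_betw f K X \<and> pointwise_lipschitz X (inv_into K f)"

end

theory Submission
  imports Defs "HOL-Complex_Analysis.Great_Picard" "HOL-Real_Asymp.Real_Asymp"
begin

text \<open>
  The net \<open>Y\<close> is built so that its rescalings converge to a measure \<open>R\<close> with density between \<open>1\<close> and \<open>2\<close>.
  A bijection of either forbidden kind, rescaled along with \<open>Y\<close>, has a proper Lipschitz limit \<open>F\<close> that transports
  \<open>R\<close> to Lebesgue measure (case a) or Lebesgue measure to \<open>R\<close> (case b).

  Such an \<open>F\<close> cannot collapse volume. Blowing up at points of maximal stretch, one basis direction after the other,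
  gives an injective linear tangent map, so in every open set there is a ball whose image covers an open set
  robustly, i.e. under all perturbations that fix \<open>F\<close> on the boundary sphere. For a maximal number of disjoint robust
  balls over a common open set the preimages of small balls are connected within each of them, and a volume count
  turns this into bi-Lipschitz estimates: over some open set \<open>F\<close> consists of finitely many bi-Lipschitz sheets.

  The density of \<open>R\<close> alternates between \<open>2\<close> and \<open>1\<close> along thin rows of balls placed at a dense set of horizontal
  segments. Following Burago and Kleiner, take a row along which the joint stretch of all sheets is almost maximal. Then
  every sheet maps some two neighbouring balls of the row to almost translated copies, which have almost the same
  volume, although the two balls have different \<open>R\<close>-measure.
\<close>

section \<open>Blow-ups of Lipschitz maps\<close>

text \<open>The limit \<open>F\<close> is controlled in one direction only. The pointwise constants
  of the inverse may be unbounded, so injectivity is lost in the limit and what survives is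
  properness. The sheets must therefore be extracted from transport itself: \<open>F\<close> cannot
  shrink volume by more than a fixed factor, and this bounds the number of disjoint robust balls
  over a common set. Robust covering plays the role of a nonzero local degree. With several sheets,
  transport equates one measure with a sum over pieces. If \<open>R\<close> is the target, the
  pieces are volumes of charts, and almost translated balls give a contradiction at once. If
  \<open>R\<close> is the source, solving for one sheet leaves the \<open>R\<close>-measures of the
  other sheets with a minus sign, and these could cancel the oscillation of the chosen row. Hence
  the demand that off its row \<open>R\<close> looks constant at the scale of the row: each row is
  fine compared with the variation of the earlier density, and all later rows together have tiny
  volume. The values 1 and 2 keep \<open>R\<close> comparable to Lebesgue measure, so one theory of
  sheets serves both orders of the two measures.\<close>

lemma almost_lipschitz_convergent_subsequence:
  fixes f :: "nat \<Rightarrow> 'a::euclidean_space \<Rightarrow> 'b::euclidean_space"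
  assumes lip: "\<And>n x y. norm (f n x - f n y) \<le> L * norm (x - y) + \<epsilon> n"
    and eps: "\<epsilon> \<longlonglongrightarrow> 0" and bd: "\<And>n. norm (f n 0) \<le> C" and "L \<ge> 0"
  obtains g k where "strict_mono (k :: nat \<Rightarrow> nat)" "\<And>x. (\<lambda>n. f (k n) x) \<longlonglongrightarrow> g x"
    "\<And>x y. norm (g x - g y) \<le> L * norm (x - y)"
proof -
  obtain E where E: "\<And>n. \<bar>\<epsilon> n\<bar> \<le> E"
    using convergent_imp_Bseq[OF convergentI[OF eps]] unfolding Bseq_def by (metis real_norm_def)
  obtain D :: "'a set" where D: "countable D" "\<And>X. open X \<Longrightarrow> X \<noteq> {} \<Longrightarrow> \<exists>d\<in>D. d \<in> X"
    by (rule countable_dense_setE) blast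
  have b: "norm (f n x) \<le> (C + L + E) * (1 + norm x)" for n x
  proof -
    have "norm (f n x) \<le> norm (f n x - f n 0) + norm (f n 0)" by norm
    also have "\<dots> \<le> L * norm x + E + C" using lip[of n x 0] bd[of n] E[of n] by simp
    also have "\<dots> \<le> (C + L + E) * (1 + norm x)"
    proof -
      have "0 \<le> C" using bd[of 0] norm_ge_zero[of "f 0 0"] by linarith
      moreover have "0 \<le> E" using E[of 0] by linarith
      ultimately have "0 \<le> C * norm x" "0 \<le> E * norm x" by auto
      then show ?thesis using \<open>L \<ge> 0\<close> by (simp add: algebra_simps)
    qed
    finally show ?thesis .
  qed
  \<comment> \<open>The diagonal extraction asks for one bound valid at all points of
    \<open>D\<close>; the weight \<open>1 + norm x\<close> turns the linear growth bound into such a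
    bound.\<close>
  have "norm (f n x /\<^sub>R (1 + norm x)) \<le> C + L + E" if "x \<in> D" for n x
  proof -
    have "0 < 1 + norm x" by (simp add: add_pos_nonneg)
    with b[of n x] show ?thesis by (simp add: divide_simps)
  qed
  from function_convergent_subsequence[OF D(1), of "\<lambda>n x. f n x /\<^sub>R (1 + norm x)", OF this]
  obtain k where k: "strict_mono (k::nat\<Rightarrow>nat)"
    and kD: "\<And>x. x \<in> D \<Longrightarrow> \<exists>l. (\<lambda>n. f (k n) x /\<^sub>R (1 + norm x)) \<longlonglongrightarrow> l" by blast
  have cD: "convergent (\<lambda>n. f (k n) x)" if xD: "x \<in> D" for x
  proof -
    have "0 < 1 + norm x" by (simp add: add_pos_nonneg)
    then have "1 + norm x \<noteq> 0" by simp
    obtain l where "(\<lambda>n. f (k n) x /\<^sub>R (1 + norm x)) \<longlonglongrightarrow> l" using kD[OF xD] by blast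
    then have "(\<lambda>n. (1 + norm x) *\<^sub>R (f (k n) x /\<^sub>R (1 + norm x))) \<longlonglongrightarrow> (1 + norm x) *\<^sub>R l"
      by (intro tendsto_intros)
    moreover have "(1 + norm x) *\<^sub>R (f (k n) x /\<^sub>R (1 + norm x)) = f (k n) x" for n
      using \<open>1 + norm x \<noteq> 0\<close> by (subst scaleR_scaleR, subst right_inverse) simp_all
    ultimately have "(\<lambda>n. f (k n) x) \<longlonglongrightarrow> (1 + norm x) *\<^sub>R l" by (simp only:)
    then show ?thesis by (rule convergentI)
  qed
  have ek: "(\<lambda>n. \<epsilon> (k n)) \<longlonglongrightarrow> 0" using LIMSEQ_subseq_LIMSEQ[OF eps k] by (simp add: o_def)
  \<comment> \<open>Convergence passes from \<open>D\<close> to every point although the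
    \<open>f n\<close> need not be continuous: the Lipschitz part is small for \<open>d\<close> near
    \<open>x\<close>, and the additive error vanishes along the sequence.\<close>
  have conv: "convergent (\<lambda>n. f (k n) x)" for x
  proof (rule Cauchy_convergent, rule metric_CauchyI)
    fix e :: real assume "e > 0"
    have p: "e / (8 * (L + 1)) > 0" using \<open>e > 0\<close> \<open>L \<ge> 0\<close> by simp
    then obtain d where d: "d \<in> D" "dist x d < e / (8 * (L + 1))"
      using D(2)[of "ball x (e / (8 * (L+1)))"] by auto
    have "L * norm (x - d) \<le> (L + 1) * (e / (8 * (L + 1)))"
      using d \<open>L \<ge> 0\<close> by (intro mult_mono) (auto simp: dist_norm)
    also have "\<dots> = e / 8" using \<open>L \<ge> 0\<close> by (simp add: field_simps)
    finally have Ld: "L * norm (x - d) \<le> e / 8" .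
    obtain N1 where N1: "\<And>n. n \<ge> N1 \<Longrightarrow> \<bar>\<epsilon> (k n)\<bar> < e / 8"
      using LIMSEQ_D[OF ek, of "e/8"] \<open>e > 0\<close> by auto
    obtain N2 where N2: "\<And>m n. m \<ge> N2 \<Longrightarrow> n \<ge> N2 \<Longrightarrow> norm (f (k m) d - f (k n) d) < e / 8"
      using convergent_Cauchy[OF cD[OF d(1)]] \<open>e > 0\<close> unfolding Cauchy_def dist_norm
      by (metis divide_pos_pos zero_less_numeral)
    show "\<exists>M. \<forall>m\<ge>M. \<forall>n\<ge>M. dist (f (k m) x) (f (k n) x) < e"
    proof (intro exI allI impI)
      fix m n assume mn: "max N1 N2 \<le> m" "max N1 N2 \<le> n"
      have "norm (f (k m) x - f (k m) d) \<le> e / 8 + e / 8"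
        using lip[of "k m" x d] N1[of m] mn Ld by auto
      moreover have "norm (f (k n) x - f (k n) d) \<le> e / 8 + e / 8"
        using lip[of "k n" x d] N1[of n] mn Ld by auto
      moreover have "norm (f (k m) d - f (k n) d) < e / 8" using N2 mn by auto
      ultimately have "norm (f (k m) x - f (k n) x) < e / 8 + e/8 + (e / 8+e/8) + e/8"
        by norm
      then show "dist (f (k m) x) (f (k n) x) < e" using \<open>e > 0\<close> by (simp add: dist_norm)
    qed
  qed
  define g where "g x = lim (\<lambda>n. f (k n) x)" for x
  have g: "(\<lambda>n. f (k n) x) \<longlonglongrightarrow> g x" for x
    using conv[of x] by (simp add: g_def convergent_LIMSEQ_iff)
  have "norm (g x - g y) \<le> L * norm (x - y)" for x y
  proof (rule tendsto_le[OF trivial_limit_sequentially])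
    show "(\<lambda>n. norm (f (k n) x - f (k n) y)) \<longlonglongrightarrow> norm (g x - g y)"
      by (intro tendsto_intros g)
    show "(\<lambda>n. L * norm (x - y) + \<epsilon> (k n)) \<longlonglongrightarrow> L * norm (x - y)"
      using tendsto_add[OF tendsto_const ek, of "L * norm (x-y)"] by simp
  qed (use lip in auto)
  with k g that show thesis by blast
qed

text \<open>Pointwise convergence is uniform on a finite \<open>d\<close>-net of \<open>K\<close>,
  and the almost Lipschitz bound carries it to the rest of \<open>K\<close>.\<close>

lemma almost_lipschitz_uniform_limit:
  fixes f :: "nat \<Rightarrow> 'a::euclidean_space \<Rightarrow> 'b::euclidean_space"
  assumes lip: "\<And>n x y. norm (f n x - f n y) \<le> L * norm (x - y) + \<epsilon> n"
    and eps: "\<epsilon> \<longlonglongrightarrow> 0" and "L \<ge> 0"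
    and lim: "\<And>x. (\<lambda>n. f n x) \<longlonglongrightarrow> g x"
    and glip: "\<And>x y. norm (g x - g y) \<le> L * norm (x - y)"
    and "compact K" "e > 0"
  shows "\<forall>\<^sub>F n in sequentially. \<forall>x\<in>K. norm (f n x - g x) < e"
proof -
  define d where "d = e / (8 * (L + 1))"
  have "d > 0" using \<open>e > 0\<close> \<open>L \<ge> 0\<close> by (simp add: d_def)
  obtain Z where Z: "finite Z" "K \<subseteq> (\<Union>z\<in>Z. ball z d)"
    using \<open>compact K\<close> \<open>d > 0\<close> unfolding compact_eq_totally_bounded by blast
  have "\<forall>\<^sub>F n in sequentially. \<forall>z\<in>Z. norm (f n z - g z) < e / 8"
  proof (rule eventually_ball_finite[OF Z(1)], rule ballI)
    fix z
    show "\<forall>\<^sub>F n in sequentially. norm (f n z - g z) < e / 8"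
      using tendstoD[OF lim[of z], of "e / 8"] \<open>e > 0\<close> by (simp add: dist_norm)
  qed
  moreover have "\<forall>\<^sub>F n in sequentially. \<bar>\<epsilon> n\<bar> < e / 8"
    using tendstoD[OF eps, of "e / 8"] \<open>e > 0\<close> by (simp add: dist_norm)
  ultimately show ?thesis
  proof eventually_elim
    case (elim n)
    show ?case
    proof
      fix x assume "x \<in> K"
      then obtain z where z: "z \<in> Z" "norm (x - z) < d" using Z(2) by (auto simp: dist_norm norm_minus_commute)
      have "L * norm (x - z) \<le> (L + 1) * d" using z \<open>L \<ge> 0\<close> by (intro mult_mono) auto
      also have "\<dots> = e / 8" using \<open>L \<ge> 0\<close> by (simp add: d_def field_simps)
      finally have "L * norm (x - z) \<le> e / 8" .
      moreover have "norm (f n z - g z) < e / 8" using elim z by auto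
      ultimately have "norm (f n x - f n z) \<le> e/8 + e/8" "norm (g x - g z) \<le> e / 8" "norm (f n z - g z) < e / 8"
        using lip[of n x z] glip[of x z] elim by auto
      then have "norm (f n x - g x) < e/8+e/8+e/8+e/8" by norm
      then show "norm (f n x - g x) < e" using \<open>e > 0\<close> by simp
    qed
  qed
qed

definition blowup :: "('a::real_vector \<Rightarrow> 'b::real_vector) \<Rightarrow> 'a \<Rightarrow> real \<Rightarrow> 'a \<Rightarrow> 'b" where
  "blowup f x r y = (f (x + r *\<^sub>R y) - f x) /\<^sub>R r"

text \<open>These are the closure properties of a family of iterated tangents. They are abstracted
  so that a subfamily cut out by a condition stable under blow-ups and limits has them again, which
  permits an induction over basis vectors.\<close>

definition blowup_closed :: "real \<Rightarrow> ('a::euclidean_space \<Rightarrow> 'a) set \<Rightarrow> bool" where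
  "blowup_closed L \<F> \<longleftrightarrow> \<F> \<noteq> {} \<and>
     (\<forall>f\<in>\<F>. f 0 = 0 \<and> (\<forall>x y. norm (f x - f y) \<le> L * norm (x - y))) \<and>
     (\<forall>f\<in>\<F>. \<forall>x r. r > 0 \<longrightarrow> blowup f x r \<in> \<F>) \<and>
     (\<forall>f g. (\<forall>n. f n \<in> \<F>) \<longrightarrow> (\<forall>x. (\<lambda>n::nat. f n x) \<longlonglongrightarrow> g x) \<longrightarrow> g \<in> \<F>)"

lemma blowup_closed_subsequence:
  assumes "blowup_closed L \<F>" "L \<ge> 0" and "\<And>n. f n \<in> \<F>"
  obtains g k where "strict_mono (k :: nat \<Rightarrow> nat)" "\<And>x. (\<lambda>n. f (k n) x) \<longlonglongrightarrow> g x" "g \<in> \<F>"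
proof -
  obtain g k where gk: "strict_mono (k :: nat \<Rightarrow> nat)" "\<And>x. (\<lambda>n. f (k n) x) \<longlonglongrightarrow> g x"
  proof (rule almost_lipschitz_convergent_subsequence[of f L "\<lambda>_. 0" 0])
    show "norm (f n x - f n y) \<le> L * norm (x - y) + 0" for n x y
      using assms unfolding blowup_closed_def by auto
    show "norm (f n 0) \<le> 0" for n
      using assms unfolding blowup_closed_def by auto
  qed (use assms in auto)
  moreover have "g \<in> \<F>"
  proof -
    have "(\<forall>n. (\<lambda>n. f (k n)) n \<in> \<F>) \<longrightarrow> (\<forall>x. (\<lambda>n. f (k n) x) \<longlonglongrightarrow> g x) \<longrightarrow> g \<in> \<F>"
      using assms(1)[unfolded blowup_closed_def, THEN conjunct2, THEN conjunct2, THEN conjunct2, THEN spec[of _ "\<lambda>n. f (k n)"], THEN spec[of _ g]] .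
    then show ?thesis using gk(2) assms(3) by simp
  qed
  ultimately show thesis using that by blast
qed

text \<open>A bounded antitone function has a limit at infinity, so its far translates flatten out.
  The shifts are integers; monotonicity of \<open>A\<close> fills the gaps between them.\<close>

lemma antimono_shift_limit_constant:
  fixes a :: "real \<Rightarrow> real"
  assumes mono: "\<And>s t. s \<le> t \<Longrightarrow> a t \<le> a s" and bdd: "\<And>s. b \<le> a s"
    and k: "strict_mono (k :: nat \<Rightarrow> nat)"
    and lim: "\<And>t. (\<lambda>n. a (t + real (k n))) \<longlonglongrightarrow> A t"
  shows "A t = A s"
proof -
  have Amono: "A t \<le> A s" if "s \<le> t" for s t
    by (rule LIMSEQ_le[OF lim lim]) (use mono that in auto)
  have shift: "A (t + real m) = A t" for t m
  proof -
    have "decseq (\<lambda>n. a (t + real n))" by (auto simp: decseq_def intro!: mono)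
    then obtain c where c: "(\<lambda>n. a (t + real n)) \<longlonglongrightarrow> c"
      using decseq_convergent[of "\<lambda>n. a (t + real n)" b] bdd by metis
    have "A t = c"
      using LIMSEQ_unique[OF lim[of t]] LIMSEQ_subseq_LIMSEQ[OF c k] by (simp add: o_def)
    moreover have "A (t + real m) = c"
    proof (rule LIMSEQ_unique[OF lim])
      from LIMSEQ_ignore_initial_segment[OF c, of m]
      have "(\<lambda>n. a (t + real m + real n)) \<longlonglongrightarrow> c" by (simp add: algebra_simps)
      from LIMSEQ_subseq_LIMSEQ[OF this k]
      show "(\<lambda>n. a (t + real m + real (k n))) \<longlonglongrightarrow> c" by (simp add: o_def)
    qed
    ultimately show ?thesis by simp
  qed
  have *: "A t = A s" if "s \<le> t" for s t
  proof -
    obtain m :: nat where "t \<le> s + real m" using real_arch_simple[of "t - s"] by (auto simp: algebra_simps)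
    then show ?thesis using Amono[of s t] Amono[of t "s + real m"] shift[of s m] that by auto
  qed
  show ?thesis using *[of s t] *[of t s] by linarith
qed

text \<open>An extremality argument in the style of splitting theorems. A member of maximal stretch
  along \<open>e\<close> is linear on a segment because the Euclidean norm is strictly convex;
  blowing up at the midpoint makes it linear on a line; translating along that line to infinity
  spreads this to all parallel lines.\<close>

lemma blowup_closed_translation_invariant:
  fixes \<F> :: "('a::euclidean_space \<Rightarrow> 'a) set"
  assumes bc: "blowup_closed L \<F>" and "L \<ge> 0"
  obtains w \<G> where "\<G> \<subseteq> \<F>" "blowup_closed L \<G>" "\<And>f x t. f \<in> \<G> \<Longrightarrow> f (x + t *\<^sub>R e) = f x + t *\<^sub>R w"
proof -
  have ne: "\<F> \<noteq> {}" and zero: "\<And>f. f \<in> \<F> \<Longrightarrow> f 0 = 0"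
    and lip: "\<And>f x y. f \<in> \<F> \<Longrightarrow> norm (f x - f y) \<le> L * norm (x - y)"
    and blow: "\<And>f x r. f \<in> \<F> \<Longrightarrow> r > 0 \<Longrightarrow> blowup f x r \<in> \<F>"
    using bc unfolding blowup_closed_def by auto
  define M where "M = (SUP f\<in>\<F>. norm (f e))"
  have bdd: "bdd_above ((\<lambda>f. norm (f e)) ` \<F>)"
    using lip[of _ e 0] zero by (intro bdd_aboveI[of _ "L * norm e"]) fastforce
  have leM: "norm (f e) \<le> M" if "f \<in> \<F>" for f
    unfolding M_def by (rule cSUP_upper[OF that bdd])
  have M0: "0 \<le> M" using ne leM norm_ge_zero order_trans by blast
  \<comment> \<open>Every increment in direction \<open>e\<close> is the value at \<open>e\<close>
    of a rescaled member, so the supremum \<open>M\<close> is a Lipschitz constant in that direction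
    for the whole family.\<close>
  have dirM: "norm (f (x + t *\<^sub>R e) - f x) \<le> M * \<bar>t\<bar>" if "f \<in> \<F>" for f x t
  proof -
    have pos: "norm (f (y + s *\<^sub>R e) - f y) \<le> M * s" if "s > 0" for y s
    proof -
      have "norm (blowup f y s e) \<le> M" using leM[OF blow[OF \<open>f \<in> \<F>\<close> that]] .
      moreover have "norm (blowup f y s e) = norm (f (y + s *\<^sub>R e) - f y) / s"
        using that by (simp add: blowup_def divide_inverse mult.commute)
      ultimately have "norm (f (y + s *\<^sub>R e) - f y) / s \<le> M" by (simp only:)
      then show ?thesis unfolding pos_divide_le_eq[OF that] .
    qed
    consider "t = 0" | "t > 0" | "t < 0" by linarith
    then show ?thesis
    proof cases
      case 3
      then show ?thesis using pos[of "-t" "x + t *\<^sub>R e"] by (simp add: norm_minus_commute)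
    qed (use pos in auto)
  qed
  have "\<exists>f\<in>\<F>. M - 1 / real (Suc n) < norm (f e)" for n
    unfolding M_def by (rule less_cSUP_iff[THEN iffD1, OF ne bdd]) simp
  then obtain f where f: "\<And>n. f n \<in> \<F>" "\<And>n. M - 1 / real (Suc n) < norm (f n e)" by metis
  obtain f1 k where k: "strict_mono (k :: nat \<Rightarrow> nat)" and f1: "\<And>x. (\<lambda>n. f (k n) x) \<longlonglongrightarrow> f1 x" "f1 \<in> \<F>"
    by (rule blowup_closed_subsequence[OF bc \<open>L \<ge> 0\<close>, of f, OF f(1)]) (rule that)
  define w where "w = f1 e"
  have "M \<le> norm w" unfolding w_def
  proof (rule LIMSEQ_le[OF _ tendsto_norm[OF f1(1)]])
    have "(\<lambda>n. M - 1 / real (Suc n)) \<longlonglongrightarrow> M - 0"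
      by (intro tendsto_intros LIMSEQ_Suc[OF lim_1_over_n])
    from LIMSEQ_subseq_LIMSEQ[OF this k]
    show "(\<lambda>n. M - 1 / real (Suc (k n))) \<longlonglongrightarrow> M" by (simp add: o_def)
  qed (use f(2) in \<open>auto intro: less_imp_le\<close>)
  then have wM: "norm w = M" using leM[OF f1(2)] by (simp add: w_def)
  \<comment> \<open>The point \<open>v\<close> is as close to \<open>0\<close> and to
    \<open>w\<close> as the segment from \<open>0\<close> to \<open>w\<close> permits. Stewart's
    identity turns this equality case of the triangle inequality into
    \<open>v = t w\<close>.\<close>
  have seg: "f1 (t *\<^sub>R e) = t *\<^sub>R w" if t: "0 \<le> t" "t \<le> 1" for t
  proof -
    define v where "v = f1 (t *\<^sub>R e)"
    have 1: "norm v \<le> M * t" using dirM[OF f1(2), of 0 t] zero[OF f1(2)] t by (simp add: v_def)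
    have "e = t *\<^sub>R e + (1 - t) *\<^sub>R e" by (simp add: algebra_simps)
    then have 2: "norm (v - w) \<le> M * (1 - t)"
      using dirM[OF f1(2), of "t *\<^sub>R e" "1 - t"] t by (simp add: v_def w_def norm_minus_commute)
    have "(norm (v - t *\<^sub>R w))\<^sup>2 = (1 - t) * (norm v)\<^sup>2 + t * (norm (v - w))\<^sup>2 - t * (1 - t) * (norm w)\<^sup>2"
      unfolding power2_norm_eq_inner by (simp add: algebra_simps inner_commute power2_eq_square)
    also have "\<dots> \<le> (1 - t) * (M * t)\<^sup>2 + t * (M * (1 - t))\<^sup>2 - t * (1 - t) * M\<^sup>2"
      using 1 2 t wM by (intro diff_mono add_mono mult_left_mono power_mono) auto
    also have "\<dots> = 0" by (simp add: power2_eq_square algebra_simps)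
    finally have "norm (v - t *\<^sub>R w) = 0" by simp
    then show ?thesis by (simp add: v_def)
  qed
  \<comment> \<open>Blowing up at the midpoint leaves room on both sides, so the linear segment
    grows to the full line.\<close>
  define g where "g n = blowup f1 ((1/2) *\<^sub>R e) (1 / (real n + 2))" for n
  have gF: "g n \<in> \<F>" for n unfolding g_def by (rule blow[OF f1(2)]) simp
  obtain f2 k2 where k2: "strict_mono (k2 :: nat \<Rightarrow> nat)" and f2: "\<And>x. (\<lambda>n. g (k2 n) x) \<longlonglongrightarrow> f2 x" "f2 \<in> \<F>"
    by (rule blowup_closed_subsequence[OF bc \<open>L \<ge> 0\<close>, of g, OF gF]) (rule that)
  have gt: "g n (t *\<^sub>R e) = t *\<^sub>R w" if "\<bar>t\<bar> \<le> real n / 2" for n t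
  proof -
    have t2: "\<bar>t / (real n + 2)\<bar> \<le> 1 / 2" using that by (simp add: field_simps)
    have "(1/2) *\<^sub>R e + (1 / (real n + 2)) *\<^sub>R t *\<^sub>R e = (1/2 + t / (real n + 2)) *\<^sub>R e"
      by (simp add: algebra_simps)
    moreover have "f1 ((1/2 + t / (real n + 2)) *\<^sub>R e) = (1/2 + t / (real n + 2)) *\<^sub>R w"
      using abs_le_D1[OF t2] abs_le_D2[OF t2] by (intro seg) linarith+
    moreover have "(t * real n + t * 2) / (real n + 2) = t" by (simp add: divide_eq_eq algebra_simps)
    ultimately show ?thesis using seg[of "1/2"] by (simp add: g_def blowup_def algebra_simps)
  qed
  have f2t: "f2 (t *\<^sub>R e) = t *\<^sub>R w" for t
  proof (rule LIMSEQ_unique[OF f2(1)])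
    obtain N :: nat where N: "2 * \<bar>t\<bar> \<le> real N" using real_arch_simple by blast
    show "(\<lambda>n. g (k2 n) (t *\<^sub>R e)) \<longlonglongrightarrow> t *\<^sub>R w"
    proof (rule tendsto_eventually, rule eventually_sequentiallyI[of N])
      fix n assume "N \<le> n"
      then have "real N \<le> real (k2 n)" using seq_suble[OF k2, of n] by linarith
      then show "g (k2 n) (t *\<^sub>R e) = t *\<^sub>R w" using N by (intro gt) linarith
    qed
  qed
  define h where "h n = blowup f2 (real n *\<^sub>R e) 1" for n
  have hF: "h n \<in> \<F>" for n unfolding h_def by (rule blow[OF f2(2)]) simp
  obtain f3 k3 where k3: "strict_mono (k3 :: nat \<Rightarrow> nat)" and f3: "\<And>x. (\<lambda>n. h (k3 n) x) \<longlonglongrightarrow> f3 x" "f3 \<in> \<F>"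
    by (rule blowup_closed_subsequence[OF bc \<open>L \<ge> 0\<close>, of h, OF hF]) (rule that)
  have f3w: "f3 (x + t *\<^sub>R e) = f3 x + t *\<^sub>R w" for x t
  proof -
    \<comment> \<open>An analogue of a Busemann function: it decreases because the stretch along
      \<open>e\<close> is at most \<open>M\<close>, and it is bounded below because
      \<open>f2\<close> is linear with slope \<open>w\<close> on the line through \<open>0\<close>,
      at fixed distance from \<open>x\<close>.\<close>
    define a where "a s = w \<bullet> f2 (x + s *\<^sub>R e) - M\<^sup>2 * s" for s
    define A where "A s = w \<bullet> f3 (x + s *\<^sub>R e) - M\<^sup>2 * s" for s
    have "A t = A 0"
    proof (rule antimono_shift_limit_constant[where a = a and b = "- M * (L * norm x)" and A = A, OF _ _ k3])
      fix s t :: real assume "s \<le> t"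
      have "w \<bullet> (f2 (x + t *\<^sub>R e) - f2 (x + s *\<^sub>R e)) \<le> norm w * norm (f2 (x + t *\<^sub>R e) - f2 (x + s *\<^sub>R e))"
        by (rule norm_cauchy_schwarz)
      also have "\<dots> \<le> M * (M * (t - s))"
      proof -
        have "norm (f2 (x + t *\<^sub>R e) - f2 (x + s *\<^sub>R e)) \<le> M * (t - s)"
          using dirM[OF f2(2), of "x + s *\<^sub>R e" "t - s"] \<open>s \<le> t\<close> by (simp add: add.assoc flip: scaleR_add_left)
        then show ?thesis unfolding wM by (rule mult_left_mono[OF _ M0])
      qed
      finally show "a t \<le> a s" by (simp add: a_def algebra_simps power2_eq_square)
    next
      fix s
      have "\<bar>w \<bullet> (f2 (x + s *\<^sub>R e) - f2 (s *\<^sub>R e))\<bar> \<le> norm w * norm (f2 (x + s *\<^sub>R e) - f2 (s *\<^sub>R e))"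
        by (rule Cauchy_Schwarz_ineq2)
      also have "\<dots> \<le> M * (L * norm x)"
        using lip[OF f2(2), of "x + s *\<^sub>R e" "s *\<^sub>R e"] M0 by (auto simp: wM intro!: mult_left_mono)
      finally show "- M * (L * norm x) \<le> a s"
        using wM by (simp add: a_def f2t inner_diff_right power2_norm_eq_inner[symmetric] abs_le_iff algebra_simps)
    next
      fix s
      have "(\<lambda>n. w \<bullet> h (k3 n) (x + s *\<^sub>R e) - M\<^sup>2 * s) \<longlonglongrightarrow> A s"
        unfolding A_def by (intro tendsto_intros f3)
      moreover have "w \<bullet> h n (x + s *\<^sub>R e) - M\<^sup>2 * s = a (s + real n)" for n
        using wM by (simp add: h_def blowup_def a_def f2t inner_diff_right power2_norm_eq_inner[symmetric] algebra_simps)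
      ultimately show "(\<lambda>n. a (s + real (k3 n))) \<longlonglongrightarrow> A s" by simp
    qed
    \<comment> \<open>Constancy of \<open>A\<close> fixes the component of \<open>v\<close> along
      \<open>w\<close>, and \<open>dirM\<close> bounds the length of \<open>v\<close> by that same
      amount, so nothing remains orthogonal to \<open>w\<close>.\<close>
    define v where "v = f3 (x + t *\<^sub>R e) - f3 x"
    have wv: "w \<bullet> v = M\<^sup>2 * t" using \<open>A t = A 0\<close> by (simp add: A_def v_def inner_diff_right)
    have "norm v \<le> M * \<bar>t\<bar>" using dirM[OF f3(2)] by (simp add: v_def)
    then have "(norm v)\<^sup>2 \<le> M\<^sup>2 * t\<^sup>2" using power_mono[of "norm v" "M * \<bar>t\<bar>" 2] by (simp add: power_mult_distrib)
    moreover have "(norm (v - t *\<^sub>R w))\<^sup>2 = (norm v)\<^sup>2 - 2 * t * (w \<bullet> v) + t\<^sup>2 * (norm w)\<^sup>2"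
      unfolding power2_norm_eq_inner by (simp add: algebra_simps inner_commute power2_eq_square)
    ultimately have "(norm (v - t *\<^sub>R w))\<^sup>2 \<le> 0" unfolding wv wM by (simp add: power2_eq_square algebra_simps)
    then show ?thesis by (simp add: v_def algebra_simps)
  qed
  define \<G> where "\<G> = {f\<in>\<F>. \<forall>x t. f (x + t *\<^sub>R e) = f x + t *\<^sub>R w}"
  have "blowup_closed L \<G>" unfolding blowup_closed_def
  proof (intro conjI ballI allI impI)
    show "\<G> \<noteq> {}" using f3 f3w by (auto simp: \<G>_def)
  next
    fix f x and r :: real assume "f \<in> \<G>" "r > 0"
    then have inv: "f (y + t *\<^sub>R e) = f y + t *\<^sub>R w" for y t by (simp add: \<G>_def)
    have "blowup f x r (y + t *\<^sub>R e) = blowup f x r y + t *\<^sub>R w" for y t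
      using inv[of "x + r *\<^sub>R y" "r * t"] \<open>r > 0\<close> by (simp add: blowup_def algebra_simps)
    then show "blowup f x r \<in> \<G>" using blow \<open>f \<in> \<G>\<close> \<open>r > 0\<close> by (simp add: \<G>_def)
  next
    fix f g assume f: "\<forall>n. f n \<in> \<G>" and g: "\<forall>x. (\<lambda>n::nat. f n x) \<longlonglongrightarrow> g x"
    have "g \<in> \<F>" using bc f g unfolding blowup_closed_def \<G>_def by blast
    moreover have "g (x + t *\<^sub>R e) = g x + t *\<^sub>R w" for x t
    proof (rule LIMSEQ_unique)
      show "(\<lambda>n. f n (x + t *\<^sub>R e)) \<longlonglongrightarrow> g (x + t *\<^sub>R e)" using g by blast
      have "(\<lambda>n. f n x + t *\<^sub>R w) \<longlonglongrightarrow> g x + t *\<^sub>R w" using g by (intro tendsto_intros) auto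
      then show "(\<lambda>n. f n (x + t *\<^sub>R e)) \<longlonglongrightarrow> g x + t *\<^sub>R w" using f by (simp add: \<G>_def)
    qed
    ultimately show "g \<in> \<G>" by (simp add: \<G>_def)
  qed (use zero lip in \<open>auto simp: \<G>_def\<close>)
  then show thesis by (intro that[of \<G>]) (auto simp: \<G>_def)
qed

text \<open>Equivariance along earlier basis vectors holds for all members, so it survives the
  passage to a subfamily for the next vector. A map that vanishes at \<open>0\<close> and is
  equivariant along every basis vector is linear.\<close>

lemma blowup_closed_contains_linear:
  fixes \<F> :: "('a::euclidean_space \<Rightarrow> 'a) set"
  assumes bc: "blowup_closed L \<F>" and "L \<ge> 0"
  obtains f where "f \<in> \<F>" "linear f"
proof -
  have "\<exists>\<G> w. \<G> \<subseteq> \<F> \<and> blowup_closed L \<G> \<and> (\<forall>e\<in>B. \<forall>f\<in>\<G>. \<forall>x t. f (x + t *\<^sub>R e) = f x + t *\<^sub>R (w e))"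
    if "finite B" for B :: "'a set"
    using that
  proof (induction B)
    case empty
    then show ?case using bc by auto
  next
    case (insert e B)
    then obtain \<G> w where G: "\<G> \<subseteq> \<F>" "blowup_closed L \<G>"
      "\<And>e f x t. e \<in> B \<Longrightarrow> f\<in>\<G> \<Longrightarrow> f (x + t *\<^sub>R e) = f x + t *\<^sub>R (w e)" by blast
    obtain v \<H> where H: "\<H> \<subseteq> \<G>" "blowup_closed L \<H>" "\<And>f x t. f \<in> \<H> \<Longrightarrow> f (x + t *\<^sub>R e) = f x + t *\<^sub>R v"
      using blowup_closed_translation_invariant[OF G(2) \<open>L \<ge> 0\<close>] by metis
    have "\<forall>e'\<in>insert e B. \<forall>f\<in>\<H>. \<forall>x t. f (x + t *\<^sub>R e') = f x + t *\<^sub>R ((w(e := v)) e')"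
      using G(3) H(1,3) insert.hyps by auto
    then show ?case using H(1,2) G(1) by (meson order_trans)
  qed
  from this[OF finite_Basis] obtain \<G> w where G: "\<G> \<subseteq> \<F>" "blowup_closed L \<G>"
      "\<And>e f x t. e \<in> Basis \<Longrightarrow> f\<in>\<G> \<Longrightarrow> f (x + t *\<^sub>R e) = f x + t *\<^sub>R (w e)" by blast
  then obtain f where f: "f \<in> \<G>" unfolding blowup_closed_def by blast
  have f0: "f 0 = 0" using G(2) f unfolding blowup_closed_def by blast
  have sum: "f (\<Sum>e\<in>B. c e *\<^sub>R e) = (\<Sum>e\<in>B. c e *\<^sub>R w e)" if "finite B" "B \<subseteq> Basis" for B c
    using that
  proof (induction B)
    case (insert e B)
    then show ?case using G(3)[of e f "\<Sum>e\<in>B. c e *\<^sub>R e" "c e"] f by (simp add: algebra_simps)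
  qed (simp add: f0)
  have "f y = (\<Sum>e\<in>Basis. (y \<bullet> e) *\<^sub>R w e)" for y
    using sum[OF finite_Basis order_refl, of "\<lambda>e. y \<bullet> e"] by (simp add: euclidean_representation)
  then have "f = (\<lambda>y. \<Sum>e\<in>Basis. (y \<bullet> e) *\<^sub>R w e)" by blast
  moreover have "linear (\<lambda>y. \<Sum>e\<in>Basis. (y \<bullet> e) *\<^sub>R w e)"
    by (rule linearI) (simp_all add: inner_add_left algebra_simps sum.distrib scaleR_sum_right)
  ultimately show thesis using that f G(1) by auto
qed

text \<open>The base point \<open>x\<close> may move while tending to \<open>b\<close>, unlike for
  an ordinary tangent at \<open>b\<close>. This is what makes the family closed under further
  blow-ups.\<close>

definition tangents :: "real \<Rightarrow> ('a::euclidean_space \<Rightarrow> 'a) \<Rightarrow> 'a \<Rightarrow> ('a \<Rightarrow> 'a) set" where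
  "tangents L F b = {f. f 0 = 0 \<and> (\<forall>x y. norm (f x - f y) \<le> L * norm (x - y)) \<and>
     (\<forall>R. \<forall>\<epsilon>>0. \<exists>x r. norm (x - b) \<le> \<epsilon> \<and> 0 < r \<and> r \<le> \<epsilon> \<and>
        (\<forall>y. norm y \<le> R \<longrightarrow> norm (blowup F x r y - f y) \<le> \<epsilon>))}"

text \<open>A blow-up of a tangent at \<open>x0\<close> with scale \<open>r0\<close> is approximated
  by the blow-up of \<open>F\<close> at \<open>x + r x0\<close> with scale \<open>r r0\<close>.
  Nonemptiness comes from compactness with base point \<open>b\<close> kept fixed.\<close>

lemma blowup_closed_tangents:
  fixes F :: "'a::euclidean_space \<Rightarrow> 'a"
  assumes lip: "\<And>x y. norm (F x - F y) \<le> L * norm (x - y)" and "L \<ge> 0"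
  shows "blowup_closed L (tangents L F b)"
proof -
  have blip: "norm (blowup F x r y - blowup F x r z) \<le> L * norm (y - z)" if "r > 0" for x r y z
  proof -
    have "norm (F (x + r *\<^sub>R y) - F (x + r *\<^sub>R z)) \<le> L * (r * norm (y - z))"
      using lip[of "x + r *\<^sub>R y" "x + r *\<^sub>R z"] that by (simp flip: scaleR_diff_right)
    then show ?thesis using that by (simp add: blowup_def flip: scaleR_diff_right) (simp add: field_simps)
  qed
  have approx: "\<exists>x r. norm (x - b) \<le> \<epsilon> \<and> 0 < r \<and> r \<le> \<epsilon> \<and>
        (\<forall>y. norm y \<le> R \<longrightarrow> norm (blowup F x r y - f y) \<le> \<epsilon>)"
    if "f \<in> tangents L F b" "\<epsilon> > 0" for f R \<epsilon> using that unfolding tangents_def by blast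
  show ?thesis unfolding blowup_closed_def
  proof (intro conjI ballI allI impI)
    define f where "f n = blowup F b (1 / real (Suc n))" for n
    obtain g k where k: "strict_mono (k :: nat \<Rightarrow> nat)" and g: "\<And>x. (\<lambda>n. f (k n) x) \<longlonglongrightarrow> g x"
      "\<And>x y. norm (g x - g y) \<le> L * norm (x - y)"
      by (rule almost_lipschitz_convergent_subsequence[of f L "\<lambda>_. 0" 0])
         (use blip \<open>L \<ge> 0\<close> in \<open>auto simp: f_def blowup_def[of _ _ _ 0]\<close>)
    have "g 0 = 0" by (rule LIMSEQ_unique[OF g(1)]) (simp add: f_def blowup_def)
    moreover have "\<exists>x r. norm (x - b) \<le> \<epsilon> \<and> 0 < r \<and> r \<le> \<epsilon> \<and>
        (\<forall>y. norm y \<le> R \<longrightarrow> norm (blowup F x r y - g y) \<le> \<epsilon>)" if "\<epsilon> > 0" for \<epsilon> R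
    proof -
      have "\<forall>\<^sub>F n in sequentially. \<forall>y\<in>cball 0 R. norm (f (k n) y - g y) < \<epsilon>"
        by (rule almost_lipschitz_uniform_limit[where \<epsilon> = "\<lambda>_. 0" and L = L])
           (use blip \<open>L \<ge> 0\<close> that g in \<open>auto simp: f_def\<close>)
      moreover have "\<forall>\<^sub>F n in sequentially. 1 / real (Suc n) < \<epsilon>"
        using LIMSEQ_Suc[OF lim_1_over_n] that by (rule order_tendstoD)
      then have "\<forall>\<^sub>F n in sequentially. 1 / real (Suc (k n)) < \<epsilon>"
        by (rule eventually_subseq[OF k])
      ultimately have "\<forall>\<^sub>F n in sequentially. (\<forall>y\<in>cball 0 R. norm (f (k n) y - g y) < \<epsilon>) \<and> 1 / real (Suc (k n)) < \<epsilon>"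
        by eventually_elim auto
      then obtain n where "\<forall>y\<in>cball 0 R. norm (f (k n) y - g y) < \<epsilon>" "1 / real (Suc (k n)) < \<epsilon>"
        using eventually_happens'[OF sequentially_bot] by blast
      then show ?thesis using that by (intro exI[of _ b] exI[of _ "1 / real (Suc (k n))"]) (auto simp: f_def less_imp_le)
    qed
    ultimately have "g \<in> tangents L F b" using g(2) unfolding tangents_def by blast
    then show "tangents L F b \<noteq> {}" by blast
  next
    fix f x0 and r0 :: real assume f: "f \<in> tangents L F b" and "r0 > 0"
    have flip: "norm (f x - f y) \<le> L * norm (x - y)" for x y using f unfolding tangents_def by blast
    have "norm (blowup f x0 r0 y - blowup f x0 r0 z) \<le> L * norm (y - z)" for y z
    proof -
      have "norm (f (x0 + r0 *\<^sub>R y) - f (x0 + r0 *\<^sub>R z)) \<le> L * (r0 * norm (y - z))"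
        using flip[of "x0 + r0 *\<^sub>R y" "x0 + r0 *\<^sub>R z"] \<open>r0 > 0\<close> by (simp flip: scaleR_diff_right)
      then show ?thesis using \<open>r0 > 0\<close> by (simp add: blowup_def flip: scaleR_diff_right) (simp add: field_simps)
    qed
    moreover have "\<exists>x r. norm (x - b) \<le> \<epsilon> \<and> 0 < r \<and> r \<le> \<epsilon> \<and>
        (\<forall>y. norm y \<le> R \<longrightarrow> norm (blowup F x r y - blowup f x0 r0 y) \<le> \<epsilon>)" if "\<epsilon> > 0" for \<epsilon> R
    proof -
      \<comment> \<open>The three bounds control, in this order, the drift of the base point by
        \<open>r x0\<close>, the new scale \<open>r r0\<close>, and two approximation errors divided
        by \<open>r0\<close>.\<close>
      define \<delta> where "\<delta> = min (\<epsilon> / (1 + norm x0)) (min (\<epsilon> / r0) (\<epsilon> * r0 / 2))"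
      have n0: "1 + norm x0 > 0" by (simp add: add_pos_nonneg)
      have "\<delta> > 0" unfolding \<delta>_def using that \<open>r0 > 0\<close> n0 by simp
      have \<delta>: "\<delta> * (1 + norm x0) \<le> \<epsilon>" "\<delta> * r0 \<le> \<epsilon>" "2 * \<delta> \<le> \<epsilon> * r0"
      proof -
        have "\<delta> \<le> \<epsilon> / (1 + norm x0)" "\<delta> \<le> \<epsilon> / r0" "\<delta> \<le> \<epsilon> * r0 / 2" unfolding \<delta>_def
          by (rule min.cobounded1, rule min.coboundedI2[OF min.cobounded1], rule min.coboundedI2[OF min.cobounded2])
        then show "\<delta> * (1 + norm x0) \<le> \<epsilon>" "\<delta> * r0 \<le> \<epsilon>" "2 * \<delta> \<le> \<epsilon> * r0" using n0 \<open>r0 > 0\<close> by (simp_all add: pos_le_divide_eq)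
      qed
      obtain x r where xr: "norm (x - b) \<le> \<delta>" "0 < r" "r \<le> \<delta>"
        "\<And>y. norm y \<le> norm x0 + r0 * \<bar>R\<bar> \<Longrightarrow> norm (blowup F x r y - f y) \<le> \<delta>"
        using approx[OF f \<open>\<delta> > 0\<close>] by metis
      have "norm (x + r *\<^sub>R x0 - b) \<le> \<epsilon>"
      proof -
        have "norm (x + r *\<^sub>R x0 - b) \<le> norm (x - b) + r * norm x0" using xr(2) norm_triangle_ineq[of "x - b" "r *\<^sub>R x0"] by (simp add: algebra_simps)
        also have "\<dots> \<le> \<delta> + \<delta> * norm x0" using xr by (intro add_mono mult_right_mono) auto
        finally show ?thesis using \<delta>(1) by (simp add: algebra_simps)
      qed
      moreover have "r * r0 \<le> \<epsilon>" using xr(3) \<open>r0 > 0\<close> \<delta>(2) by (meson mult_right_mono less_imp_le order_trans)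
      moreover have "norm (blowup F (x + r *\<^sub>R x0) (r * r0) y - blowup f x0 r0 y) \<le> \<epsilon>" if "norm y \<le> R" for y
      proof -
        have "norm (x0 + r0 *\<^sub>R y) \<le> norm x0 + r0 * \<bar>R\<bar>"
        proof -
          have "norm (x0 + r0 *\<^sub>R y) \<le> norm x0 + r0 * norm y"
            using norm_triangle_ineq[of x0 "r0 *\<^sub>R y"] \<open>r0 > 0\<close> by simp
          also have "\<dots> \<le> norm x0 + r0 * \<bar>R\<bar>"
            using that \<open>r0 > 0\<close> by (intro add_left_mono mult_left_mono) auto
          finally show ?thesis .
        qed
        then have a: "norm (blowup F x r (x0 + r0 *\<^sub>R y) - f (x0 + r0 *\<^sub>R y)) \<le> \<delta>" using xr(4) by blast
        have "r0 * \<bar>R\<bar> \<ge> 0" using \<open>r0 > 0\<close> by simp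
        then have b: "norm (blowup F x r x0 - f x0) \<le> \<delta>" using xr(4) by simp
        have e: "blowup F (x + r *\<^sub>R x0) (r * r0) y - blowup f x0 r0 y =
          ((blowup F x r (x0 + r0 *\<^sub>R y) - f (x0 + r0 *\<^sub>R y)) - (blowup F x r x0 - f x0)) /\<^sub>R r0"
          using \<open>r0 > 0\<close> xr(2) by (simp add: blowup_def algebra_simps)
        have "norm ((blowup F x r (x0 + r0 *\<^sub>R y) - f (x0 + r0 *\<^sub>R y)) - (blowup F x r x0 - f x0)) \<le> 2 * \<delta>"
          using a b by norm
        then have "norm ((blowup F x r (x0 + r0 *\<^sub>R y) - f (x0 + r0 *\<^sub>R y)) - (blowup F x r x0 - f x0)) \<le> \<epsilon> * r0"
          using \<delta>(3) by linarith
        then show ?thesis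
          unfolding e norm_scaleR using \<open>r0 > 0\<close> by (simp add: divide_inverse_commute[symmetric] pos_divide_le_eq)
      qed
      ultimately show ?thesis using xr(2) \<open>r0 > 0\<close> by (intro exI[of _ "x + r *\<^sub>R x0"] exI[of _ "r * r0"]) auto
    qed
    moreover have "blowup f x0 r0 0 = 0" by (simp add: blowup_def)
    ultimately show "blowup f x0 r0 \<in> tangents L F b" unfolding tangents_def by blast
  next
    fix f g assume f: "\<forall>n. f n \<in> tangents L F b" and g: "\<forall>x. (\<lambda>n::nat. f n x) \<longlonglongrightarrow> g x"
    have flip: "norm (f n x - f n y) \<le> L * norm (x - y)" and fz: "f n 0 = 0" for x y n
      using f unfolding tangents_def by blast+
    have glip: "norm (g x - g y) \<le> L * norm (x - y)" for x y
      by (rule LIMSEQ_le_const2[where X = "\<lambda>n. norm (f n x - f n y)"]) (use flip g in \<open>auto intro!: tendsto_intros\<close>)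
    moreover have "g 0 = 0" by (rule LIMSEQ_unique[OF g[rule_format]]) (simp add: fz)
    moreover have "\<exists>x r. norm (x - b) \<le> \<epsilon> \<and> 0 < r \<and> r \<le> \<epsilon> \<and>
        (\<forall>y. norm y \<le> R \<longrightarrow> norm (blowup F x r y - g y) \<le> \<epsilon>)" if "\<epsilon> > 0" for \<epsilon> R
    proof -
      have "\<forall>\<^sub>F n in sequentially. \<forall>y\<in>cball 0 R. norm (f n y - g y) < \<epsilon>/2"
        by (rule almost_lipschitz_uniform_limit[where \<epsilon> = "\<lambda>_. 0" and L = L])
           (use flip glip \<open>L \<ge> 0\<close> that g in auto)
      then obtain n where n: "\<forall>y\<in>cball 0 R. norm (f n y - g y) < \<epsilon>/2"
        using eventually_happens'[OF sequentially_bot] by blast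
      have "0 < \<epsilon> / 2" using that by simp
      then obtain x r where xr: "norm (x - b) \<le> \<epsilon>/2" "0 < r" "r \<le> \<epsilon>/2"
        "\<And>y. norm y \<le> R \<Longrightarrow> norm (blowup F x r y - f n y) \<le> \<epsilon>/2"
        using approx[OF f[rule_format, of n], of "\<epsilon>/2" R] by blast
      have "norm (blowup F x r y - g y) \<le> \<epsilon>" if "norm y \<le> R" for y
      proof -
        have "norm (f n y - g y) < \<epsilon>/2" "norm (blowup F x r y - f n y) \<le> \<epsilon>/2" using n xr(4) that by auto
        then show ?thesis by norm
      qed
      then show ?thesis using xr(1-3) by (intro exI[of _ x] exI[of _ r]) auto
    qed
    ultimately show "g \<in> tangents L F b" unfolding tangents_def by blast
  qed (auto simp: tangents_def)
qed

section \<open>Robust sheets of measure transporting maps\<close>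

text \<open>Density bounds stated without a density, so that Lebesgue measure and the oscillating
  measure can stand on either side of a transport.\<close>

definition comparable :: "'a::euclidean_space measure \<Rightarrow> bool" where
  "comparable M \<longleftrightarrow> sets M = sets borel \<and>
     (\<forall>B\<in>sets borel. emeasure lborel B \<le> emeasure M B \<and> emeasure M B \<le> 2 * emeasure lborel B)"

lemma comparable_fmeasurable:
  assumes "comparable M" "bounded B" "B \<in> sets borel"
  shows "B \<in> fmeasurable M"
proof (rule fmeasurableI)
  show "B \<in> sets M" using assms by (simp add: comparable_def)
  have "emeasure lborel B < \<infinity>" by (rule emeasure_bounded_finite[OF assms(2)])
  moreover have "emeasure M B \<le> 2 * emeasure lborel B" using assms by (simp add: comparable_def)
  ultimately show "emeasure M B < \<infinity>" by (simp add: ennreal_mult_less_top le_less_trans)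
qed

lemma comparable_measure:
  assumes "comparable M" "bounded B" "B \<in> sets borel"
  shows "measure lborel B \<le> measure M B" "measure M B \<le> 2 * measure lborel B"
proof -
  have f: "emeasure M B \<noteq> \<infinity>" "emeasure lborel B \<noteq> \<infinity>"
    using comparable_fmeasurable[OF assms] emeasure_bounded_finite[OF assms(2)] by (auto simp: fmeasurable_def)
  have "ennreal (measure lborel B) \<le> ennreal (measure M B)"
    "ennreal (measure M B) \<le> 2 * ennreal (measure lborel B)"
    using assms f by (auto simp: comparable_def emeasure_eq_ennreal_measure[symmetric])
  moreover have "2 * ennreal (measure lborel B) = ennreal (2 * measure lborel B)"
    by (simp add: ennreal_mult)
  ultimately show "measure lborel B \<le> measure M B" "measure M B \<le> 2 * measure lborel B"
    by (auto simp: measure_nonneg)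
qed

lemma comparable_lborel: "comparable lborel"
  unfolding comparable_def
  by (auto intro: order_trans[OF _ mult_right_mono[of 1 2]])

text \<open>A substitute for nonzero degree over \<open>U\<close>: the values on the sphere alone
  force \<open>U\<close> to be covered, so \<open>F\<close> may be altered freely inside the
  ball.\<close>

definition robust_sheet :: "('a::euclidean_space \<Rightarrow> 'a) \<Rightarrow> 'a \<Rightarrow> real \<Rightarrow> 'a set \<Rightarrow> bool" where
  "robust_sheet F c r U \<longleftrightarrow> (\<forall>g. continuous_on (cball c r) g \<longrightarrow> (\<forall>x\<in>sphere c r. g x = F x) \<longrightarrow> U \<subseteq> g ` cball c r)"

text \<open>
  If \<open>g\<close> missed \<open>u\<close>, then Brouwer's theorem for the negative of the normalised \<open>A\<^sup>-\<^sup>1 (g - u)\<close> would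
  contradict the closeness of \<open>g\<close> to \<open>A\<close> on the sphere.
\<close>
lemma robust_sheet_near_linear:
  fixes F :: "'a::euclidean_space \<Rightarrow> 'a"
  assumes A: "linear A" "inj A" and c: "c > 0" "\<And>y. c * norm y \<le> norm (A y)"
    and r: "r > 0" and near: "\<And>y. norm y \<le> 1 \<Longrightarrow> norm (blowup F x r y - A y) \<le> c / 4"
  shows "robust_sheet F x r (ball (F x) (r * c / 2))"
  unfolding robust_sheet_def
proof (intro allI impI subsetI, rule ccontr)
  fix g u
  assume g: "continuous_on (cball x r) g" "\<forall>x\<in>sphere x r. g x = F x" and u: "u \<in> ball (F x) (r * c / 2)"
    and notin: "u \<notin> g ` cball x r"
  obtain A' where A': "linear A'" "\<And>y. A' (A y) = y" "\<And>y. A (A' y) = y"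
    using linear_injective_isomorphism[OF A] by blast
  define G where "G y = A' ((g (x + r *\<^sub>R y) - u) /\<^sub>R r)" for y
  have mem: "x + r *\<^sub>R y \<in> cball x r" if "norm y \<le> 1" for y
    using that r by (simp add: dist_norm)
  have G0: "G y \<noteq> 0" if "norm y \<le> 1" for y
  proof
    assume "G y = 0"
    then have "(g (x + r *\<^sub>R y) - u) /\<^sub>R r = 0" using A'(3)[of "(g (x + r *\<^sub>R y) - u) /\<^sub>R r"] linear_0[OF A(1)] by (simp add: G_def)
    then have "g (x + r *\<^sub>R y) = u" using r by simp
    then show False using notin mem[OF that] by blast
  qed
  have contG: "continuous_on (cball 0 1) G"
  proof -
    have "continuous_on (cball 0 1) (\<lambda>y. g (x + r *\<^sub>R y))"
      by (rule continuous_on_compose2[OF g(1)]) (use mem in \<open>auto intro!: continuous_intros\<close>)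
    then have "continuous_on (cball 0 1) (\<lambda>y. (g (x + r *\<^sub>R y) - u) /\<^sub>R r)" by (intro continuous_intros)
    then show ?thesis unfolding G_def
      by (rule continuous_on_compose2[OF linear_continuous_on[OF linear_conv_bounded_linear[THEN iffD1, OF A'(1)], of UNIV]]) auto
  qed
  obtain y where y: "y \<in> cball 0 1" "- (G y /\<^sub>R norm (G y)) = y"
  proof (rule brouwer[of "cball 0 1 :: 'a set" "\<lambda>y. - (G y /\<^sub>R norm (G y))"])
    show "continuous_on (cball 0 1) (\<lambda>y. - (G y /\<^sub>R norm (G y)))"
      using G0 by (intro continuous_intros contG) auto
    show "(\<lambda>y. - (G y /\<^sub>R norm (G y))) \<in> cball 0 1 \<rightarrow> cball 0 1" using G0 by auto
  qed (auto intro: that)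
  have "norm (- (G y /\<^sub>R norm (G y))) = 1" using G0[of y] y(1) by simp
  then have ny: "norm y = 1" unfolding y(2) .
  have "norm (G y) *\<^sub>R y = norm (G y) *\<^sub>R (- (G y /\<^sub>R norm (G y)))" using y(2) by simp
  also have "\<dots> = - G y" using G0[of y] ny by simp
  finally have Gy: "G y = - (norm (G y) *\<^sub>R y)" by simp
  have "G y - y = - (norm (G y) *\<^sub>R y) - y" using Gy by (rule arg_cong)
  also have "\<dots> = - ((norm (G y) + 1) *\<^sub>R y)" by (simp add: algebra_simps)
  finally have "norm (G y - y) = norm (- ((norm (G y) + 1) *\<^sub>R y))" by (rule arg_cong)
  also have "\<dots> = norm (G y) + 1" using ny by (simp only: norm_minus_cancel norm_scaleR) auto
  finally have big: "norm (G y - y) \<ge> 1" by simp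
  have gy: "g (x + r *\<^sub>R y) = F (x + r *\<^sub>R y)" using g(2) ny r by (simp add: dist_norm)
  \<comment> \<open>On the sphere \<open>g\<close> is \<open>F\<close>, so the discrepancy consists
    of the tangent error, at most \<open>c / 4\<close>, and the rescaled offset of \<open>u\<close>,
    below \<open>c / 2\<close>. Their sum is less than the \<open>c\<close> forced by
    \<open>big\<close>.\<close>
  have "A (G y - y) = (blowup F x r y - A y) + (F x - u) /\<^sub>R r"
    by (simp add: linear_diff[OF A(1)] G_def A'(3) gy blowup_def algebra_simps)
  also have "norm \<dots> \<le> c / 4 + norm (F x - u) / r"
  proof -
    have "norm ((F x - u) /\<^sub>R r) = norm (F x - u) / r" using r by (simp add: divide_inverse mult.commute)
    then show ?thesis
      using near[of y] ny norm_triangle_ineq[of "blowup F x r y - A y" "(F x - u) /\<^sub>R r"] by linarith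
  qed
  also have "norm (F x - u) / r < c / 2" using u r by (simp add: dist_norm field_simps)
  finally have "norm (A (G y - y)) < c" using c(1) by simp
  then have "c * norm (G y - y) < c" using c(2)[of "G y - y"] by linarith
  then show False using big c(1) by (simp add: mult_less_cancel_left2)
qed

text \<open>\<open>S\<close> and \<open>T\<close> will be \<open>R\<close> and Lebesgue measure, in
  one order for each part of the theorem; the theory of sheets is the same for both.\<close>

locale lipschitz_transport =
  fixes F :: "'a::euclidean_space \<Rightarrow> 'a" and S T :: "'a measure" and L :: real
  assumes L: "1 \<le> L" and lip: "\<And>x y. norm (F x - F y) \<le> L * norm (x - y)"
    and S: "comparable S" and T: "comparable T"
    and transport: "\<And>K. compact K \<Longrightarrow> emeasure S (F -` K) = emeasure T K"
begin

lemma cont: "continuous_on A F"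
proof (rule lipschitz_on_continuous_on)
  show "L-lipschitz_on A F" using lip L by (intro lipschitz_onI) (auto simp: dist_norm)
qed

lemma vimage_closed: "closed K \<Longrightarrow> closed (F -` K)"
  using cont[of UNIV] by (simp add: closed_vimage continuous_on_closed_vimage)

lemma vimage_open: "open K \<Longrightarrow> open (F -` K)"
  using cont[of UNIV] by (simp add: open_vimage)

text \<open>The quantitative form of not collapsing volume: \<open>B\<close> lies in the preimage of
  \<open>K\<close>, whose \<open>S\<close>-measure is that of \<open>K\<close> under
  \<open>T\<close>. The factor 2 is the price of comparing with Lebesgue measure.\<close>

lemma measure_le_of_image_subset:
  assumes "B \<in> sets borel" "bounded B" "F ` B \<subseteq> K" "compact K"
  shows "measure S B \<le> measure T K" "measure lborel B \<le> 2 * measure lborel K"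
proof -
  have sB: "sets S = sets borel" using S by (simp add: comparable_def)
  have KT: "K \<in> fmeasurable T"
    using comparable_fmeasurable[OF T compact_imp_bounded[OF assms(4)] borel_compact[OF assms(4)]] .
  have "emeasure S B \<le> emeasure S (F -` K)"
    using assms vimage_closed[of K] sB by (intro emeasure_mono) (auto simp: compact_imp_closed borel_closed)
  also have "\<dots> = emeasure T K" by (rule transport[OF assms(4)])
  finally have "emeasure S B \<le> emeasure T K" .
  then show 1: "measure S B \<le> measure T K"
    using KT by (simp add: measure_def enn2real_mono fmeasurable_def)
  show "measure lborel B \<le> 2 * measure lborel K"
    using comparable_measure(1)[OF S assms(2,1)] 1
      comparable_measure(2)[OF T compact_imp_bounded[OF assms(4)] borel_compact[OF assms(4)]]
    by linarith
qed

text \<open>Disjoint balls of radius \<open>r\<close> about the points of \<open>P\<close> all land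
  in one ball of radius \<open>R + L r\<close>. With \<open>R = 0\<close> this bounds the number of
  preimages of a point, with \<open>R\<close> proportional to \<open>r\<close> the size of connected
  preimages.\<close>

lemma packing:
  assumes P: "finite P" and r: "r > 0" and "R \<ge> 0"
    and sep: "\<And>x y. x \<in> P \<Longrightarrow> y \<in> P \<Longrightarrow> x \<noteq> y \<Longrightarrow> 2 * r < dist x y"
    and im: "F ` P \<subseteq> cball u R"
  shows "real (card P) * r ^ DIM('a) \<le> 2 * (R + L * r) ^ DIM('a)"
proof -
  define V where "V = unit_ball_vol (real DIM('a))"
  have "V > 0" by (simp add: V_def unit_ball_vol_pos)
  have disj: "disjoint_family_on (\<lambda>x. cball x r) P"
    unfolding disjoint_family_on_def
  proof (intro ballI impI)
    fix x y assume "x \<in> P" "y \<in> P" "x \<noteq> y"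
    then have "2 * r < dist x y" by (rule sep)
    have False if "z \<in> cball x r" "z \<in> cball y r" for z
      using that dist_triangle2[of x y z] \<open>2 * r < dist x y\<close> by auto
    then show "cball x r \<inter> cball y r = {}" by blast
  qed
  have "measure lborel (\<Union>x\<in>P. cball x r) = (\<Sum>x\<in>P. measure lborel (cball x r))"
    using P disj by (intro measure_finite_Union) (auto simp: emeasure_cball r less_imp_le)
  also have "\<dots> = real (card P) * (V * r ^ DIM('a))" using r by (simp add: content_cball V_def)
  finally have 1: "measure lborel (\<Union>x\<in>P. cball x r) = real (card P) * (V * r ^ DIM('a))" .
  have "measure lborel (\<Union>x\<in>P. cball x r) \<le> 2 * measure lborel (cball u (R + L * r))"
  proof (rule measure_le_of_image_subset(2))
    show "(\<Union>x\<in>P. cball x r) \<in> sets borel" using P by (intro sets.finite_UN) auto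
    show "F ` (\<Union>x\<in>P. cball x r) \<subseteq> cball u (R + L * r)"
    proof clarify
      fix z x assume "x \<in> P" "z \<in> cball x r"
      have "dist u (F x) \<le> R" using im \<open>x \<in> P\<close> by auto
      moreover have "norm (F x - F z) \<le> L * r"
      proof -
        have "L * norm (x - z) \<le> L * r" using \<open>z \<in> cball x r\<close> L by (intro mult_left_mono) (auto simp: dist_norm)
        then show ?thesis using lip[of x z] by linarith
      qed
      ultimately show "F z \<in> cball u (R + L * r)"
        using dist_triangle[of u "F z" "F x"] by (simp add: dist_norm)
    qed
  qed (use P in auto)
  also have "\<dots> = 2 * (V * (R + L * r) ^ DIM('a))" using L r \<open>R \<ge> 0\<close> by (simp add: content_cball V_def)
  finally have "V * (real (card P) * r ^ DIM('a)) \<le> V * (2 * (R + L * r) ^ DIM('a))"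
    unfolding 1 by (simp add: algebra_simps)
  then show ?thesis using \<open>V > 0\<close> by (rule mult_left_le_imp_le)
qed

text \<open>A singular linear map flattens the unit ball to a null set. If \<open>F\<close> looked
  like it at some scale, a ball would be mapped into a set of far too small volume.\<close>

lemma tangent_inj:
  assumes A: "A \<in> tangents L F b" "linear A"
  shows "inj A"
proof (rule ccontr)
  assume "\<not> inj A"
  define K where "K = A ` cball 0 1"
  define V where "V = unit_ball_vol (real DIM('a))"
  have "V > 0" by (simp add: V_def unit_ball_vol_pos)
  have "negligible K" unfolding K_def by (rule negligible_linear_singular_image[OF A(2) \<open>\<not> inj A\<close>])
  have "compact K" unfolding K_def
    by (intro compact_continuous_image linear_continuous_on linear_conv_bounded_linear[THEN iffD1] A(2) compact_cball)
  have "K \<in> null_sets lebesgue" using \<open>negligible K\<close> by (simp add: negligible_iff_null_sets)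
  \<comment> \<open>The bound \<open>V / 2\<close> beats the factor 2 lost in
    \<open>measure_le_of_image_subset\<close>.\<close>
  then obtain N where N: "open N" "K \<subseteq> N" "N - K \<in> lmeasurable" "emeasure lebesgue (N - K) < ennreal (V / 2)"
    using sets_lebesgue_outer_open[of K "V / 2"] \<open>V > 0\<close> by auto
  have eN: "emeasure lebesgue N = emeasure lebesgue (N - K)"
    using \<open>K \<in> null_sets lebesgue\<close> N(1,3) by (intro emeasure_Diff_null_set[symmetric]) auto
  then have N': "N \<in> lmeasurable" "measure lebesgue N < V / 2"
  proof -
    have lt: "emeasure lebesgue N < ennreal (V / 2)" using N(4) eN by simp
    then show f: "N \<in> lmeasurable" using N(1) by (auto simp: fmeasurable_def intro: order.strict_trans)
    show "measure lebesgue N < V / 2"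
      using lt f \<open>V > 0\<close> by (simp add: emeasure_eq_measure2 ennreal_less_iff)
  qed
  obtain \<epsilon> where \<epsilon>: "\<epsilon> > 0" "(\<Union>x\<in>K. cball x \<epsilon>) \<subseteq> N"
    using compact_subset_open_imp_cball_epsilon_subset[OF \<open>compact K\<close> N(1,2)] by blast
  obtain x r where xr: "0 < r" "\<And>y. norm y \<le> 1 \<Longrightarrow> norm (blowup F x r y - A y) \<le> \<epsilon>"
    using A(1) \<epsilon>(1) unfolding tangents_def by blast
  have sub: "F ` cball x r \<subseteq> (\<lambda>z. r *\<^sub>R z + F x) ` N"
  proof
    fix w assume "w \<in> F ` cball x r"
    then obtain z where z: "norm (x - z) \<le> r" "w = F z" by (auto simp: dist_norm)
    define y where "y = (z - x) /\<^sub>R r"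
    have zy: "z = x + r *\<^sub>R y" using xr(1) by (simp add: y_def)
    have "norm y \<le> 1" using z(1) xr(1) by (simp add: y_def norm_minus_commute pos_divide_le_eq divide_inverse_commute[symmetric])
    then have "blowup F x r y \<in> cball (A y) \<epsilon>" "A y \<in> K"
      using xr(2)[of y] by (auto simp: K_def dist_norm norm_minus_commute)
    then have "blowup F x r y \<in> N" using \<epsilon>(2) by blast
    moreover have "w = r *\<^sub>R blowup F x r y + F x" using xr(1) z zy by (simp add: blowup_def)
    ultimately show "w \<in> (\<lambda>z. r *\<^sub>R z + F x) ` N" by blast
  qed
  have img: "measure lebesgue ((\<lambda>z. r *\<^sub>R z + F x) ` N) = r ^ DIM('a) * measure lebesgue N"
    using measure_lebesgue_affine[of r "F x" N] xr(1) by (simp add: add.commute)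
  have "V * r ^ DIM('a) = measure lborel (cball x r)" using xr(1) by (simp add: content_cball V_def)
  also have "\<dots> \<le> 2 * measure lborel (F ` cball x r)"
    by (rule measure_le_of_image_subset(2)) (auto intro!: compact_continuous_image cont)
  also have "measure lborel (F ` cball x r) = measure lebesgue (F ` cball x r)"
    by (simp add: measure_completion borel_compact compact_continuous_image cont)
  also have "\<dots> \<le> measure lebesgue ((\<lambda>z. r *\<^sub>R z + F x) ` N)"
  proof (rule measure_mono_fmeasurable[OF sub])
    show "F ` cball x r \<in> sets lebesgue" by (simp add: borel_compact compact_continuous_image cont)
    have "emeasure lebesgue ((\<lambda>z. r *\<^sub>R z + F x) ` N) = ennreal (r ^ DIM('a)) * emeasure lebesgue N"
      using emeasure_lebesgue_affine[of r "F x" N] xr(1) by (simp add: add.commute ennreal_power)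
    moreover have "open ((\<lambda>z. r *\<^sub>R z + F x) ` N)"
      using open_affinity[OF N(1), of r "F x"] xr(1) by (simp add: add.commute)
    ultimately show "(\<lambda>z. r *\<^sub>R z + F x) ` N \<in> lmeasurable"
      using N'(1) by (auto simp: fmeasurable_def ennreal_mult_less_top)
  qed
  also have "\<dots> < r ^ DIM('a) * (V / 2)" unfolding img using N'(2) xr(1) by simp
  finally show False by simp
qed

lemma robust_sheet_exists:
  assumes "open B" "b \<in> B"
  obtains c r U where "r > 0" "cball c r \<subseteq> B" "open U" "U \<noteq> {}" "robust_sheet F c r U"
proof -
  obtain A where A: "A \<in> tangents L F b" "linear A"
    using blowup_closed_contains_linear[OF blowup_closed_tangents[of F L b]] lip L
    by (metis order_trans zero_le_one)
  have "inj A" by (rule tangent_inj[OF A])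
  obtain c where c: "c > 0" "\<And>y. c * norm y \<le> norm (A y)"
    using linear_inj_bounded_below_pos[OF A(2) \<open>inj A\<close>] by blast
  obtain \<beta> where \<beta>: "\<beta> > 0" "ball b \<beta> \<subseteq> B" using assms openE by blast
  \<comment> \<open>Drift of the centre and radius are each at most a third of
    \<open>\<beta>\<close>, which keeps the ball in \<open>B\<close>; \<open>c / 4\<close> is the
    closeness required by \<open>robust_sheet_near_linear\<close>.\<close>
  define \<epsilon> where "\<epsilon> = min (\<beta> / 3) (c / 4)"
  have "\<epsilon> > 0" using \<beta> c by (simp add: \<epsilon>_def)
  then obtain x r where xr: "norm (x - b) \<le> \<epsilon>" "0 < r" "r \<le> \<epsilon>" "\<And>y. norm y \<le> 1 \<Longrightarrow> norm (blowup F x r y - A y) \<le> \<epsilon>"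
    using A(1) unfolding tangents_def by blast
  show thesis
  proof
    show "cball x r \<subseteq> B"
    proof
      fix z assume "z \<in> cball x r"
      then have "dist b z \<le> \<epsilon> + \<epsilon>"
        using dist_triangle[of b z x] xr(1,3) by (simp add: dist_norm norm_minus_commute)
      also have "\<dots> < \<beta>" using \<beta>(1) by (auto simp: \<epsilon>_def min_def)
      finally show "z \<in> B" using \<beta>(2) by auto
    qed
    show "robust_sheet F x r (ball (F x) (r * c / 2))"
    proof (rule robust_sheet_near_linear[OF A(2) \<open>inj A\<close> c xr(2)])
      fix y :: 'a assume "norm y \<le> 1"
      from xr(4)[OF this] show "norm (blowup F x r y - A y) \<le> c / 4" by (simp add: \<epsilon>_def)
    qed
    have "F x \<in> ball (F x) (r * c / 2)" using xr(2) c(1) by simp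
    then show "ball (F x) (r * c / 2) \<noteq> {}" by blast
  qed (use xr(2) in auto)
qed

end

lemma robust_sheet_mono: "robust_sheet F c r U \<Longrightarrow> V \<subseteq> U \<Longrightarrow> robust_sheet F c r V"
  unfolding robust_sheet_def by (meson order_trans)

lemma finite_separation:
  fixes P :: "'a::metric_space set"
  assumes "finite P"
  obtains r where "r > 0" "\<And>x y. x \<in> P \<Longrightarrow> y \<in> P \<Longrightarrow> x \<noteq> y \<Longrightarrow> 2 * r < dist x y"
proof -
  define Q where "Q = insert 1 ((\<lambda>(x, y). dist x y) ` {(x, y) \<in> P \<times> P. x \<noteq> y})"
  have "finite {(x, y) \<in> P \<times> P. x \<noteq> y}" by (rule finite_subset[of _ "P \<times> P"]) (auto simp: assms)
  then have "finite Q" unfolding Q_def by simp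
  have "Min Q > 0" using \<open>finite Q\<close> by (subst Min_gr_iff) (auto simp: Q_def)
  show thesis
  proof (rule that[of "Min Q / 3"])
    fix x y assume "x \<in> P" "y \<in> P" "x \<noteq> y"
    then have "Min Q \<le> dist x y" by (intro Min_le[OF \<open>finite Q\<close>]) (auto simp: Q_def)
    then show "2 * (Min Q / 3) < dist x y" using \<open>Min Q > 0\<close> by linarith
  qed (use \<open>Min Q > 0\<close> in simp)
qed

section \<open>Maximal systems of disjoint robust balls\<close>

context lipschitz_transport
begin

definition sheets :: "nat \<Rightarrow> 'a set \<Rightarrow> (nat \<Rightarrow> 'a) \<Rightarrow> (nat \<Rightarrow> real) \<Rightarrow> bool" where
  "sheets n U c r \<longleftrightarrow> open U \<and> U \<noteq> {} \<and> (\<forall>i<n. 0 < r i \<and> robust_sheet F (c i) (r i) U) \<and>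
     (\<forall>i<n. \<forall>j<n. i \<noteq> j \<longrightarrow> cball (c i) (r i) \<inter> cball (c j) (r j) = {})"

lemma robust_sheet_image: "robust_sheet F c r U \<Longrightarrow> U \<subseteq> F ` cball c r"
  unfolding robust_sheet_def using cont by blast

text \<open>Each ball contains a preimage of one and the same point of \<open>U\<close>, and the
  balls are disjoint. Packing at a scale that separates these preimages gives a bound in which the
  scale cancels.\<close>

lemma sheets_bounded:
  assumes "sheets n U c r"
  shows "real n \<le> 2 * L ^ DIM('a)"
proof -
  obtain u where "u \<in> U" using assms unfolding sheets_def by blast
  have "\<forall>i<n. \<exists>x. x \<in> cball (c i) (r i) \<and> F x = u"
  proof (intro allI impI)
    fix i assume "i < n"
    then have "U \<subseteq> F ` cball (c i) (r i)" using assms robust_sheet_image unfolding sheets_def by blast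
    then show "\<exists>x. x \<in> cball (c i) (r i) \<and> F x = u" using \<open>u \<in> U\<close> by blast
  qed
  then obtain x where x: "\<And>i. i < n \<Longrightarrow> x i \<in> cball (c i) (r i) \<and> F (x i) = u" by metis
  have "inj_on x {..<n}"
    using x assms unfolding sheets_def by (intro inj_onI) (metis IntI empty_iff lessThan_iff)
  then have card: "card (x ` {..<n}) = n" by (simp add: card_image)
  obtain \<rho> where \<rho>: "\<rho> > 0" "\<And>y z. y \<in> x ` {..<n} \<Longrightarrow> z \<in> x ` {..<n} \<Longrightarrow> y \<noteq> z \<Longrightarrow> 2 * \<rho> < dist y z"
    using finite_separation[of "x ` {..<n}"] by blast
  have "real (card (x ` {..<n})) * \<rho> ^ DIM('a) \<le> 2 * (0 + L * \<rho>) ^ DIM('a)"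
    using \<rho> x by (intro packing[where u = u]) auto
  then have "real n * \<rho> ^ DIM('a) \<le> (2 * L ^ DIM('a)) * \<rho> ^ DIM('a)"
    unfolding card by (simp add: power_mult_distrib)
  then show ?thesis using \<rho>(1) by simp
qed

lemma sheets_mono:
  assumes "sheets n U c r" "open V" "V \<noteq> {}" "V \<subseteq> U"
  shows "sheets n V c r"
  using assms robust_sheet_mono[OF _ assms(4)] unfolding sheets_def by blast

lemma sheets_insert:
  assumes "sheets n U c r" "0 < \<rho>" "robust_sheet F x \<rho> U"
    "\<And>i. i < n \<Longrightarrow> cball x \<rho> \<inter> cball (c i) (r i) = {}"
  shows "sheets (Suc n) U (c(n := x)) (r(n := \<rho>))"
  using assms unfolding sheets_def less_Suc_eq by (auto simp: Int_commute)

lemma sheets_replace: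
  assumes sh: "sheets n U c r" and x: "0 < \<rho>" "robust_sheet F x \<rho> U" "cball x \<rho> \<subseteq> cball (c i) (r i)" and "i < n"
  shows "sheets n U (c(i := x)) (r(i := \<rho>))"
proof -
  have "cball ((c(i := x)) j) ((r(i := \<rho>)) j) \<subseteq> cball (c j) (r j)" for j using x(3) by simp
  moreover have "cball (c j) (r j) \<inter> cball (c k) (r k) = {}" if "j < n" "k < n" "j \<noteq> k" for j k
    using sh that unfolding sheets_def by blast
  ultimately have "cball ((c(i := x)) j) ((r(i := \<rho>)) j) \<inter> cball ((c(i := x)) k) ((r(i := \<rho>)) k) = {}"
    if "j < n" "k < n" "j \<noteq> k" for j k using that by blast
  then show ?thesis using sh x(1,2) unfolding sheets_def by auto
qed

text \<open>A new robust ball is found inside \<open>N\<close>. The set it covers lies in the image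
  of \<open>N\<close>, hence in \<open>U\<close>, so the common set can shrink to it while the old
  balls stay robust.\<close>

lemma sheets_extend:
  assumes sh: "sheets n U c r" and N: "open N" "N \<noteq> {}" "F ` N \<subseteq> U"
    and disj: "\<And>i. i < n \<Longrightarrow> N \<inter> cball (c i) (r i) = {}"
  obtains V c' r' where "sheets (Suc n) V c' r'"
proof -
  obtain b where "b \<in> N" using N by blast
  obtain x \<rho> V where V: "\<rho> > 0" "cball x \<rho> \<subseteq> N" "open V" "V \<noteq> {}" "robust_sheet F x \<rho> V"
    using robust_sheet_exists[OF N(1) \<open>b \<in> N\<close>] .
  have "V \<subseteq> U" using robust_sheet_image[OF V(5)] V(2) N(3) by blast
  from sheets_mono[OF sh V(3,4) this] have "sheets (Suc n) V (c(n := x)) (r(n := \<rho>))"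
    by (rule sheets_insert) (use V disj in blast)+
  then show thesis by (rule that)
qed

text \<open>
  If neither piece covered \<open>V\<close>, pushing \<open>F\<close> off a missed point on each piece would give a map that
  agrees with \<open>F\<close> on the sphere but misses \<open>V\<close>.
\<close>
lemma robust_sheet_separation:
  assumes rob: "robust_sheet F c r (ball y s)" and s: "s > 0"
    and PQ: "open P" "open Q" "P \<inter> Q = {}" "P \<subseteq> ball c r" "Q \<subseteq> ball c r"
    and un: "F -` ball y s \<inter> cball c r = P \<union> Q"
  shows "ball y s \<subseteq> F ` P \<or> ball y s \<subseteq> F ` Q"
proof (rule ccontr)
  assume "\<not> ?thesis"
  then obtain p q where p: "p \<in> ball y s" "p \<notin> F ` P" and q: "q \<in> ball y s" "q \<notin> F ` Q" by blast
  \<comment> \<open>The punctured ball retracts onto its bounding sphere; extended by the identity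
    outside, this clears the open ball of all values except the missed point
    \<open>a\<close>.\<close>
  have push: "\<exists>h. continuous_on (- {a}) h \<and> (\<forall>w. w \<notin> ball y s \<longrightarrow> h w = w) \<and> (\<forall>w. w \<noteq> a \<longrightarrow> h w \<notin> ball y s)"
    if a: "a \<in> ball y s" for a
  proof -
    obtain k where k: "retraction (- {a}) (sphere y s) k"
      using sphere_retract_of_punctured_universe_gen[OF a] unfolding retract_of_def by blast
    then have kc: "continuous_on (- {a}) k" and ki: "\<And>w. w \<noteq> a \<Longrightarrow> k w \<in> sphere y s"
      and kf: "\<And>w. w \<in> sphere y s \<Longrightarrow> k w = w"
      unfolding retraction_def by auto
    define h where "h w = (if w \<in> cball y s then k w else w)" for w
    have "continuous_on ((- {a} \<inter> cball y s) \<union> (- ball y s)) h"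
      unfolding h_def
    proof (rule continuous_on_cases_local)
      show "closedin (top_of_set (- {a} \<inter> cball y s \<union> - ball y s)) (- {a} \<inter> cball y s)"
        using a by (auto simp: closedin_closed intro!: exI[of _ "cball y s"])
      show "closedin (top_of_set (- {a} \<inter> cball y s \<union> - ball y s)) (- ball y s)"
        using a by (auto simp: closedin_closed intro!: exI[of _ "- ball y s"])
      show "continuous_on (- {a} \<inter> cball y s) k" by (rule continuous_on_subset[OF kc]) auto
    qed (use kf in auto)
    moreover have "- {a} \<inter> cball y s \<union> - ball y s = - {a}" using a by auto
    ultimately have "continuous_on (- {a}) h" by simp
    moreover have "h w = w" if "w \<notin> ball y s" for w using kf[of w] that by (auto simp: h_def)
    moreover have "h w \<notin> ball y s" if "w \<noteq> a" for w
      using ki[OF that] by (auto simp: h_def)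
    ultimately show ?thesis by blast
  qed
  obtain hp where hp: "continuous_on (- {p}) hp" "\<And>w. w \<notin> ball y s \<Longrightarrow> hp w = w" "\<And>w. w \<noteq> p \<Longrightarrow> hp w \<notin> ball y s"
    using push[OF p(1)] by blast
  obtain hq where hq: "continuous_on (- {q}) hq" "\<And>w. w \<notin> ball y s \<Longrightarrow> hq w = w" "\<And>w. w \<noteq> q \<Longrightarrow> hq w \<notin> ball y s"
    using push[OF q(1)] by blast
  \<comment> \<open>Off \<open>P\<close> and \<open>Q\<close> the values of \<open>F\<close> lie
    outside the ball, where both push maps are the identity. Hence the two pushes glue continuously
    and do not change \<open>F\<close> on the sphere.\<close>
  have out: "F x \<notin> ball y s" if "x \<in> cball c r" "x \<notin> P" "x \<notin> Q" for x using un that by blast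
  define g where "g x = (if x \<in> P then hp (F x) else hq (F x))" for x
  have "continuous_on ((cball c r - Q) \<union> (cball c r - P)) g"
    unfolding g_def
  proof (rule continuous_on_cases_local)
    show "closedin (top_of_set ((cball c r - Q) \<union> (cball c r - P))) (cball c r - Q)"
      using PQ by (auto simp: closedin_closed intro!: exI[of _ "cball c r - Q"])
    show "closedin (top_of_set ((cball c r - Q) \<union> (cball c r - P))) (cball c r - P)"
      using PQ by (auto simp: closedin_closed intro!: exI[of _ "cball c r - P"])
    have "F x \<noteq> p" if "x \<in> cball c r - Q" for x using out[of x] p that by blast
    then have "F ` (cball c r - Q) \<subseteq> - {p}" by blast
    then show "continuous_on (cball c r - Q) (\<lambda>x. hp (F x))"
      by (rule continuous_on_compose2[OF hp(1) cont])
    have "F x \<noteq> q" if "x \<in> cball c r - P" for x using out[of x] q that by blast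
    then have "F ` (cball c r - P) \<subseteq> - {q}" by blast
    then show "continuous_on (cball c r - P) (\<lambda>x. hq (F x))"
      by (rule continuous_on_compose2[OF hq(1) cont])
    show "hp (F x) = hq (F x)" if "x \<in> cball c r - Q \<and> x \<notin> P \<or> x \<in> cball c r - P \<and> x \<in> P" for x
      using that out[of x] hp(2) hq(2) by auto
  qed
  moreover have "cball c r - Q \<union> (cball c r - P) = cball c r" using PQ(3) by blast
  ultimately have "continuous_on (cball c r) g" by simp
  moreover have "g x = F x" if "x \<in> sphere c r" for x
  proof -
    have "x \<notin> P" "x \<notin> Q" using PQ(4,5) that by auto
    then show ?thesis using out[of x] that hq(2) by (auto simp: g_def)
  qed
  ultimately have "ball y s \<subseteq> g ` cball c r" using rob unfolding robust_sheet_def by blast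
  moreover have "y \<in> ball y s" using s by simp
  ultimately obtain x where x: "x \<in> cball c r" "g x \<in> ball y s" by (metis imageE subsetD)
  show False
  proof (cases "x \<in> P")
    case True
    then have "F x \<noteq> p" using p(2) by blast
    then show False using hp(3) x(2) True by (simp add: g_def)
  next
    case False
    have "F x \<noteq> q"
    proof (cases "x \<in> Q")
      case True
      then show ?thesis using q(2) by blast
    next
      case F: False
      then show ?thesis using out[OF x(1) False] q(1) by auto
    qed
    then show False using hq(3) x(2) False by (simp add: g_def)
  qed
qed

lemma maximal_sheets:
  obtains n U c r where "sheets n U c r" "0 < n" "\<And>V c' r'. \<not> sheets (Suc n) V c' r'"
proof -
  define P where "P n \<longleftrightarrow> (\<exists>U c r. sheets n U c r)" for n
  have "P 0" unfolding P_def sheets_def by (intro exI[of _ UNIV]) auto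
  have "sheets 0 UNIV (\<lambda>_. 0) (\<lambda>_. 1)" unfolding sheets_def by auto
  then have "P 1" unfolding P_def
    using sheets_extend[of 0 UNIV "\<lambda>_. 0" "\<lambda>_. 1" UNIV] by (metis One_nat_def less_nat_zero_code open_UNIV UNIV_not_empty subset_UNIV)
  have "n \<le> nat \<lceil>2 * L ^ DIM('a)\<rceil>" if "P n" for n
  proof -
    have "real n \<le> 2 * L ^ DIM('a)" using that sheets_bounded unfolding P_def by blast
    then show ?thesis by linarith
  qed
  then obtain n where n: "P n" "\<And>m. P m \<Longrightarrow> m \<le> n"
    using GreatestI_nat[of P 1] Greatest_le_nat[of P] \<open>P 1\<close> by blast
  then have "0 < n" using \<open>P 1\<close> by fastforce
  obtain U c r where "sheets n U c r" using n(1) unfolding P_def by blast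
  moreover have "\<not> sheets (Suc n) V c' r'" for V c' r'
    using n(2)[of "Suc n"] unfolding P_def by auto
  ultimately show thesis using that \<open>0 < n\<close> by blast
qed

text \<open>The part of the preimage of \<open>U\<close> outside all closed balls is open, so by
  maximality it is empty. A preimage on the sphere of one ball is excluded as well, since a slight
  radial push would lead outside all balls.\<close>

lemma maximal_sheets_cover:
  assumes sh: "sheets n U c r" and max: "\<And>V c' r'. \<not> sheets (Suc n) V c' r'"
    and x: "F x \<in> U"
  shows "\<exists>i<n. x \<in> ball (c i) (r i)"
proof (rule ccontr)
  assume no: "\<not> ?thesis"
  define N where "N = F -` U - (\<Union>i<n. cball (c i) (r i))"
  have "open U" using sh by (simp add: sheets_def)
  have "open N" unfolding N_def using vimage_open[OF \<open>open U\<close>] by (intro open_Diff closed_UN) auto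
  have "N = {}"
  proof (rule ccontr)
    assume "N \<noteq> {}"
    moreover have "F ` N \<subseteq> U" "\<And>i. i < n \<Longrightarrow> N \<inter> cball (c i) (r i) = {}" unfolding N_def by auto
    ultimately show False using sheets_extend[OF sh \<open>open N\<close>] max by metis
  qed
  then obtain i where i: "i < n" "x \<in> cball (c i) (r i)" using x unfolding N_def by blast
  then have xs: "dist (c i) x = r i" using no by force
  have ri: "r i > 0" using sh i by (simp add: sheets_def)
  define N' where "N' = F -` U - (\<Union>j\<in>{..<n} - {i}. cball (c j) (r j))"
  have "open N'" unfolding N'_def using vimage_open[OF \<open>open U\<close>] by (intro open_Diff closed_UN) auto
  moreover have "x \<in> N'" using x sh i unfolding N'_def sheets_def by blast
  ultimately obtain e where e: "e > 0" "ball x e \<subseteq> N'" using openE by blast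
  \<comment> \<open>The point moves outward by \<open>e / 2\<close>: it leaves the ball
    \<open>i\<close> but remains in \<open>N'\<close>, which avoids the other balls.\<close>
  define z where "z = x + (e / (2 * r i)) *\<^sub>R (x - c i)"
  have "dist x z = e / 2" using ri e(1) xs by (simp add: z_def dist_norm norm_minus_commute)
  then have zN: "z \<in> N'" using e by (simp add: subset_iff)
  have "z - c i = (1 + e / (2 * r i)) *\<^sub>R (x - c i)" by (simp add: z_def algebra_simps)
  then have "norm (z - c i) = \<bar>1 + e / (2 * r i)\<bar> * r i" using xs by (simp add: dist_norm norm_minus_commute)
  also have "\<dots> > r i" using e(1) ri by (simp add: field_simps)
  finally have "z \<notin> cball (c i) (r i)" by (simp add: dist_norm norm_minus_commute)
  with zN have "z \<in> N" unfolding N'_def N_def by blast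
  then show False using \<open>N = {}\<close> by blast
qed

text \<open>If the preimage split, one piece alone would cover the ball by
  \<open>robust_sheet_separation\<close>. The other piece is then free to carry an extra robust
  ball, and the sheet \<open>i\<close> could be traded for two.\<close>

lemma maximal_sheets_connected:
  assumes sh: "sheets n U c r" and max: "\<And>V c' r'. \<not> sheets (Suc n) V c' r'"
    and i: "i < n" and s: "s > 0" "ball y s \<subseteq> U"
  shows "connected (F -` ball y s \<inter> ball (c i) (r i))"
proof (rule ccontr)
  define V where "V = ball y s"
  define H where "H = F -` V \<inter> ball (c i) (r i)"
  assume "\<not> ?thesis"
  then obtain A B where AB: "open A" "open B" "H \<subseteq> A \<union> B" "A \<inter> B \<inter> H = {}" "A \<inter> H \<noteq> {}" "B \<inter> H \<noteq> {}"
    unfolding connected_def H_def V_def by blast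
  have "open H" unfolding H_def V_def using vimage_open by auto
  have shV: "sheets n V c r" using sheets_mono[OF sh _ _ s(2)] s(1) by (simp add: V_def)
  \<comment> \<open>The order of choice matters: the robust ball in \<open>Q\<close> comes first and
    covers \<open>V1\<close>, then one is found in \<open>P\<close> over part of \<open>V1\<close>,
    so that both cover the common set \<open>V2\<close>.\<close>
  have piece: False if P: "open P" "P \<subseteq> H" "V \<subseteq> F ` P" and Q: "open Q" "Q \<subseteq> H" "Q \<noteq> {}" "P \<inter> Q = {}" for P Q
  proof -
    obtain b where "b \<in> Q" using Q by blast
    obtain x1 r1 V1 where V1: "r1 > 0" "cball x1 r1 \<subseteq> Q" "open V1" "V1 \<noteq> {}" "robust_sheet F x1 r1 V1"
      using robust_sheet_exists[OF Q(1) \<open>b \<in> Q\<close>] .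
    have "V1 \<subseteq> V" using robust_sheet_image[OF V1(5)] V1(2) Q(2) unfolding H_def by blast
    obtain w where "w \<in> V1" using V1(4) by blast
    then obtain a where a: "a \<in> P \<inter> F -` V1" using P(3) \<open>V1 \<subseteq> V\<close> by blast
    have "open (P \<inter> F -` V1)" using P(1) vimage_open[OF V1(3)] by blast
    from robust_sheet_exists[OF this a] obtain x2 r2 V2 where
      V2: "r2 > 0" "cball x2 r2 \<subseteq> P \<inter> F -` V1" "open V2" "V2 \<noteq> {}" "robust_sheet F x2 r2 V2" .
    have "V2 \<subseteq> V1" using robust_sheet_image[OF V2(5)] V2(2) by blast
    have "sheets n V2 c r" using sheets_mono[OF shV V2(3,4)] \<open>V2 \<subseteq> V1\<close> \<open>V1 \<subseteq> V\<close> by blast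
    moreover have sub: "cball x1 r1 \<subseteq> cball (c i) (r i)" "cball x2 r2 \<subseteq> cball (c i) (r i)"
      using V1(2) V2(2) P(2) Q(2) unfolding H_def by (auto simp: subset_iff less_imp_le)
    ultimately have sh2: "sheets n V2 (c(i := x2)) (r(i := r2))"
      using V2 i by (intro sheets_replace) auto
    have "sheets (Suc n) V2 ((c(i := x2))(n := x1)) ((r(i := r2))(n := r1))"
    proof (rule sheets_insert[OF sh2 V1(1) robust_sheet_mono[OF V1(5) \<open>V2 \<subseteq> V1\<close>]])
      fix j assume "j < n"
      show "cball x1 r1 \<inter> cball ((c(i := x2)) j) ((r(i := r2)) j) = {}"
      proof (cases "j = i")
        case True
        then show ?thesis using V1(2) V2(2) Q(4) by auto
      next
        case False
        then have "cball (c i) (r i) \<inter> cball (c j) (r j) = {}"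
          using sh i \<open>j < n\<close> unfolding sheets_def by blast
        then show ?thesis using sub(1) False by auto
      qed
    qed
    then show False using max by blast
  qed
  \<comment> \<open>By \<open>maximal_sheets_cover\<close> every preimage lies in some open ball,
    and disjointness makes that the ball \<open>i\<close>. So the preimage does not touch the
    bounding sphere, as the separation lemma requires.\<close>
  have cb: "F -` ball y s \<inter> cball (c i) (r i) = (A \<inter> H) \<union> (B \<inter> H)"
  proof
    show "F -` ball y s \<inter> cball (c i) (r i) \<subseteq> A \<inter> H \<union> B \<inter> H"
    proof
      fix x assume x: "x \<in> F -` ball y s \<inter> cball (c i) (r i)"
      then obtain j where j: "j < n" "x \<in> ball (c j) (r j)"
        using maximal_sheets_cover[OF sh max, of x] s(2) by blast
      have "x \<in> cball (c j) (r j)" "x \<in> cball (c i) (r i)" using j(2) x by (auto simp: less_imp_le)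
      then have "j = i" using sh i j(1) unfolding sheets_def by blast
      then show "x \<in> A \<inter> H \<union> B \<inter> H" using x j AB(3) by (auto simp: H_def V_def)
    qed
  qed (auto simp: H_def V_def less_imp_le)
  have "ball y s \<subseteq> F ` (A \<inter> H) \<or> ball y s \<subseteq> F ` (B \<inter> H)"
  proof (rule robust_sheet_separation[OF _ s(1) _ _ _ _ _ cb])
    show "robust_sheet F (c i) (r i) (ball y s)" using shV i by (simp add: sheets_def V_def)
  qed (use AB \<open>open H\<close> in \<open>auto simp: H_def\<close>)
  then show False
    using piece[of "A \<inter> H" "B \<inter> H"] piece[of "B \<inter> H" "A \<inter> H"] AB \<open>open H\<close> unfolding V_def by blast
qed

text \<open>
  The points of a connected preimage of a ball of radius \<open>s\<close> at distances \<open>0, s, 2 s, \<dots>\<close> from \<open>x\<close> are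
  limited in number by packing, so such a preimage has diameter at most a constant times \<open>s\<close>.
\<close>
lemma connected_vimage_diameter:
  assumes H: "connected H" "F ` H \<subseteq> ball u s" and s: "s > 0" and x: "x \<in> H" "x' \<in> H"
  shows "norm (x - x') \<le> 2 * (3 + L) ^ DIM('a) * s"
proof -
  define m where "m = nat \<lfloor>norm (x - x') / s\<rfloor>"
  have "0 \<le> norm (x - x') / s" using s by simp
  then have m: "real m \<le> norm (x - x') / s" "norm (x - x') / s < real m + 1"
    unfolding m_def by linarith+
  have ms: "real m * s \<le> norm (x - x')" using m(1) s by (simp add: pos_le_divide_eq)
  have "connected ((\<lambda>y. norm (x - y)) ` H)"
    by (intro connected_continuous_image continuous_intros H(1))
  then have ivl: "t \<in> (\<lambda>y. norm (x - y)) ` H" if "0 \<le> t" "t \<le> norm (x - x')" for t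
  proof -
    have "0 \<in> (\<lambda>y. norm (x - y)) ` H" using x(1) by (intro image_eqI[of _ _ x]) auto
    moreover have "norm (x - x') \<in> (\<lambda>y. norm (x - y)) ` H" using x(2) by blast
    ultimately show ?thesis using \<open>connected ((\<lambda>y. norm (x - y)) ` H)\<close> that unfolding connected_iff_interval by blast
  qed
  have "\<forall>k\<le>m. \<exists>y\<in>H. norm (x - y) = real k * s"
  proof (intro allI impI)
    fix k assume "k \<le> m"
    then have "real k * s \<le> real m * s" using s by simp
    then have "real k * s \<in> (\<lambda>y. norm (x - y)) ` H" using s order_trans[OF _ ms] by (intro ivl) auto
    then show "\<exists>y\<in>H. norm (x - y) = real k * s" by auto
  qed
  then obtain y where y: "\<And>k. k \<le> m \<Longrightarrow> y k \<in> H" "\<And>k. k \<le> m \<Longrightarrow> norm (x - y k) = real k * s" by metis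
  \<comment> \<open>The chosen points are \<open>s\<close> apart by the reverse triangle inequality,
    so balls of radius \<open>s / 3\<close> about them are disjoint with room to spare;
    \<open>(3 + L) ^ DIM('a)\<close> in the final constant comes from this radius.\<close>
  have sep: "2 * (s / 3) < dist (y k) (y l)" if "k \<le> m" "l \<le> m" "k \<noteq> l" for k l
  proof -
    have "s * 1 \<le> s * \<bar>real k - real l\<bar>" using that s by (intro mult_left_mono) auto
    also have "\<dots> = \<bar>norm (x - y k) - norm (x - y l)\<bar>"
      using s y(2) that by (simp add: abs_mult flip: left_diff_distrib)
    also have "\<dots> \<le> norm ((x - y k) - (x - y l))" by (rule norm_triangle_ineq3)
    also have "\<dots> = dist (y k) (y l)" by (simp add: dist_norm norm_minus_commute)
    finally show ?thesis using s by linarith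
  qed
  have "inj_on y {..m}"
  proof (rule inj_onI, rule ccontr)
    fix k l assume "k \<in> {..m}" "l \<in> {..m}" "y k = y l" "k \<noteq> l"
    then show False using sep[of k l] s by auto
  qed
  then have card: "card (y ` {..m}) = Suc m" by (simp add: card_image)
  have "real (card (y ` {..m})) * (s / 3) ^ DIM('a) \<le> 2 * (s + L * (s / 3)) ^ DIM('a)"
  proof (rule packing)
    show "F ` y ` {..m} \<subseteq> cball u s" using y(1) H(2) by (fastforce simp: subset_iff)
    fix a b assume ab: "a \<in> y ` {..m}" "b \<in> y ` {..m}" "a \<noteq> b"
    then obtain k l where "k \<le> m" "l \<le> m" "a = y k" "b = y l" by auto
    then show "2 * (s / 3) < dist a b" using sep[of k l] ab(3) by auto
  qed (use s in auto)
  also have "s + L * (s / 3) = (3 + L) * (s / 3)" by (simp add: algebra_simps)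
  also have "((3 + L) * (s / 3)) ^ DIM('a) = (3 + L) ^ DIM('a) * (s / 3) ^ DIM('a)" by (rule power_mult_distrib)
  finally have "(1 + real m) * (s / 3) ^ DIM('a) \<le> (2 * (3 + L) ^ DIM('a)) * (s / 3) ^ DIM('a)"
    unfolding card by (simp only: of_nat_Suc mult.assoc)
  then have "1 + real m \<le> 2 * (3 + L) ^ DIM('a)" using s by (subst (asm) mult_le_cancel_right_pos) auto
  moreover have "norm (x - x') \<le> (1 + real m) * s" using m(2) s by (simp add: pos_divide_less_eq add.commute)
  ultimately show ?thesis using s by (meson mult_right_mono less_imp_le order_trans)
qed

text \<open>Two points of one sheet lie in the connected preimage of a ball about \<open>F x\<close>
  with radius \<open>t\<close> slightly above the distance of their images. The diameter bound at
  scale \<open>t\<close> then compares the two distances.\<close>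

theorem bilipschitz_sheets:
  obtains n y s W C where "0 < (n::nat)" "0 < s" "C > 0"
    "\<And>i. i < n \<Longrightarrow> open (W i)" "\<And>i j. i < n \<Longrightarrow> j < n \<Longrightarrow> i \<noteq> j \<Longrightarrow> W i \<inter> W j = {}"
    "F -` ball y s = (\<Union>i<n. W i)" "\<And>i. i < n \<Longrightarrow> F ` W i = ball y s"
    "\<And>i x x'. i < n \<Longrightarrow> x \<in> W i \<Longrightarrow> x' \<in> W i \<Longrightarrow> norm (x - x') \<le> C * norm (F x - F x')"
proof -
  obtain n U c r where sh: "sheets n U c r" "0 < n" and max: "\<And>V c' r'. \<not> sheets (Suc n) V c' r'"
    by (rule maximal_sheets) (rule that)
  have "open U" "U \<noteq> {}" using sh(1) by (auto simp: sheets_def)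
  then obtain y s where ys: "s > 0" "ball y s \<subseteq> U" by (metis all_not_in_conv openE)
  \<comment> \<open>With a quarter of the radius, a ball of radius \<open>t < s / 2\<close> about an
    image point of \<open>W i\<close> still lies in \<open>ball y s\<close>, where maximality
    applies.\<close>
  define W where "W i = F -` ball y (s / 4) \<inter> ball (c i) (r i)" for i
  define C where "C = 2 * (3 + L) ^ DIM('a)"
  have "C > 0" using L by (simp add: C_def)
  have sub: "ball y (s / 4) \<subseteq> U" using ys by (auto simp: subset_iff)
  show thesis
  proof (rule that[of n "s / 4" C W y])
    show "W i \<inter> W j = {}" if "i < n" "j < n" "i \<noteq> j" for i j
    proof -
      have "cball (c i) (r i) \<inter> cball (c j) (r j) = {}" using sh(1) that unfolding sheets_def by blast
      then show ?thesis unfolding W_def using ball_subset_cball by blast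
    qed
    show "F -` ball y (s / 4) = (\<Union>i<n. W i)"
      using maximal_sheets_cover[OF sh(1) max] sub unfolding W_def by blast
    show "F ` W i = ball y (s / 4)" if "i < n" for i
    proof
      show "ball y (s / 4) \<subseteq> F ` W i"
      proof
        fix u assume u: "u \<in> ball y (s / 4)"
        then obtain x where x: "x \<in> cball (c i) (r i)" "F x = u"
          using robust_sheet_image[of "c i" "r i" U] sh(1) \<open>i < n\<close> sub unfolding sheets_def by blast
        then obtain j where j: "j < n" "x \<in> ball (c j) (r j)"
          using maximal_sheets_cover[OF sh(1) max, of x] u sub by blast
        have "x \<in> cball (c j) (r j)" using j(2) by (auto simp: less_imp_le)
        then have "j = i" using sh(1) \<open>i < n\<close> j(1) x(1) unfolding sheets_def by blast
        then show "u \<in> F ` W i" using x(2) j u by (auto simp: W_def)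
      qed
    qed (auto simp: W_def)
    show "norm (x - x') \<le> C * norm (F x - F x')" if i: "i < n" and x: "x \<in> W i" "x' \<in> W i" for i x x'
    proof (rule ccontr)
      assume "\<not> ?thesis"
      then have lt: "norm (F x - F x') < norm (x - x') / C" using \<open>C > 0\<close> by (simp add: field_simps)
      have Fx: "dist y (F x) < s / 4" "dist y (F x') < s / 4" using x by (auto simp: W_def)
      then have "norm (F x - F x') < s / 2" using dist_triangle2[of "F x" "F x'" y] by (simp add: dist_norm norm_minus_commute)
      then obtain t where t: "norm (F x - F x') < t" "t < norm (x - x') / C" "t < s / 2"
        using lt dense[of "norm (F x - F x')" "min (norm (x - x') / C) (s / 2)"] by auto
      have t0: "t > 0" using t(1) norm_ge_zero[of "F x - F x'"] by linarith
      have "ball (F x) t \<subseteq> U"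
      proof
        fix z assume "z \<in> ball (F x) t"
        then have "dist y z < s" using Fx(1) t(3) ys(1) dist_triangle[of y z "F x"] by auto
        then show "z \<in> U" using ys(2) by auto
      qed
      from maximal_sheets_connected[OF sh(1) max i t0 this]
      have "norm (x - x') \<le> 2 * (3 + L) ^ DIM('a) * t"
        by (rule connected_vimage_diameter) (use x t t0 in \<open>auto simp: W_def dist_norm\<close>)
      then show False using t(2) \<open>C > 0\<close> by (simp add: C_def field_simps)
    qed
    show "open (W i)" if "i < n" for i using vimage_open by (simp add: W_def open_Int)
  qed (use sh(2) ys(1) \<open>C > 0\<close> in auto)
qed

end

section \<open>Rows of balls and bi-Lipschitz sheets\<close>

text \<open>The volume clause stands in for a change of variables formula. For inverse sheets it
  comes from transport, for \<open>F\<close> itself from a covering argument.\<close>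

definition bilip_chart :: "real \<Rightarrow> real \<Rightarrow> 'a::euclidean_space set \<Rightarrow> ('a \<Rightarrow> 'a) \<Rightarrow> bool" where
  "bilip_chart \<Lambda> C W \<phi> \<longleftrightarrow> open (\<phi> ` W) \<and>
     (\<forall>x\<in>W. \<forall>y\<in>W. norm (\<phi> x - \<phi> y) \<le> \<Lambda> * norm (x - y) \<and> norm (x - y) \<le> \<Lambda> * norm (\<phi> x - \<phi> y)) \<and>
     (\<forall>V. compact V \<longrightarrow> V \<subseteq> W \<longrightarrow> measure lborel (\<phi> ` V) \<le> C * measure lborel V)"

lemma bilip_chart_continuous: "bilip_chart \<Lambda> C W \<phi> \<Longrightarrow> \<Lambda> \<ge> 0 \<Longrightarrow> continuous_on W \<phi>"
  unfolding bilip_chart_def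
  by (intro lipschitz_on_continuous_on[of \<Lambda>] lipschitz_onI) (auto simp: dist_norm)

text \<open>
  If \<open>\<psi>\<close> inverts the chart, a fixed point of \<open>w \<mapsto> \<phi> x + w - g (\<psi> w)\<close> on the ball of
  radius \<open>\<delta>\<close> around \<open>\<phi> x\<close> yields a solution of \<open>g p = \<phi> x\<close>.
\<close>
lemma perturbed_chart_surjects:
  fixes \<phi> :: "'a::euclidean_space \<Rightarrow> 'a"
  assumes ch: "bilip_chart \<Lambda> C W \<phi>" and "\<Lambda> > 0"
    and g: "continuous_on (cball c \<rho>) g" "\<And>p. p \<in> cball c \<rho> \<Longrightarrow> norm (g p - \<phi> p) \<le> \<delta>"
    and sub: "cball c \<rho> \<subseteq> W" and x: "x \<in> cball c (\<rho> - \<Lambda> * \<delta>)" and "\<delta> \<ge> 0"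
    and room: "cball (\<phi> x) \<delta> \<subseteq> \<phi> ` W"
  shows "\<phi> x \<in> g ` cball c \<rho>"
proof -
  have co: "norm (x - y) \<le> \<Lambda> * norm (\<phi> x - \<phi> y)" if "x \<in> W" "y \<in> W" for x y
    using ch that unfolding bilip_chart_def by blast
  have "0 \<le> \<Lambda> * \<delta>" using \<open>\<Lambda> > 0\<close> \<open>\<delta> \<ge> 0\<close> by simp
  then have "x \<in> cball c \<rho>" using x by simp
  then have "x \<in> W" using sub by blast
  have inj: "inj_on \<phi> W"
  proof (rule inj_onI)
    fix a b assume "a \<in> W" "b \<in> W" "\<phi> a = \<phi> b"
    then show "a = b" using co[of a b] by simp
  qed
  define \<psi> where "\<psi> = inv_into W \<phi>"
  have \<psi>: "\<psi> w \<in> W" "\<phi> (\<psi> w) = w" if "w \<in> \<phi> ` W" for w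
    using that by (auto simp: \<psi>_def inv_into_into f_inv_into_f)
  have \<psi>b: "\<psi> w \<in> cball c \<rho>" if "w \<in> cball (\<phi> x) \<delta>" for w
  proof -
    have w: "w \<in> \<phi> ` W" using that room by blast
    have "norm (x - \<psi> w) \<le> \<Lambda> * norm (\<phi> x - w)" using co[OF \<open>x \<in> W\<close> \<psi>(1)[OF w]] \<psi>(2)[OF w] by simp
    also have "\<dots> \<le> \<Lambda> * \<delta>" using that \<open>\<Lambda> > 0\<close> by (intro mult_left_mono) (auto simp: dist_norm)
    finally have "dist x (\<psi> w) \<le> \<Lambda> * \<delta>" by (simp add: dist_norm)
    then show ?thesis using x dist_triangle[of c "\<psi> w" x] by simp
  qed
  have cont\<psi>: "continuous_on (cball (\<phi> x) \<delta>) \<psi>"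
  proof (rule lipschitz_on_continuous_on, rule lipschitz_onI)
    fix a b assume "a \<in> cball (\<phi> x) \<delta>" "b \<in> cball (\<phi> x) \<delta>"
    then have ab: "a \<in> \<phi> ` W" "b \<in> \<phi> ` W" using room by blast+
    show "dist (\<psi> a) (\<psi> b) \<le> \<Lambda> * dist a b"
      using co[OF \<psi>(1)[OF ab(1)] \<psi>(1)[OF ab(2)]] \<psi>(2)[OF ab(1)] \<psi>(2)[OF ab(2)] by (simp add: dist_norm)
  qed (use \<open>\<Lambda> > 0\<close> in simp)
  obtain w where w: "w \<in> cball (\<phi> x) \<delta>" "\<phi> x + (w - g (\<psi> w)) = w"
  proof (rule brouwer[of "cball (\<phi> x) \<delta>" "\<lambda>w. \<phi> x + (w - g (\<psi> w))"])
    show "continuous_on (cball (\<phi> x) \<delta>) (\<lambda>w. \<phi> x + (w - g (\<psi> w)))"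
      by (intro continuous_intros continuous_on_compose2[OF g(1) cont\<psi>]) (use \<psi>b in auto)
    show "(\<lambda>w. \<phi> x + (w - g (\<psi> w))) \<in> cball (\<phi> x) \<delta> \<rightarrow> cball (\<phi> x) \<delta>"
    proof
      fix w assume w: "w \<in> cball (\<phi> x) \<delta>"
      have "norm (g (\<psi> w) - \<phi> (\<psi> w)) \<le> \<delta>" by (rule g(2)[OF \<psi>b[OF w]])
      moreover have "\<phi> (\<psi> w) = w" using \<psi>(2) w room by blast
      ultimately show "\<phi> x + (w - g (\<psi> w)) \<in> cball (\<phi> x) \<delta>" by (simp add: dist_norm)
    qed
  qed (use \<open>\<delta> \<ge> 0\<close> in \<open>auto intro: that\<close>)
  then have "g (\<psi> w) = \<phi> x" by (simp add: algebra_simps)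
  then show ?thesis using \<psi>b[OF w(1)] by (metis image_eqI)
qed

text \<open>Up to the translation by \<open>v\<close>, the chart on the second ball is a
  perturbation of the chart on the first, so its image covers the image of a slightly smaller ball.
  What remains is the image of the thin shell \<open>H\<close>, which the volume clause
  controls.\<close>

lemma chart_translate_content:
  fixes \<phi> :: "'a::euclidean_space \<Rightarrow> 'a"
  assumes ch: "bilip_chart \<Lambda> C W \<phi>" and "\<Lambda> > 0" "C \<ge> 0" "\<rho> > 0" "\<delta> \<ge> 0" "\<Lambda> * \<delta> < \<rho>"
    and sub: "cball c \<rho> \<subseteq> W" "cball c' \<rho> \<subseteq> W"
    and close: "\<And>y. norm y \<le> \<rho> \<Longrightarrow> norm (\<phi> (c' + y) - \<phi> (c + y) - v) \<le> \<delta>"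
    and room: "\<And>x. x \<in> cball c \<rho> \<Longrightarrow> cball (\<phi> x) \<delta> \<subseteq> \<phi> ` W"
  shows "measure lborel (\<phi> ` cball c \<rho>) \<le> measure lborel (\<phi> ` cball c' \<rho>)
     + C * (unit_ball_vol (real DIM('a)) * (\<rho> ^ DIM('a) - (\<rho> - \<Lambda> * \<delta>) ^ DIM('a)))"
proof -
  note cont = bilip_chart_continuous[OF ch less_imp_le[OF \<open>\<Lambda> > 0\<close>]]
  define S where "S = cball c (\<rho> - \<Lambda> * \<delta>)"
  define H where "H = cball c \<rho> - ball c (\<rho> - \<Lambda> * \<delta>)"
  have "0 \<le> \<Lambda> * \<delta>" using assms by simp
  have "compact H" unfolding H_def by (intro compact_diff) auto
  have "H \<subseteq> W" using sub by (auto simp: H_def)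
  have SW: "S \<subseteq> cball c \<rho>" using \<open>0 \<le> \<Lambda> * \<delta>\<close> by (auto simp: S_def)
  have "cball c \<rho> \<subseteq> S \<union> H" unfolding S_def H_def by auto
  then have un: "\<phi> ` cball c \<rho> \<subseteq> \<phi> ` S \<union> \<phi> ` H" by blast
  define g where "g p = \<phi> (p + (c' - c)) - v" for p
  have shift: "(\<lambda>p. p + (c' - c)) ` cball c \<rho> = cball c' \<rho>"
  proof (intro equalityI subsetI)
    fix y assume "y \<in> cball c' \<rho>"
    then have "y - (c' - c) \<in> cball c \<rho>" by (simp add: dist_norm algebra_simps)
    then show "y \<in> (\<lambda>p. p + (c' - c)) ` cball c \<rho>" by (rule rev_image_eqI) simp
  qed (auto simp: dist_norm)
  have gim: "g ` cball c \<rho> = (\<lambda>x. - v + x) ` \<phi> ` cball c' \<rho>"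
    unfolding shift[symmetric] image_image g_def by simp
  have cg: "continuous_on (cball c \<rho>) g" unfolding g_def
    by (intro continuous_intros continuous_on_compose2[OF cont]) (use shift sub in auto)
  have "\<phi> ` S \<subseteq> g ` cball c \<rho>"
  proof clarify
    fix x assume "x \<in> S"
    then have "x \<in> cball c \<rho>" using SW by blast
    show "\<phi> x \<in> g ` cball c \<rho>"
    proof (rule perturbed_chart_surjects[OF ch \<open>\<Lambda> > 0\<close> cg _ sub(1)])
      fix p assume "p \<in> cball c \<rho>"
      then show "norm (g p - \<phi> p) \<le> \<delta>"
        using close[of "p - c"] by (simp add: g_def dist_norm norm_minus_commute algebra_simps)
    qed (use \<open>x \<in> S\<close> room[OF \<open>x \<in> cball c \<rho>\<close>] assms in \<open>auto simp: S_def\<close>)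
  qed
  have comp: "compact (\<phi> ` V)" if "compact V" "V \<subseteq> W" for V
    by (intro compact_continuous_image continuous_on_subset[OF cont] that)
  have cS: "compact (\<phi> ` S)" by (rule comp) (use SW sub in \<open>auto simp: S_def\<close>)
  have cH: "compact (\<phi> ` H)" by (rule comp[OF \<open>compact H\<close> \<open>H \<subseteq> W\<close>])
  have cG: "compact (g ` cball c \<rho>)" by (rule compact_continuous_image[OF cg]) simp
  have fin: "K \<in> fmeasurable lborel" if "compact K" for K :: "'a set"
    using emeasure_bounded_finite[OF compact_imp_bounded[OF that]] that by (auto simp: fmeasurable_def borel_compact)
  have "measure lborel (\<phi> ` cball c \<rho>) \<le> measure lborel (\<phi> ` S \<union> \<phi> ` H)"
    using cS cH by (intro measure_mono_fmeasurable[OF un] fmeasurable.Un fin) (auto intro!: borel_compact comp sub)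
  also have "\<dots> \<le> measure lborel (\<phi> ` S) + measure lborel (\<phi> ` H)"
    by (rule measure_Un_le) (use cS cH in \<open>auto simp: borel_compact\<close>)
  also have "measure lborel (\<phi> ` S) \<le> measure lborel (g ` cball c \<rho>)"
    using \<open>\<phi> ` S \<subseteq> g ` cball c \<rho>\<close> cS cG by (intro measure_mono_fmeasurable fin) (auto simp: borel_compact)
  also have "measure lborel (g ` cball c \<rho>) = measure lborel (\<phi> ` cball c' \<rho>)"
  proof -
    have "measure lborel (g ` cball c \<rho>) = measure lebesgue ((\<lambda>x. - v + x) ` \<phi> ` cball c' \<rho>)"
      using cG by (simp add: measure_completion borel_compact gim)
    also have "\<dots> = measure lebesgue (\<phi> ` cball c' \<rho>)" by (rule measure_translation)
    also have "\<dots> = measure lborel (\<phi> ` cball c' \<rho>)"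
      using comp[of "cball c' \<rho>"] sub by (simp add: measure_completion borel_compact)
    finally show ?thesis .
  qed
  also have "measure lborel (\<phi> ` H) \<le> C * measure lborel H"
    using ch \<open>compact H\<close> \<open>H \<subseteq> W\<close> unfolding bilip_chart_def by blast
  also have "measure lborel H = measure lborel (cball c \<rho>) - measure lborel (ball c (\<rho> - \<Lambda> * \<delta>))"
    unfolding H_def using \<open>0 \<le> \<Lambda> * \<delta>\<close> emeasure_bounded_finite[of "cball c \<rho>"] by (intro measure_Diff) auto
  also have "\<dots> = unit_ball_vol (real DIM('a)) * (\<rho> ^ DIM('a) - (\<rho> - \<Lambda> * \<delta>) ^ DIM('a))"
    using assms by (simp add: content_cball content_ball algebra_simps)
  finally show ?thesis using \<open>C \<ge> 0\<close> by (simp add: mult_left_mono)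
qed

section \<open>Averaging the stretch along a row\<close>

lemma sum_square_deviation:
  fixes u :: "nat \<Rightarrow> 'a::real_inner"
  assumes "N > 0" and D: "D = (\<Sum>i<N. u i)"
  shows "(\<Sum>i<N. (norm (u i - D /\<^sub>R real N))\<^sup>2) = (\<Sum>i<N. (norm (u i))\<^sup>2) - (norm D)\<^sup>2 / real N"
proof -
  define m where "m = D /\<^sub>R real N"
  have Dm: "D = real N *\<^sub>R m" using \<open>N > 0\<close> by (simp add: m_def)
  have "(\<Sum>i<N. (norm (u i - m))\<^sup>2) = (\<Sum>i<N. (norm (u i))\<^sup>2 - 2 * (u i \<bullet> m) + (norm m)\<^sup>2)"
    by (rule sum.cong) (simp_all add: power2_norm_eq_inner inner_diff_left inner_diff_right inner_commute)
  also have "\<dots> = (\<Sum>i<N. (norm (u i))\<^sup>2) - 2 * (D \<bullet> m) + real N * (norm m)\<^sup>2"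
    by (simp add: sum.distrib sum_subtractf D inner_sum_left sum_distrib_left)
  also have "\<dots> = (\<Sum>i<N. (norm (u i))\<^sup>2) - real N * (norm m)\<^sup>2"
    unfolding Dm by (simp add: power2_norm_eq_inner)
  also have "real N * (norm m)\<^sup>2 = (norm D)\<^sup>2 / real N"
    unfolding Dm using \<open>N > 0\<close> by (simp add: power_mult_distrib power2_eq_square)
  finally show ?thesis by (simp add: m_def)
qed

text \<open>
  Here \<open>t\<close> is the length of a row and \<open>l\<close> the distance of its neighbouring centres. By the last clause \<open>R\<close> looks
  constant at scale \<open>l\<close> off the row, so that other sheets of a map cannot compensate the oscillation along it.
\<close>
definition row_property :: "'a::euclidean_space measure \<Rightarrow> 'a \<Rightarrow> bool" where
  "row_property R e \<longleftrightarrow> (\<forall>Q \<epsilon>. open Q \<longrightarrow> Q \<noteq> {} \<longrightarrow> Q \<subseteq> UNIV \<times> {0<..} \<longrightarrow> \<epsilon> > 0 \<longrightarrow>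
     (\<exists>x t N l. (x, t) \<in> Q \<and> 0 < N \<and> l = t / real N \<and> l < \<epsilon> \<and> 1 / real N < \<epsilon> \<and>
       (\<forall>i\<le>N. \<bar>measure R (cball (x + (real i * l) *\<^sub>R e) (l / 4))
            - (if even i then 2 else 1) * measure lborel (cball x (l / 4))\<bar> \<le> \<epsilon> * l ^ DIM('a)) \<and>
       (\<forall>q. \<exists>c. 0 \<le> c \<and> c \<le> 2 \<and> (\<forall>E\<in>sets borel. E \<subseteq> cball q (l / \<epsilon>) \<longrightarrow>
            (\<forall>i\<le>N. E \<inter> cball (x + (real i * l) *\<^sub>R e) (l / 3) = {}) \<longrightarrow>
            \<bar>measure R E - c * measure lborel E\<bar> \<le> \<epsilon> * (measure lborel E + l ^ DIM('a))))))"

text \<open>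
  If the joint stretch of the \<open>\<phi> j\<close> along a segment is almost maximal, then the displacements of its \<open>N\<close> pieces
  have small variance, so most pieces are displaced by almost the same vector.
\<close>
lemma almost_translation_cell:
  fixes \<phi> :: "'b \<Rightarrow> 'a::euclidean_space \<Rightarrow> 'a"
  assumes J: "finite J" and Z: "finite Z" "Z \<noteq> {}" and N: "0 < N" and l: "l = t / real N" "t > 0" and \<eta>: "\<eta> > 0"
    and upper: "\<And>z i. z \<in> Z \<Longrightarrow> i < N \<Longrightarrow>
       (\<Sum>j\<in>J. (norm (\<phi> j (x + z + (real i * l) *\<^sub>R e + l *\<^sub>R e) - \<phi> j (x + z + (real i * l) *\<^sub>R e)))\<^sup>2) \<le> Q * l\<^sup>2"
    and lower: "\<And>z. z \<in> Z \<Longrightarrow> (\<Sum>j\<in>J. (norm (\<phi> j (x + z + t *\<^sub>R e) - \<phi> j (x + z)))\<^sup>2) \<ge> (Q - \<eta>) * t\<^sup>2"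
  obtains i where "i < N" "\<And>z j. z \<in> Z \<Longrightarrow> j \<in> J \<Longrightarrow>
     (norm ((\<phi> j (x + z + (real i * l) *\<^sub>R e + l *\<^sub>R e) - \<phi> j (x + z + (real i * l) *\<^sub>R e))
        - (\<phi> j (x + z + t *\<^sub>R e) - \<phi> j (x + z)) /\<^sub>R real N))\<^sup>2 \<le> real (card Z) * \<eta> * l\<^sup>2"
proof -
  have Nl: "real N * l = t" using N l by simp
  define u where "u j z i = \<phi> j (x + z + (real i * l) *\<^sub>R e + l *\<^sub>R e) - \<phi> j (x + z + (real i * l) *\<^sub>R e)" for j z i
  define D where "D j z = \<phi> j (x + z + t *\<^sub>R e) - \<phi> j (x + z)" for j z
  define dev where "dev z i j = (norm (u j z i - D j z /\<^sub>R real N))\<^sup>2" for z i j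
  have D: "D j z = (\<Sum>i<N. u j z i)" for j z
  proof -
    have "u j z i = \<phi> j (x + z + (real (Suc i) * l) *\<^sub>R e) - \<phi> j (x + z + (real i * l) *\<^sub>R e)" for i
      by (simp add: u_def algebra_simps)
    then have "(\<Sum>i<N. u j z i) = \<phi> j (x + z + (real N * l) *\<^sub>R e) - \<phi> j (x + z + (real 0 * l) *\<^sub>R e)"
      using sum_lessThan_telescope[of "\<lambda>i. \<phi> j (x + z + (real i * l) *\<^sub>R e)" N] by simp
    then show ?thesis by (simp add: D_def Nl)
  qed
  have per: "(\<Sum>j\<in>J. \<Sum>i<N. dev z i j) \<le> real N * \<eta> * l\<^sup>2" if z: "z \<in> Z" for z
  proof -
    have "(\<Sum>j\<in>J. \<Sum>i<N. dev z i j) = (\<Sum>j\<in>J. (\<Sum>i<N. (norm (u j z i))\<^sup>2) - (norm (D j z))\<^sup>2 / real N)"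
      unfolding dev_def using sum_square_deviation[OF N D] by (intro sum.cong refl)
    also have "\<dots> = (\<Sum>i<N. \<Sum>j\<in>J. (norm (u j z i))\<^sup>2) - (\<Sum>j\<in>J. (norm (D j z))\<^sup>2) / real N"
      by (simp add: sum_subtractf sum_divide_distrib sum.swap[of _ J])
    also have "\<dots> \<le> (\<Sum>i<N. Q * l\<^sup>2) - (Q - \<eta>) * t\<^sup>2 / real N"
      using upper[OF z] lower[OF z] by (intro diff_mono sum_mono divide_right_mono) (auto simp: u_def D_def)
    also have "\<dots> = real N * \<eta> * l\<^sup>2"
      unfolding Nl[symmetric] using N by (simp add: power2_eq_square field_simps)
    finally show ?thesis .
  qed
  \<comment> \<open>Averaging over the cells yields one \<open>i\<close> that is good for all charts
    and all offsets in \<open>Z\<close> at once, at the cost of the factor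
    \<open>card Z\<close>.\<close>
  have "\<exists>i<N. (\<Sum>z\<in>Z. \<Sum>j\<in>J. dev z i j) \<le> real (card Z) * \<eta> * l\<^sup>2"
  proof (rule ccontr)
    assume "\<not> ?thesis"
    then have "(\<Sum>i<N. real (card Z) * \<eta> * l\<^sup>2) < (\<Sum>i<N. \<Sum>z\<in>Z. \<Sum>j\<in>J. dev z i j)"
      using N by (intro sum_strict_mono) (auto simp: not_le)
    also have "\<dots> = (\<Sum>z\<in>Z. \<Sum>j\<in>J. \<Sum>i<N. dev z i j)"
      by (subst sum.swap, rule sum.cong[OF refl], subst sum.swap, rule refl)
    also have "\<dots> \<le> (\<Sum>z\<in>Z. real N * \<eta> * l\<^sup>2)" by (intro sum_mono per)
    finally show False by simp
  qed
  then obtain i where i: "i < N" "(\<Sum>z\<in>Z. \<Sum>j\<in>J. dev z i j) \<le> real (card Z) * \<eta> * l\<^sup>2" by blast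
  have "dev z i j \<le> real (card Z) * \<eta> * l\<^sup>2" if "z \<in> Z" "j \<in> J" for z j
  proof -
    have "dev z i j \<le> (\<Sum>j\<in>J. dev z i j)" using J that by (intro member_le_sum) (auto simp: dev_def)
    also have "\<dots> \<le> (\<Sum>z\<in>Z. \<Sum>j\<in>J. dev z i j)"
      using Z that by (intro member_le_sum[of z]) (auto simp: dev_def intro!: sum_nonneg)
    finally show ?thesis using i(2) by linarith
  qed
  then show thesis using that[OF i(1)] by (simp add: dev_def u_def D_def)
qed


lemma small_constants:
  fixes \<Lambda> C v m :: real and n :: nat
  assumes "\<Lambda> > 0" "C \<ge> 0" "v > 0" "m > 0"
  obtains \<kappa> where "\<kappa> > 0" "\<Lambda> * \<kappa> < 1 / 4" "C * (v * ((1 / 4) ^ n - (1 / 4 - \<Lambda> * \<kappa>) ^ n)) \<le> m"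
proof -
  have "((\<lambda>\<kappa>. C * (v * ((1 / 4) ^ n - (1 / 4 - \<Lambda> * \<kappa>) ^ n))) \<longlongrightarrow> C * (v * ((1 / 4) ^ n - (1 / 4 - \<Lambda> * 0) ^ n))) (at_right 0)"
    by (intro tendsto_intros)
  then have "\<forall>\<^sub>F \<kappa> in at_right 0. C * (v * ((1 / 4) ^ n - (1 / 4 - \<Lambda> * \<kappa>) ^ n)) < m"
    using \<open>m > 0\<close> by (intro order_tendstoD(2)) auto
  moreover have "\<forall>\<^sub>F \<kappa> in at_right 0. \<kappa> < 1 / (4 * \<Lambda>)"
    by (rule order_tendstoD(2)[OF tendsto_ident_at]) (use \<open>\<Lambda> > 0\<close> in simp)
  moreover have "\<forall>\<^sub>F \<kappa> in at_right (0::real). 0 < \<kappa>" by (rule eventually_at_right_less)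
  ultimately have "\<forall>\<^sub>F \<kappa> in at_right 0. 0 < \<kappa> \<and> \<kappa> < 1 / (4 * \<Lambda>) \<and> C * (v * ((1 / 4) ^ n - (1 / 4 - \<Lambda> * \<kappa>) ^ n)) < m"
    by eventually_elim auto
  then obtain \<kappa> where "0 < \<kappa>" "\<kappa> < 1 / (4 * \<Lambda>)" "C * (v * ((1 / 4) ^ n - (1 / 4 - \<Lambda> * \<kappa>) ^ n)) < m"
    using eventually_happens'[OF trivial_limit_at_right_real] by blast
  then show thesis using \<open>\<Lambda> > 0\<close> by (intro that[of \<kappa>]) (auto simp: field_simps)
qed

text \<open>The signs \<open>s\<close> and the flags \<open>far\<close> let one statement serve both
  directions of transport: a \<open>far\<close> chart leaves \<open>W\<close> and is measured by
  \<open>R\<close>, which looks constant there at the scale of a row in \<open>W\<close>. So the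
  right side of \<open>eq\<close> is nearly equal on two neighbouring balls, while \<open>R\<close>
  differs on them by about the volume of one ball.\<close>

theorem no_chart_decomposition:
  fixes \<phi> :: "'b \<Rightarrow> 'a::euclidean_space \<Rightarrow> 'a" and R :: "'a measure"
  assumes R: "comparable R" and row: "row_property R e" and e: "norm e = 1"
    and W: "open W" "W \<noteq> {}" and J: "finite J" and "\<Lambda> > 0" "C \<ge> 0"
    and ch: "\<And>j. j \<in> J \<Longrightarrow> bilip_chart \<Lambda> C W (\<phi> j)"
    and s: "\<And>j. j \<in> J \<Longrightarrow> \<bar>s j\<bar> \<le> (1::real)"
    and far: "\<And>j. j \<in> J \<Longrightarrow> far j \<Longrightarrow> \<phi> j ` W \<inter> W = {}"
    and eq: "\<And>V. compact V \<Longrightarrow> V \<subseteq> W \<Longrightarrow>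
       measure R V = (\<Sum>j\<in>J. s j * measure (if far j then R else lborel) (\<phi> j ` V))"
  shows False
proof -
  define d where "d = DIM('a)"
  define v where "v = unit_ball_vol (real d)"
  have "v > 0" by (simp add: v_def unit_ball_vol_pos)
  define m where "m = real (card J) + 1"
  have "m \<ge> 1" by (simp add: m_def)
  define V where "V = v * (1 / 4) ^ d"
  have "V > 0" using \<open>v > 0\<close> by (simp add: V_def)
  \<comment> \<open>\<open>\<kappa>\<close> is the tolerated deviation from a translation in units
    of the spacing \<open>l\<close>. The value \<open>V / (8 * m)\<close> leaves each of the fewer
    than \<open>m\<close> charts its share of the total error, \<open>V\<close> being the volume of
    a row ball in units of \<open>l ^ d\<close>.\<close>
  obtain \<kappa> where \<kappa>: "\<kappa> > 0" "\<Lambda> * \<kappa> < 1 / 4" "C * (v * ((1 / 4) ^ d - (1 / 4 - \<Lambda> * \<kappa>) ^ d)) \<le> V / (8 * m)"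
    using small_constants[of \<Lambda> C v "V / (8 * m)" d] \<open>\<Lambda> > 0\<close> \<open>C \<ge> 0\<close> \<open>v > 0\<close> \<open>V > 0\<close> \<open>m \<ge> 1\<close> by auto
  \<comment> \<open>Error budget for \<open>close\<close>: moving the offset to a point of the net
    \<open>Z\<close> costs \<open>\<kappa> / 6\<close> at each of two centres, the deviation at the
    net point \<open>\<kappa> / 3\<close>, and comparing its mean displacement with
    \<open>w j\<close> another \<open>\<kappa> / 3\<close>.\<close>
  define \<theta> where "\<theta> = \<kappa> / (6 * \<Lambda>)"
  have "\<theta> > 0" using \<kappa>(1) \<open>\<Lambda> > 0\<close> by (simp add: \<theta>_def)
  obtain Z where Z: "finite Z" "Z \<subseteq> cball 0 (1 / 4 :: real)" "cball (0::'a) (1 / 4) \<subseteq> (\<Union>z\<in>Z. ball z \<theta>)"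
    using seq_compact_imp_totally_bounded[of "cball (0::'a) (1 / 4)"] \<open>\<theta> > 0\<close>
      compact_imp_seq_compact[OF compact_cball[of "0::'a" "1/4"]] by meson
  have "Z \<noteq> {}" using Z(3) centre_in_cball[of "0::'a" "1/4"] by auto
  then have cZ: "real (card Z) \<ge> 1" using Z(1) by (simp add: Suc_le_eq card_gt_0_iff)
  define \<eta> where "\<eta> = (\<kappa> / 3)\<^sup>2 / real (card Z)"
  have "\<eta> > 0" using \<kappa>(1) cZ by (simp add: \<eta>_def)
  note contW = bilip_chart_continuous[OF ch less_imp_le[OF \<open>\<Lambda> > 0\<close>]]
  have lip: "norm (\<phi> j x - \<phi> j y) \<le> \<Lambda> * norm (x - y)" if "j \<in> J" "x \<in> W" "y \<in> W" for j x y
    using ch[OF that(1)] that unfolding bilip_chart_def by blast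
  obtain a \<beta> where \<beta>: "\<beta> > 0" "cball a (2 * \<beta>) \<subseteq> W"
  proof -
    obtain a \<beta> where "\<beta> > 0" "cball a \<beta> \<subseteq> W" using W open_contains_cball by (metis all_not_in_conv)
    then show thesis using that[of "\<beta> / 2" a] by simp
  qed
  have "\<forall>j\<in>J. \<exists>r>0. (\<Union>x\<in>\<phi> j ` cball a (2 * \<beta>). cball x r) \<subseteq> \<phi> j ` W"
  proof
    fix j assume j: "j \<in> J"
    have "compact (\<phi> j ` cball a (2 * \<beta>))"
      by (intro compact_continuous_image continuous_on_subset[OF contW[OF j] \<beta>(2)]) simp
    moreover have "open (\<phi> j ` W)" using ch[OF j] by (simp add: bilip_chart_def)
    moreover have "\<phi> j ` cball a (2 * \<beta>) \<subseteq> \<phi> j ` W" using \<beta>(2) by blast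
    ultimately show "\<exists>r>0. (\<Union>x\<in>\<phi> j ` cball a (2 * \<beta>). cball x r) \<subseteq> \<phi> j ` W"
      using compact_subset_open_imp_cball_epsilon_subset by metis
  qed
  then obtain rj where rj: "\<And>j. j \<in> J \<Longrightarrow> rj j > 0" "\<And>j. j \<in> J \<Longrightarrow> (\<Union>x\<in>\<phi> j ` cball a (2 * \<beta>). cball x (rj j)) \<subseteq> \<phi> j ` W"
    by metis
  define r0 where "r0 = Min (insert 1 (rj ` J))"
  have "r0 > 0" unfolding r0_def using J rj(1) by (subst Min_gr_iff) auto
  have room: "cball (\<phi> j x) r0 \<subseteq> \<phi> j ` W" if "j \<in> J" "x \<in> cball a (2 * \<beta>)" for j x
  proof -
    have "r0 \<le> rj j" unfolding r0_def using J that by (intro Min_le) auto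
    then have "cball (\<phi> j x) r0 \<subseteq> cball (\<phi> j x) (rj j)" by auto
    then show ?thesis using rj(2)[OF that(1)] that(2) by blast
  qed
  \<comment> \<open>Segments are recorded by their start and length. The ball is convex, so pieces
    of a segment in \<open>A\<close> are in \<open>A\<close> too; \<open>q\<close> sums squares over
    the charts so that the variance identity applies.\<close>
  define A where "A = {(x, t). 0 < t \<and> x \<in> ball a \<beta> \<and> x + t *\<^sub>R e \<in> ball a \<beta>}"
  define q where "q = (\<lambda>(x, t). (\<Sum>j\<in>J. (norm (\<phi> j (x + t *\<^sub>R e) - \<phi> j x))\<^sup>2) / t\<^sup>2)"
  have ball_sub: "ball a \<beta> \<subseteq> W" using \<beta> by (auto simp: subset_iff)
  have "open A"
  proof -
    have "A = UNIV \<times> {0<..} \<inter> (fst -` ball a \<beta> \<inter> (\<lambda>p. fst p + snd p *\<^sub>R e) -` ball a \<beta>)"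
      unfolding A_def by auto
    then show ?thesis by (auto intro!: open_Int open_Times open_vimage continuous_intros)
  qed
  have cq: "continuous_on A q"
  proof -
    have 1: "continuous_on A (\<lambda>p. \<phi> j (fst p + snd p *\<^sub>R e))" "continuous_on A (\<lambda>p. \<phi> j (fst p))" if "j \<in> J" for j
      by (rule continuous_on_compose2[OF contW[OF that]], intro continuous_intros, use ball_sub in \<open>force simp: A_def\<close>)+
    show ?thesis unfolding q_def case_prod_beta
      by (intro continuous_intros 1) (auto simp: A_def)
  qed
  have qle: "q p \<le> real (card J) * \<Lambda>\<^sup>2" if "p \<in> A" for p
  proof -
    obtain x t where p: "p = (x, t)" by force
    have xt: "0 < t" "x \<in> W" "x + t *\<^sub>R e \<in> W" using that ball_sub by (auto simp: p A_def)
    have "(\<Sum>j\<in>J. (norm (\<phi> j (x + t *\<^sub>R e) - \<phi> j x))\<^sup>2) \<le> (\<Sum>j\<in>J. \<Lambda>\<^sup>2 * t\<^sup>2)"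
    proof (rule sum_mono)
      fix j assume "j \<in> J"
      then have "norm (\<phi> j (x + t *\<^sub>R e) - \<phi> j x) \<le> \<Lambda> * t" using lip[of j "x + t *\<^sub>R e" x] xt e by simp
      then show "(norm (\<phi> j (x + t *\<^sub>R e) - \<phi> j x))\<^sup>2 \<le> \<Lambda>\<^sup>2 * t\<^sup>2"
        by (metis norm_ge_zero power_mono power_mult_distrib)
    qed
    then show ?thesis using xt(1) by (simp add: p q_def divide_le_eq algebra_simps)
  qed
  define Q where "Q = (SUP p\<in>A. q p)"
  have "(a, \<beta> / 2) \<in> A" using \<beta>(1) e by (simp add: A_def dist_norm)
  then have "A \<noteq> {}" by blast
  have bdd: "bdd_above (q ` A)" using qle by (intro bdd_aboveI[of _ "real (card J) * \<Lambda>\<^sup>2"]) auto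
  have qQ: "q p \<le> Q" if "p \<in> A" for p unfolding Q_def by (rule cSUP_upper[OF that bdd])
  define A1 where "A1 = A \<inter> q -` {Q - \<eta><..}"
  have "open A1" unfolding A1_def
    using continuous_open_preimage[OF cq \<open>open A\<close>] by simp
  obtain p0 where p0: "p0 \<in> A1"
  proof -
    have "Q - \<eta> < Q" using \<open>\<eta> > 0\<close> by simp
    then obtain p where "p \<in> A" "Q - \<eta> < q p" unfolding Q_def using less_cSUP_iff[OF \<open>A \<noteq> {}\<close> bdd] by blast
    then show thesis using that[of p] by (simp add: A1_def)
  qed
  obtain r where r: "r > 0" "ball p0 (2 * r) \<subseteq> A1"
  proof -
    obtain r where "r > 0" "ball p0 r \<subseteq> A1" using \<open>open A1\<close> p0 openE by blast
    then show thesis using that[of "r / 2"] by simp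
  qed
  \<comment> \<open>Two neighbouring balls each contribute an off-row error of at most
    \<open>\<epsilon> * (C * v + 1) * l ^ d\<close>.\<close>
  define K where "K = 2 * C * v + 2"
  have "K > 0" using \<open>C \<ge> 0\<close> \<open>v > 0\<close> unfolding K_def by (meson add_nonneg_pos less_imp_le mult_nonneg_nonneg zero_le_numeral zero_less_numeral)
  \<comment> \<open>In order, the entries keep shifted rows almost maximal, keep the row balls in
    \<open>W\<close>, leave room in the targets of the charts, fit both images into
    \<open>cball (\<phi> j c) (l / \<epsilon>)\<close>, bound \<open>1 / N\<close>, and bound the
    errors of \<open>R\<close> on the row and off it.\<close>
  define \<epsilon> where "\<epsilon> = Min {r, \<beta>, r0 / \<kappa>, 1 / (2 * \<Lambda>), \<kappa> / (3 * \<Lambda>), V / 8, V / (8 * m * K)}"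
  have "\<epsilon> > 0" unfolding \<epsilon>_def
    using r(1) \<beta>(1) \<open>r0 > 0\<close> \<kappa>(1) \<open>\<Lambda> > 0\<close> \<open>V > 0\<close> \<open>m \<ge> 1\<close> \<open>K > 0\<close> by (subst Min_gr_iff) auto
  have \<epsilon>le: "\<epsilon> \<le> y" if "y \<in> {r, \<beta>, r0 / \<kappa>, 1 / (2 * \<Lambda>), \<kappa> / (3 * \<Lambda>), V / 8, V / (8 * m * K)}" for y
    unfolding \<epsilon>_def by (rule Min_le[OF _ that]) simp
  have "open (ball p0 r)" "ball p0 r \<noteq> {}" using r(1) by auto
  moreover have "ball p0 r \<subseteq> UNIV \<times> {0<..}"
    using r subset_ball[of r "2 * r" p0] by (auto simp: A1_def A_def)
  ultimately obtain x t N l where xt: "(x, t) \<in> ball p0 r" "0 < N" "l = t / real N" "l < \<epsilon>" "1 / real N < \<epsilon>"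
    and dens: "\<And>i. i \<le> N \<Longrightarrow> \<bar>measure R (cball (x + (real i * l) *\<^sub>R e) (l / 4))
            - (if even i then 2 else 1) * measure lborel (cball x (l / 4))\<bar> \<le> \<epsilon> * l ^ DIM('a)"
    and offrow: "\<And>q. \<exists>c. 0 \<le> c \<and> c \<le> 2 \<and> (\<forall>E\<in>sets borel. E \<subseteq> cball q (l / \<epsilon>) \<longrightarrow>
            (\<forall>i\<le>N. E \<inter> cball (x + (real i * l) *\<^sub>R e) (l / 3) = {}) \<longrightarrow>
            \<bar>measure R E - c * measure lborel E\<bar> \<le> \<epsilon> * (measure lborel E + l ^ DIM('a)))"
    using row[unfolded row_property_def, rule_format, of "ball p0 r" \<epsilon>] \<open>\<epsilon> > 0\<close> by metis
  have "(x, t) \<in> A" using xt(1) r subset_ball[of r "2 * r" p0] by (auto simp: A1_def)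
  then have t: "t > 0" and xA: "x \<in> ball a \<beta>" "x + t *\<^sub>R e \<in> ball a \<beta>" by (auto simp: A_def)
  have l: "l > 0" using xt t by simp
  have Nl: "real N * l = t" using xt by simp
  \<comment> \<open>Being almost maximal is an open condition with margin \<open>r\<close>, so it
    holds for all parallel segments through the small ball, not only for the central one.\<close>
  have shifted: "(x + l *\<^sub>R z, t) \<in> A1" if "norm z \<le> 1 / 4" for z
  proof -
    have "l * norm z \<le> l * 1" using that l by (intro mult_left_mono) auto
    moreover have "norm (l *\<^sub>R z) = l * norm z" using l by simp
    moreover have "\<epsilon> \<le> r" using \<epsilon>le by blast
    ultimately have "norm (l *\<^sub>R z) < r" using xt(4) by linarith
    then have "dist (x, t) (x + l *\<^sub>R z, t) < r" by (simp add: dist_Pair_Pair dist_norm)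
    then have "dist p0 (x + l *\<^sub>R z, t) < 2 * r"
      using xt(1) dist_triangle[of p0 "(x + l *\<^sub>R z, t)" "(x, t)"] by simp
    then show ?thesis using r(2) by auto
  qed
  have seg: "x + l *\<^sub>R z + (\<tau> * l) *\<^sub>R e \<in> ball a \<beta>" if "norm z \<le> 1 / 4" "0 \<le> \<tau>" "\<tau> \<le> real N" for z \<tau>
  proof -
    have "x + l *\<^sub>R z \<in> ball a \<beta>" "x + l *\<^sub>R z + t *\<^sub>R e \<in> ball a \<beta>"
      using shifted[OF that(1)] by (auto simp: A1_def A_def)
    moreover have "x + l *\<^sub>R z + (\<tau> * l) *\<^sub>R e
       = (1 - \<tau> / real N) *\<^sub>R (x + l *\<^sub>R z) + (\<tau> / real N) *\<^sub>R (x + l *\<^sub>R z + t *\<^sub>R e)"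
      using xt(2) by (simp add: Nl[symmetric] algebra_simps)
    moreover have "0 \<le> \<tau> / real N" "\<tau> / real N \<le> 1" using that xt(2) by (auto simp: divide_le_eq)
    ultimately show ?thesis using convexD_alt[OF convex_ball, of "x + l *\<^sub>R z" a \<beta>] by metis
  qed
  define Z' where "Z' = (\<lambda>z. l *\<^sub>R z) ` Z"
  have cZ': "card Z' = card Z" unfolding Z'_def using l by (intro card_image inj_onI) simp
  have Z': "finite Z'" "Z' \<noteq> {}" using Z(1) \<open>Z \<noteq> {}\<close> by (auto simp: Z'_def)
  obtain i where i: "i < N" and idev: "\<And>z j. z \<in> Z' \<Longrightarrow> j \<in> J \<Longrightarrow>
     (norm ((\<phi> j (x + z + (real i * l) *\<^sub>R e + l *\<^sub>R e) - \<phi> j (x + z + (real i * l) *\<^sub>R e))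
        - (\<phi> j (x + z + t *\<^sub>R e) - \<phi> j (x + z)) /\<^sub>R real N))\<^sup>2 \<le> real (card Z') * \<eta> * l\<^sup>2"
  proof (rule almost_translation_cell[where \<phi> = \<phi> and J = J and Z = Z' and Q = Q and e = e and x = x, OF J Z' xt(2,3) t \<open>\<eta> > 0\<close>])
    fix z i assume "z \<in> Z'" "i < N"
    then obtain z0 where z0: "norm z0 \<le> 1 / 4" "z = l *\<^sub>R z0" using Z(2) by (auto simp: Z'_def)
    have "x + z + (real i * l) *\<^sub>R e \<in> ball a \<beta>" using seg[OF z0(1), of "real i"] \<open>i < N\<close> z0(2) by simp
    moreover have "x + z + (real i * l) *\<^sub>R e + l *\<^sub>R e \<in> ball a \<beta>"
      using seg[OF z0(1), of "real i + 1"] \<open>i < N\<close> z0(2) by (simp add: algebra_simps)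
    ultimately have "q (x + z + (real i * l) *\<^sub>R e, l) \<le> Q" using l by (intro qQ) (auto simp: A_def)
    then show "(\<Sum>j\<in>J. (norm (\<phi> j (x + z + (real i * l) *\<^sub>R e + l *\<^sub>R e) - \<phi> j (x + z + (real i * l) *\<^sub>R e)))\<^sup>2) \<le> Q * l\<^sup>2"
      using l by (simp add: q_def divide_le_eq)
  next
    fix z assume "z \<in> Z'"
    then obtain z0 where z0: "norm z0 \<le> 1 / 4" "z = l *\<^sub>R z0" using Z(2) by (auto simp: Z'_def)
    have "q (x + z, t) > Q - \<eta>" using shifted[OF z0(1)] z0(2) by (simp add: A1_def)
    then show "(Q - \<eta>) * t\<^sup>2 \<le> (\<Sum>j\<in>J. (norm (\<phi> j (x + z + t *\<^sub>R e) - \<phi> j (x + z)))\<^sup>2)"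
      using t by (simp add: q_def less_divide_eq)
  qed (rule that)
  define c where "c = x + (real i * l) *\<^sub>R e"
  define c' where "c' = c + l *\<^sub>R e"
  define w where "w j = (\<phi> j (x + t *\<^sub>R e) - \<phi> j x) /\<^sub>R real N" for j
  have cz: "c + l *\<^sub>R z \<in> ball a \<beta>" "c' + l *\<^sub>R z \<in> ball a \<beta>" if "norm z \<le> 1 / 4" for z
    using seg[OF that, of "real i"] seg[OF that, of "real i + 1"] i by (auto simp: c_def c'_def algebra_simps)
  have close: "norm (\<phi> j (c' + l *\<^sub>R y) - \<phi> j (c + l *\<^sub>R y) - w j) \<le> \<kappa> * l"
    if j: "j \<in> J" and y: "norm y \<le> 1 / 4" for j y
  proof -
    obtain z where z: "z \<in> Z" "norm (y - z) < \<theta>" using Z(3) y by (force simp: dist_norm norm_minus_commute)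
    have nz: "norm z \<le> 1 / 4" using Z(2) z(1) by auto
    define D where "D = (\<phi> j (x + l *\<^sub>R z + t *\<^sub>R e) - \<phi> j (x + l *\<^sub>R z)) /\<^sub>R real N"
    have zz: "l *\<^sub>R z \<in> Z'" using z(1) unfolding Z'_def by blast
    have "c + l *\<^sub>R z = x + l *\<^sub>R z + (real i * l) *\<^sub>R e" "c' + l *\<^sub>R z = x + l *\<^sub>R z + (real i * l) *\<^sub>R e + l *\<^sub>R e"
      by (simp_all add: c_def c'_def)
    then have "(norm (\<phi> j (c' + l *\<^sub>R z) - \<phi> j (c + l *\<^sub>R z) - D))\<^sup>2 \<le> real (card Z') * \<eta> * l\<^sup>2"
      using idev[OF zz j] by (simp only: D_def)
    also have "real (card Z') * \<eta> = (\<kappa> / 3)\<^sup>2" using cZ cZ' by (simp add: \<eta>_def)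
    also have "(\<kappa> / 3)\<^sup>2 * l\<^sup>2 = (\<kappa> / 3 * l)\<^sup>2" by (rule power_mult_distrib[symmetric])
    finally have 1: "norm (\<phi> j (c' + l *\<^sub>R z) - \<phi> j (c + l *\<^sub>R z) - D) \<le> \<kappa> / 3 * l"
      by (rule power2_le_imp_le) (use \<kappa>(1) l in simp)
    have inW: "c + l *\<^sub>R z \<in> W" "c' + l *\<^sub>R z \<in> W" "c + l *\<^sub>R y \<in> W" "c' + l *\<^sub>R y \<in> W"
      using cz[OF nz] cz[OF y] ball_sub by auto
    have lz: "\<Lambda> * norm (l *\<^sub>R y - l *\<^sub>R z) \<le> \<kappa> / 6 * l"
    proof -
      have "\<Lambda> * (l * norm (y - z)) \<le> \<Lambda> * (l * \<theta>)" using z(2) l \<open>\<Lambda> > 0\<close> by (intro mult_left_mono) auto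
      also have "\<dots> = \<kappa> / 6 * l" using \<open>\<Lambda> > 0\<close> by (simp add: \<theta>_def)
      finally show ?thesis using l by (simp flip: scaleR_diff_right)
    qed
    have 2: "norm (\<phi> j (c + l *\<^sub>R y) - \<phi> j (c + l *\<^sub>R z)) \<le> \<kappa> / 6 * l"
      using lip[OF j inW(3,1)] lz by simp
    have 3: "norm (\<phi> j (c' + l *\<^sub>R y) - \<phi> j (c' + l *\<^sub>R z)) \<le> \<kappa> / 6 * l"
      using lip[OF j inW(4,2)] lz by simp
    \<comment> \<open>Shifting a row by \<open>l *\<^sub>R z\<close> changes its total displacement
      by at most \<open>\<Lambda> * l\<close>; divided among \<open>N\<close> cells this is
      negligible compared with \<open>l\<close>.\<close>
    have 4: "norm (D - w j) \<le> \<kappa> / 3 * l"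
    proof -
      have in2: "x + l *\<^sub>R z \<in> W" "x + l *\<^sub>R z + t *\<^sub>R e \<in> W" "x \<in> W" "x + t *\<^sub>R e \<in> W"
        using seg[OF nz, of 0] seg[OF nz, of "real N"] xA ball_sub by (auto simp: Nl)
      have lzn: "\<Lambda> * norm (l *\<^sub>R z) \<le> \<Lambda> * l / 4"
      proof -
        have "\<Lambda> * (l * norm z) \<le> \<Lambda> * (l * (1 / 4))" using nz l \<open>\<Lambda> > 0\<close> by (intro mult_left_mono) auto
        then show ?thesis using l by simp
      qed
      have "norm (\<phi> j (x + l *\<^sub>R z + t *\<^sub>R e) - \<phi> j (x + t *\<^sub>R e)) \<le> \<Lambda> * l / 4"
        using lip[OF j in2(2,4)] lzn by (simp add: algebra_simps)
      moreover have "norm (\<phi> j (x + l *\<^sub>R z) - \<phi> j x) \<le> \<Lambda> * l / 4"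
        using lip[OF j in2(1,3)] lzn by simp
      ultimately have "norm ((\<phi> j (x + l *\<^sub>R z + t *\<^sub>R e) - \<phi> j (x + t *\<^sub>R e)) - (\<phi> j (x + l *\<^sub>R z) - \<phi> j x)) \<le> \<Lambda> * l"
        using \<open>\<Lambda> > 0\<close> l norm_triangle_ineq4[of "\<phi> j (x + l *\<^sub>R z + t *\<^sub>R e) - \<phi> j (x + t *\<^sub>R e)" "\<phi> j (x + l *\<^sub>R z) - \<phi> j x"]
        mult_pos_pos[OF \<open>\<Lambda> > 0\<close> l] by linarith
      moreover have "D - w j = ((\<phi> j (x + l *\<^sub>R z + t *\<^sub>R e) - \<phi> j (x + t *\<^sub>R e)) - (\<phi> j (x + l *\<^sub>R z) - \<phi> j x)) /\<^sub>R real N"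
        by (simp add: D_def w_def algebra_simps)
      then have "norm (D - w j) = norm ((\<phi> j (x + l *\<^sub>R z + t *\<^sub>R e) - \<phi> j (x + t *\<^sub>R e)) - (\<phi> j (x + l *\<^sub>R z) - \<phi> j x)) / real N"
        by (simp only: norm_scaleR) (simp add: divide_inverse mult.commute)
      ultimately have "norm (D - w j) \<le> \<Lambda> * l * (1 / real N)"
        by (simp add: divide_right_mono)
      also have "\<dots> \<le> \<Lambda> * l * (\<kappa> / (3 * \<Lambda>))"
        using xt(5) \<epsilon>le[of "\<kappa> / (3 * \<Lambda>)"] l \<open>\<Lambda> > 0\<close> by (intro mult_left_mono) auto
      also have "\<dots> = \<kappa> / 3 * l" using \<open>\<Lambda> > 0\<close> by simp
      finally show ?thesis .
    qed
    define k where "k = \<kappa> * l"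
    have "norm (\<phi> j (c' + l *\<^sub>R z) - \<phi> j (c + l *\<^sub>R z) - D) \<le> k / 3"
      "norm (\<phi> j (c + l *\<^sub>R y) - \<phi> j (c + l *\<^sub>R z)) \<le> k / 6"
      "norm (\<phi> j (c' + l *\<^sub>R y) - \<phi> j (c' + l *\<^sub>R z)) \<le> k / 6" "norm (D - w j) \<le> k / 3"
      using 1 2 3 4 by (simp_all add: k_def)
    then have "norm (\<phi> j (c' + l *\<^sub>R y) - \<phi> j (c + l *\<^sub>R y) - w j) \<le> k / 3 + k / 6 + k / 6 + k / 3" by norm
    then show ?thesis by (simp add: k_def)
  qed
  define S where "S = cball c (l / 4)"
  define S' where "S' = cball c' (l / 4)"
  have cc: "c \<in> ball a \<beta>" "c' \<in> ball a \<beta>" using cz[of 0] by auto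
  have "l \<le> \<beta>" using xt(4) \<epsilon>le[of \<beta>] by simp
  have S2: "S \<subseteq> cball a (2 * \<beta>)" "S' \<subseteq> cball a (2 * \<beta>)"
  proof -
    have "cball u (l / 4) \<subseteq> cball a (2 * \<beta>)" if "u \<in> ball a \<beta>" for u
    proof
      fix y assume "y \<in> cball u (l / 4)"
      then show "y \<in> cball a (2 * \<beta>)" using that dist_triangle[of a y u] \<open>l \<le> \<beta>\<close> l by auto
    qed
    then show "S \<subseteq> cball a (2 * \<beta>)" "S' \<subseteq> cball a (2 * \<beta>)" using cc by (auto simp: S_def S'_def)
  qed
  then have SW: "S \<subseteq> W" "S' \<subseteq> W" using \<beta>(2) by auto
  define \<tau> where "\<tau> = V / (8 * m) * l ^ d"
  have room\<kappa>: "cball (\<phi> j y) (\<kappa> * l) \<subseteq> \<phi> j ` W" if "j \<in> J" "y \<in> cball a (2 * \<beta>)" for j y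
  proof -
    have "l \<le> r0 / \<kappa>" using xt(4) \<epsilon>le[of "r0 / \<kappa>"] by simp
    then have "\<kappa> * l \<le> r0" using \<kappa>(1) by (simp add: le_divide_eq mult.commute)
    then have "cball (\<phi> j y) (\<kappa> * l) \<subseteq> cball (\<phi> j y) r0" by auto
    then show ?thesis using room[OF that] by blast
  qed
  have shell: "C * (v * ((l / 4) ^ d - (l / 4 - \<Lambda> * (\<kappa> * l)) ^ d)) \<le> \<tau>"
  proof -
    have "l / 4 = (1 / 4) * l" "l / 4 - \<Lambda> * (\<kappa> * l) = (1 / 4 - \<Lambda> * \<kappa>) * l" by (simp_all add: algebra_simps)
    then have "(l / 4) ^ d = (1 / 4) ^ d * l ^ d" "(l / 4 - \<Lambda> * (\<kappa> * l)) ^ d = (1 / 4 - \<Lambda> * \<kappa>) ^ d * l ^ d"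
      by (metis power_mult_distrib)+
    then have "(l / 4) ^ d - (l / 4 - \<Lambda> * (\<kappa> * l)) ^ d = ((1 / 4) ^ d - (1 / 4 - \<Lambda> * \<kappa>) ^ d) * l ^ d"
      by (simp only: left_diff_distrib)
    then have "C * (v * ((l / 4) ^ d - (l / 4 - \<Lambda> * (\<kappa> * l)) ^ d)) = C * (v * ((1 / 4) ^ d - (1 / 4 - \<Lambda> * \<kappa>) ^ d)) * l ^ d"
      by simp
    also have "\<dots> \<le> \<tau>" unfolding \<tau>_def using \<kappa>(3) l by (intro mult_right_mono) auto
    finally show ?thesis .
  qed
  have small: "\<Lambda> * (\<kappa> * l) < l / 4" using \<kappa>(2) l mult_strict_right_mono[OF \<kappa>(2) l] by (simp add: algebra_simps)
  have "0 \<le> \<kappa> * l" using \<kappa>(1) l by simp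
  have content_diff: "\<bar>measure lborel (\<phi> j ` S) - measure lborel (\<phi> j ` S')\<bar> \<le> \<tau>" if j: "j \<in> J" for j
  proof -
    have "measure lborel (\<phi> j ` S) \<le> measure lborel (\<phi> j ` S') + C * (v * ((l / 4) ^ d - (l / 4 - \<Lambda> * (\<kappa> * l)) ^ d))"
      unfolding S_def S'_def v_def d_def
    proof (rule chart_translate_content[OF ch[OF j] \<open>\<Lambda> > 0\<close> \<open>C \<ge> 0\<close>, where v = "w j"])
      fix y :: 'a assume "norm y \<le> l / 4"
      then show "norm (\<phi> j (c' + y) - \<phi> j (c + y) - w j) \<le> \<kappa> * l"
        using close[OF j, of "y /\<^sub>R l"] l by (simp add: divide_le_eq pos_le_divide_eq divide_inverse_commute[symmetric])
    next
      fix y assume "y \<in> cball c (l / 4)"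
      then have "y \<in> cball a (2 * \<beta>)" using S2(1) by (auto simp only: S_def)
      then show "cball (\<phi> j y) (\<kappa> * l) \<subseteq> \<phi> j ` W" by (rule room\<kappa>[OF j])
    qed (use l small SW \<open>0 \<le> \<kappa> * l\<close> in \<open>simp_all add: S_def S'_def\<close>)
    moreover have "measure lborel (\<phi> j ` S') \<le> measure lborel (\<phi> j ` S) + C * (v * ((l / 4) ^ d - (l / 4 - \<Lambda> * (\<kappa> * l)) ^ d))"
      unfolding S_def S'_def v_def d_def
    proof (rule chart_translate_content[OF ch[OF j] \<open>\<Lambda> > 0\<close> \<open>C \<ge> 0\<close>, where v = "- w j"])
      fix y :: 'a assume "norm y \<le> l / 4"
      then have "norm (\<phi> j (c' + y) - \<phi> j (c + y) - w j) \<le> \<kappa> * l"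
        using close[OF j, of "y /\<^sub>R l"] l by (simp add: divide_le_eq pos_le_divide_eq divide_inverse_commute[symmetric])
      moreover have "\<phi> j (c + y) - \<phi> j (c' + y) - - w j = - (\<phi> j (c' + y) - \<phi> j (c + y) - w j)" by simp
      ultimately show "norm (\<phi> j (c + y) - \<phi> j (c' + y) - - w j) \<le> \<kappa> * l" by (metis norm_minus_cancel)
    next
      fix y assume "y \<in> cball c' (l / 4)"
      then have "y \<in> cball a (2 * \<beta>)" using S2(2) by (auto simp only: S'_def)
      then show "cball (\<phi> j y) (\<kappa> * l) \<subseteq> \<phi> j ` W" by (rule room\<kappa>[OF j])
    qed (use l small SW \<open>0 \<le> \<kappa> * l\<close> in \<open>simp_all add: S_def S'_def\<close>)
    ultimately show ?thesis using shell by linarith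
  qed
  have contS: "measure lborel S = V * l ^ d" "measure lborel S' = V * l ^ d" "measure lborel (cball x (l / 4)) = V * l ^ d"
    using l by (simp_all add: S_def S'_def content_cball V_def v_def d_def power_divide)
  have cmp: "compact (\<phi> j ` S)" "compact (\<phi> j ` S')" if "j \<in> J" for j
    using SW by (auto simp: S_def S'_def intro!: compact_continuous_image continuous_on_subset[OF contW[OF that]])
  have contphi: "measure lborel (\<phi> j ` S) \<le> C * v * l ^ d" "measure lborel (\<phi> j ` S') \<le> C * v * l ^ d" if "j \<in> J" for j
  proof -
    have "V \<le> v" using \<open>v > 0\<close> by (simp add: V_def power_le_one mult_left_le)
    then have "V * l ^ d \<le> v * l ^ d" using l by (intro mult_right_mono) auto
    then have "C * (V * l ^ d) \<le> C * v * l ^ d" using mult_left_mono[OF _ \<open>C \<ge> 0\<close>] by (simp only: mult.assoc)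
    moreover have "measure lborel (\<phi> j ` S) \<le> C * measure lborel S" "measure lborel (\<phi> j ` S') \<le> C * measure lborel S'"
      using ch[OF that] SW unfolding bilip_chart_def by (auto simp: S_def S'_def)
    ultimately show "measure lborel (\<phi> j ` S) \<le> C * v * l ^ d" "measure lborel (\<phi> j ` S') \<le> C * v * l ^ d"
      unfolding contS by linarith+
  qed
  have diff: "\<bar>measure (if far j then R else lborel) (\<phi> j ` S) - measure (if far j then R else lborel) (\<phi> j ` S')\<bar>
     \<le> 2 * \<tau> + \<epsilon> * K * l ^ d" if j: "j \<in> J" for j
  proof (cases "far j")
    case False
    have "0 \<le> \<tau>" using content_diff[OF j] by linarith
    moreover have "0 \<le> \<epsilon> * K * l ^ d" using \<open>\<epsilon> > 0\<close> \<open>K > 0\<close> l by simp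
    ultimately show ?thesis using content_diff[OF j] False by simp
  next
    case True
    have dis: "\<phi> j ` W \<inter> W = {}" using far[OF j True] .
    have sub: "\<phi> j ` S \<subseteq> cball (\<phi> j c) (l / \<epsilon>)" "\<phi> j ` S' \<subseteq> cball (\<phi> j c) (l / \<epsilon>)"
    proof -
      have "\<epsilon> \<le> 1 / (2 * \<Lambda>)" using \<epsilon>le by blast
      then have le: "\<Lambda> * (2 * l) \<le> l / \<epsilon>" using \<open>\<epsilon> > 0\<close> \<open>\<Lambda> > 0\<close> l by (simp add: field_simps)
      have "dist c c' = l" using e l by (simp add: c'_def dist_norm)
      then have *: "norm (c - y) \<le> 2 * l" if "y \<in> S \<union> S'" for y
      proof -
        have "dist c y \<le> l / 4 \<or> dist c' y \<le> l / 4" using that by (auto simp: S_def S'_def)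
        then have "dist c y \<le> 2 * l" using \<open>dist c c' = l\<close> dist_triangle[of c y c'] l by (elim disjE) linarith+
        then show ?thesis by (simp only: dist_norm)
      qed
      have "norm (\<phi> j c - \<phi> j y) \<le> l / \<epsilon>" if "y \<in> S \<union> S'" for y
      proof -
        have "norm (\<phi> j c - \<phi> j y) \<le> \<Lambda> * norm (c - y)" using that SW cc ball_sub by (intro lip[OF j]) auto
        also have "\<dots> \<le> \<Lambda> * (2 * l)" using *[OF that] \<open>\<Lambda> > 0\<close> by simp
        finally show ?thesis using le by linarith
      qed
      then show "\<phi> j ` S \<subseteq> cball (\<phi> j c) (l / \<epsilon>)" "\<phi> j ` S' \<subseteq> cball (\<phi> j c) (l / \<epsilon>)" by (auto simp: dist_norm)
    qed
    \<comment> \<open>The row stays inside \<open>W\<close>, while the image of a far chart avoids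
      \<open>W\<close>. Hence the off-row clause applies to the images of both balls.\<close>
    have rowW: "cball (x + (real k * l) *\<^sub>R e) (l / 3) \<subseteq> W" if "k \<le> N" for k
    proof
      fix y assume y: "y \<in> cball (x + (real k * l) *\<^sub>R e) (l / 3)"
      have "x + (real k * l) *\<^sub>R e \<in> ball a \<beta>" using seg[of 0 "real k"] that by simp
      then have "dist a y \<le> 2 * \<beta>"
        using y dist_triangle[of a y "x + (real k * l) *\<^sub>R e"] \<open>l \<le> \<beta>\<close> l by auto
      then show "y \<in> W" using \<beta>(2) by auto
    qed
    obtain b where b: "0 \<le> b" "b \<le> 2" and bE: "\<forall>E\<in>sets borel. E \<subseteq> cball (\<phi> j c) (l / \<epsilon>) \<longrightarrow>
            (\<forall>i\<le>N. E \<inter> cball (x + (real i * l) *\<^sub>R e) (l / 3) = {}) \<longrightarrow>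
            \<bar>measure R E - b * measure lborel E\<bar> \<le> \<epsilon> * (measure lborel E + l ^ DIM('a))"
      using offrow[of "\<phi> j c"] by (elim exE conjE) (rule that)
    have near: "\<bar>measure R (\<phi> j ` T) - b * measure lborel (\<phi> j ` T)\<bar> \<le> \<epsilon> * (C * v * l ^ d + l ^ d)" if T: "T = S \<or> T = S'" for T
    proof -
      have "\<bar>measure R (\<phi> j ` T) - b * measure lborel (\<phi> j ` T)\<bar> \<le> \<epsilon> * (measure lborel (\<phi> j ` T) + l ^ DIM('a))"
      proof (rule bE[rule_format])
        show "\<phi> j ` T \<in> sets borel" using cmp[OF j] T by (auto simp: borel_compact)
        fix k
        show "\<phi> j ` T \<inter> cball (x + (real k * l) *\<^sub>R e) (l / 3) = {}" if "k \<le> N"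
        proof -
          have "\<phi> j ` T \<subseteq> \<phi> j ` W" using T SW by blast
          then show "\<phi> j ` T \<inter> cball (x + (real k * l) *\<^sub>R e) (l / 3) = {}" using rowW[OF \<open>k \<le> N\<close>] dis by blast
        qed
      qed (use sub T in auto)
      also have "\<dots> \<le> \<epsilon> * (C * v * l ^ d + l ^ d)"
        using contphi[OF j] T \<open>\<epsilon> > 0\<close> by (intro mult_left_mono add_mono) (auto simp: d_def)
      finally show ?thesis .
    qed
    have "b * \<bar>measure lborel (\<phi> j ` S) - measure lborel (\<phi> j ` S')\<bar> \<le> 2 * \<tau>"
      using content_diff[OF j] b by (intro mult_mono) auto
    then have bb: "\<bar>b * measure lborel (\<phi> j ` S) - b * measure lborel (\<phi> j ` S')\<bar> \<le> 2 * \<tau>"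
      using b(1) by (simp add: abs_mult flip: right_diff_distrib)
    have "\<bar>p - q\<bar> \<le> t + (u + u)" if "\<bar>p - x\<bar> \<le> u" "\<bar>q - y\<bar> \<le> u" "\<bar>x - y\<bar> \<le> t" for p q x y u t :: real
      using that by linarith
    from this[OF near[OF disjI1[OF refl]] near[OF disjI2[OF refl]] bb]
    have "\<bar>measure R (\<phi> j ` S) - measure R (\<phi> j ` S')\<bar>
      \<le> 2 * \<tau> + (\<epsilon> * (C * v * l ^ d + l ^ d) + \<epsilon> * (C * v * l ^ d + l ^ d))" .
    moreover have "\<epsilon> * K * l ^ d = \<epsilon> * (C * v * l ^ d + l ^ d) + \<epsilon> * (C * v * l ^ d + l ^ d)"
      by (simp add: K_def algebra_simps)
    ultimately show ?thesis by (simp only: True if_True)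
  qed
  have "measure R S - measure R S' = (\<Sum>j\<in>J. s j * (measure (if far j then R else lborel) (\<phi> j ` S) - measure (if far j then R else lborel) (\<phi> j ` S')))"
    using eq[of S] eq[of S'] SW by (simp add: S_def S'_def sum_subtractf right_diff_distrib)
  also have "\<bar>\<dots>\<bar> \<le> (\<Sum>j\<in>J. 2 * \<tau> + \<epsilon> * K * l ^ d)"
  proof (rule order_trans[OF sum_abs sum_mono])
    fix j assume j: "j \<in> J"
    let ?D = "measure (if far j then R else lborel) (\<phi> j ` S) - measure (if far j then R else lborel) (\<phi> j ` S')"
    have "\<bar>s j * ?D\<bar> \<le> 1 * \<bar>?D\<bar>" unfolding abs_mult by (intro mult_right_mono s[OF j]) auto
    then have "\<bar>s j * ?D\<bar> \<le> \<bar>?D\<bar>" by (simp only: mult_1)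
    then show "\<bar>s j * ?D\<bar> \<le> 2 * \<tau> + \<epsilon> * K * l ^ d" by (rule order_trans[OF _ diff[OF j]])
  qed
  also have "\<dots> \<le> m * (2 * \<tau> + \<epsilon> * K * l ^ d)"
  proof -
    have "0 \<le> 2 * \<tau> + \<epsilon> * K * l ^ d"
      using \<open>V > 0\<close> \<open>m \<ge> 1\<close> l \<open>\<epsilon> > 0\<close> \<open>K > 0\<close> by (simp add: \<tau>_def)
    then show ?thesis by (simp add: m_def distrib_right)
  qed
  also have "\<dots> \<le> m * (2 * (V / (8 * m) * l ^ d) + V / (8 * m * K) * K * l ^ d)"
    unfolding \<tau>_def using \<epsilon>le[of "V / (8 * m * K)"] \<open>K > 0\<close> l \<open>m \<ge> 1\<close>
    by (intro mult_left_mono add_left_mono mult_right_mono) auto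
  also have "\<dots> = 3 / 8 * V * l ^ d" using \<open>m \<ge> 1\<close> \<open>K > 0\<close> by (simp add: field_simps)
  finally have up: "\<bar>measure R S - measure R S'\<bar> \<le> 3 / 8 * V * l ^ d" .
  \<comment> \<open>The densities 2 and 1 differ by \<open>V * l ^ d\<close>. Two density errors of
    \<open>V / 8\<close> leave three quarters of this, against the three eighths allowed by
    \<open>up\<close>.\<close>
  have "\<bar>measure R S - (if even i then 2 else 1) * (V * l ^ d)\<bar> \<le> \<epsilon> * l ^ d"
    using dens[of i] i contS(3) by (simp add: S_def c_def d_def)
  moreover have "\<bar>measure R S' - (if even (Suc i) then 2 else 1) * (V * l ^ d)\<bar> \<le> \<epsilon> * l ^ d"
    using dens[of "Suc i"] i contS(3) by (simp add: S'_def c'_def c_def d_def algebra_simps)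
  moreover have "\<epsilon> * l ^ d \<le> V / 8 * l ^ d" using \<epsilon>le[of "V / 8"] l by (intro mult_right_mono) auto
  moreover have "V * l ^ d > 0" using \<open>V > 0\<close> l by simp
  ultimately show False using up by (cases "even i") (auto simp: abs_le_iff algebra_simps)
qed

text \<open>A Vitali covering inside an open set of almost the volume of \<open>V\<close>: the
  selected balls are disjoint and their fivefold enlargements cover \<open>V\<close>, whence the
  factor \<open>5 * L\<close>.\<close>

lemma lipschitz_image_content:
  fixes F :: "'a::euclidean_space \<Rightarrow> 'a"
  assumes lip: "\<And>x y. norm (F x - F y) \<le> L * norm (x - y)" and "L > 0" and V: "compact V"
  shows "measure lborel (F ` V) \<le> (5 * L) ^ DIM('a) * measure lborel V"
proof (rule field_le_epsilon)
  fix e :: real assume "e > 0"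
  have cont: "continuous_on A F" for A
    by (rule lipschitz_on_continuous_on[of L]) (use lip \<open>L > 0\<close> in \<open>auto intro!: lipschitz_onI simp: dist_norm\<close>)
  define e' where "e' = e / (5 * L) ^ DIM('a)"
  have "e' > 0" using \<open>e > 0\<close> \<open>L > 0\<close> by (simp add: e'_def)
  obtain N where N: "open N" "V \<subseteq> N" "emeasure lborel (N - V) < ennreal e'"
    using outer_regular_lborel[OF borel_compact[OF V] \<open>e' > 0\<close>] by metis
  have fV: "V \<in> fmeasurable lborel"
    using emeasure_bounded_finite[OF compact_imp_bounded[OF V]] V by (auto simp: fmeasurable_def borel_compact)
  have fD: "N - V \<in> fmeasurable lborel" "measure lborel (N - V) \<le> e'"
  proof -
    show f: "N - V \<in> fmeasurable lborel" using N V by (auto simp: fmeasurable_def borel_compact intro: order.strict_trans)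
    show "measure lborel (N - V) \<le> e'"
      using N(3) f \<open>e' > 0\<close> by (simp add: emeasure_eq_measure2 ennreal_less_iff less_imp_le)
  qed
  have NV: "N = V \<union> (N - V)" using N(2) by blast
  have fN: "N \<in> fmeasurable lborel" by (subst NV) (rule fmeasurable.Un[OF fV fD(1)])
  have mN: "measure lborel N \<le> measure lborel V + e'"
    using measure_Un_le[of V lborel "N - V"] fD fV NV by (auto simp: fmeasurable_def)
  have "\<forall>x\<in>V. \<exists>r>0. r \<le> 1 \<and> ball x r \<subseteq> N"
  proof
    fix x assume "x \<in> V"
    then obtain r where "r > 0" "ball x r \<subseteq> N" using N openE by blast
    then show "\<exists>r>0. r \<le> 1 \<and> ball x r \<subseteq> N" by (intro exI[of _ "min r 1"]) auto
  qed
  then obtain r where r: "\<And>x. x \<in> V \<Longrightarrow> r x > 0 \<and> r x \<le> 1 \<and> ball x (r x) \<subseteq> N" by metis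
  obtain X where X: "X \<subseteq> V" "finite X" "V \<subseteq> (\<Union>x\<in>X. ball x (r x))"
  proof (rule compactE_image[OF V, of V "\<lambda>x. ball x (r x)"])
    show "V \<subseteq> (\<Union>x\<in>V. ball x (r x))"
    proof
      fix x assume "x \<in> V"
      then show "x \<in> (\<Union>x\<in>V. ball x (r x))" using r[OF \<open>x \<in> V\<close>] by (intro UN_I[of x]) auto
    qed
  qed (simp_all add: that)
  obtain Y where Y: "countable Y" "Y \<subseteq> X" "pairwise (\<lambda>i j. disjnt (ball i (r i)) (ball j (r j))) Y"
    "V \<subseteq> (\<Union>i\<in>Y. ball i (5 * r i))"
  proof (rule Vitali_covering_lemma_balls[where S = V and K = X and a = "\<lambda>x. x" and r = r and B = 1])
    show "0 < r i \<and> r i \<le> 1" if "i \<in> X" for i using r that X(1) by blast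
  qed (simp_all add: X(3) that)
  have fin: "finite Y" using Y(2) X(2) finite_subset by blast
  have rY: "r y > 0" "ball y (r y) \<subseteq> N" if "y \<in> Y" for y using r that Y(2) X(1) by auto
  have fc: "cball z s \<in> fmeasurable lborel" "ball z s \<in> fmeasurable lborel" for z :: 'a and s
    using emeasure_bounded_finite[of "cball z s"] emeasure_bounded_finite[of "ball z s"] by (auto simp: fmeasurable_def)
  have sub: "F ` V \<subseteq> (\<Union>y\<in>Y. cball (F y) (5 * L * r y))"
  proof
    fix w assume "w \<in> F ` V"
    then obtain x where x: "x \<in> V" "w = F x" by blast
    then obtain y where y: "y \<in> Y" "dist y x < 5 * r y" using Y(4) by auto
    have "dist (F y) w \<le> L * dist y x" using lip[of y x] x(2) by (simp add: dist_norm)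
    also have "\<dots> \<le> L * (5 * r y)" using y(2) \<open>L > 0\<close> by simp
    finally show "w \<in> (\<Union>y\<in>Y. cball (F y) (5 * L * r y))" using y(1) by (auto simp: algebra_simps)
  qed
  have "measure lborel (F ` V) \<le> measure lborel (\<Union>y\<in>Y. cball (F y) (5 * L * r y))"
    by (rule measure_mono_fmeasurable[OF sub])
       (use fin fc V in \<open>auto intro!: borel_compact compact_continuous_image cont fmeasurable.finite_UN\<close>)
  also have "\<dots> \<le> (\<Sum>y\<in>Y. measure lborel (cball (F y) (5 * L * r y)))"
    using fin fc by (intro measure_UNION_le) (auto simp: fmeasurable_def)
  also have "\<dots> = (\<Sum>y\<in>Y. (5 * L) ^ DIM('a) * measure lborel (ball y (r y)))"
    using rY \<open>L > 0\<close> by (intro sum.cong) (auto simp: content_cball content_ball power_mult_distrib less_imp_le)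
  also have "\<dots> = (5 * L) ^ DIM('a) * (\<Sum>y\<in>Y. measure lborel (ball y (r y)))" by (simp add: sum_distrib_left)
  also have "(\<Sum>y\<in>Y. measure lborel (ball y (r y))) = measure lborel (\<Union>y\<in>Y. ball y (r y))"
    using fin fc Y(3) by (intro measure_UNION'[symmetric]) auto
  also have "\<dots> \<le> measure lborel N"
    using rY(2) fin by (intro measure_mono_fmeasurable[OF _ _ fN]) auto
  also have "\<dots> \<le> measure lborel V + e'" by (rule mN)
  finally have "measure lborel (F ` V) \<le> (5 * L) ^ DIM('a) * (measure lborel V + e')"
    using \<open>L > 0\<close> by (simp add: mult_left_mono)
  also have "\<dots> = (5 * L) ^ DIM('a) * measure lborel V + e" using \<open>L > 0\<close> by (simp add: e'_def algebra_simps)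
  finally show "measure lborel (F ` V) \<le> (5 * L) ^ DIM('a) * measure lborel V + e" .
qed

section \<open>Inverse sheets and the two directions of transport\<close>

context lipschitz_transport
begin

text \<open>Over a small ball the preimage of \<open>V\<close> is the disjoint union of its images
  under the local inverses, which makes transport a finite sum. The inverses cannot enlarge volume
  by more than 2, because \<open>F\<close> maps their images back onto \<open>V\<close>.\<close>

lemma sheet_inverses:
  obtains n y s W C \<psi> where "0 < (n::nat)" "0 < s" "C > 0"
    "\<And>i. i < n \<Longrightarrow> open (W i)" "\<And>i j. i < n \<Longrightarrow> j < n \<Longrightarrow> i \<noteq> j \<Longrightarrow> W i \<inter> W j = {}"
    "W 0 \<noteq> {}" "\<And>i. i < n \<Longrightarrow> F ` W i = ball y s" "\<And>i. i < n \<Longrightarrow> \<psi> i ` ball y s = W i"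
    "\<And>i u. i < n \<Longrightarrow> u \<in> ball y s \<Longrightarrow> F (\<psi> i u) = u" "\<And>i x. i < n \<Longrightarrow> x \<in> W i \<Longrightarrow> \<psi> i (F x) = x"
    "\<And>i u u'. i < n \<Longrightarrow> u \<in> ball y s \<Longrightarrow> u' \<in> ball y s \<Longrightarrow> norm (\<psi> i u - \<psi> i u') \<le> C * norm (u - u')"
    "\<And>V. compact V \<Longrightarrow> V \<subseteq> ball y s \<Longrightarrow> measure T V = (\<Sum>i<n. measure S (\<psi> i ` V))"
    "\<And>i V. i < n \<Longrightarrow> compact V \<Longrightarrow> V \<subseteq> ball y s \<Longrightarrow> measure lborel (\<psi> i ` V) \<le> 2 * measure lborel V"
proof -
  obtain n y s W C where n: "0 < (n::nat)" "0 < s" "C > 0"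
    and Wo: "\<And>i. i < n \<Longrightarrow> open (W i)" and Wd: "\<And>i j. i < n \<Longrightarrow> j < n \<Longrightarrow> i \<noteq> j \<Longrightarrow> W i \<inter> W j = {}"
    and Wu: "F -` ball y s = (\<Union>i<n. W i)" and WF: "\<And>i. i < n \<Longrightarrow> F ` W i = ball y s"
    and Wc: "\<And>i x x'. i < n \<Longrightarrow> x \<in> W i \<Longrightarrow> x' \<in> W i \<Longrightarrow> norm (x - x') \<le> C * norm (F x - F x')"
    by (rule bilipschitz_sheets) (rule that)
  define \<psi> where "\<psi> i = inv_into (W i) F" for i
  have inj: "inj_on F (W i)" if "i < n" for i
  proof (rule inj_onI)
    fix a b assume "a \<in> W i" "b \<in> W i" "F a = F b"
    then show "a = b" using Wc[OF that, of a b] by simp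
  qed
  have \<psi>W: "\<psi> i u \<in> W i" "F (\<psi> i u) = u" if "i < n" "u \<in> ball y s" for i u
    using that WF[OF that(1)] by (auto simp: \<psi>_def inv_into_into f_inv_into_f)
  have \<psi>F: "\<psi> i (F x) = x" if "i < n" "x \<in> W i" for i x
    using inv_into_f_f[OF inj[OF that(1)] that(2)] by (simp add: \<psi>_def)
  have \<psi>im: "\<psi> i ` ball y s = W i" if "i < n" for i
  proof
    show "W i \<subseteq> \<psi> i ` ball y s"
    proof
      fix x assume "x \<in> W i"
      then have "F x \<in> ball y s" using WF[OF that] by blast
      then show "x \<in> \<psi> i ` ball y s" using \<psi>F[OF that \<open>x \<in> W i\<close>] by (metis image_eqI)
    qed
  qed (use \<psi>W that in auto)
  have \<psi>l: "norm (\<psi> i u - \<psi> i u') \<le> C * norm (u - u')" if "i < n" "u \<in> ball y s" "u' \<in> ball y s" for i u u'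
    using Wc[OF that(1) \<psi>W(1)[OF that(1,2)] \<psi>W(1)[OF that(1,3)]] \<psi>W(2) that by simp
  have cmp: "compact (\<psi> i ` V)" if "i < n" "compact V" "V \<subseteq> ball y s" for i V
  proof (rule compact_continuous_image[OF _ that(2)], rule lipschitz_on_continuous_on[of C], rule lipschitz_onI)
    fix a b assume "a \<in> V" "b \<in> V"
    then show "dist (\<psi> i a) (\<psi> i b) \<le> C * dist a b" using \<psi>l[OF that(1) subsetD[OF that(3)] subsetD[OF that(3)], of a b] by (simp add: dist_norm)
  qed (use n in simp)
  show thesis
  proof (rule that[of n s C W y \<psi>])
    show "W 0 \<noteq> {}" using WF[of 0] n centre_in_ball[of y s] by force
    show "measure lborel (\<psi> i ` V) \<le> 2 * measure lborel V" if "i < n" "compact V" "V \<subseteq> ball y s" for i V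
      by (rule measure_le_of_image_subset(2)) (use cmp[OF that] \<psi>W(2) that in \<open>auto simp: borel_compact compact_imp_bounded\<close>)
    show "measure T V = (\<Sum>i<n. measure S (\<psi> i ` V))" if V: "compact V" "V \<subseteq> ball y s" for V
    proof -
      have un: "F -` V = (\<Union>i<n. \<psi> i ` V)"
      proof
        show "F -` V \<subseteq> (\<Union>i<n. \<psi> i ` V)"
        proof
          fix x assume x: "x \<in> F -` V"
          then obtain i where i: "i < n" "x \<in> W i" using Wu V(2) by blast
          then show "x \<in> (\<Union>i<n. \<psi> i ` V)" using \<psi>F[OF i] x by (auto intro!: rev_image_eqI[of "F x"] bexI[of _ i])
        qed
      qed (use \<psi>W(2) V(2) in auto)
      have sb: "sets S = sets borel" using S by (simp add: comparable_def)
      have "measure S (\<Union>i<n. \<psi> i ` V) = (\<Sum>i<n. measure S (\<psi> i ` V))"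
      proof (rule measure_finite_Union)
        show "(\<lambda>i. \<psi> i ` V) ` {..<n} \<subseteq> sets S" using cmp V sb by (auto simp: borel_compact)
        show "disjoint_family_on (\<lambda>i. \<psi> i ` V) {..<n}"
          unfolding disjoint_family_on_def
        proof (intro ballI impI)
          fix i j assume ij: "i \<in> {..<n}" "j \<in> {..<n}" "i \<noteq> j"
          have "\<psi> i ` V \<subseteq> W i" "\<psi> j ` V \<subseteq> W j" using \<psi>W(1) V(2) ij by auto
          then show "\<psi> i ` V \<inter> \<psi> j ` V = {}" using Wd[of i j] ij by blast
        qed
        fix i assume "i \<in> {..<n}"
        then have "compact (\<psi> i ` V)" using cmp V by blast
        then show "emeasure S (\<psi> i ` V) \<noteq> \<infinity>"
          using comparable_fmeasurable[OF S compact_imp_bounded borel_compact, of "\<psi> i ` V"] by (auto simp: fmeasurable_def)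
      qed simp
      moreover have "measure T V = measure S (F -` V)" using transport[OF V(1)] by (simp add: measure_def)
      ultimately show ?thesis using un by simp
    qed
  qed (use n Wo Wd WF \<psi>W \<psi>F \<psi>im \<psi>l in auto)
qed

end

text \<open>Here \<open>R\<close> is a sum of volumes of the inverse sheets over one ball of the
  target, so these are the charts and none is far.\<close>

theorem no_transport_to_row_measure:
  assumes "lipschitz_transport F lborel R L" and row: "row_property R e" and e: "norm e = 1"
  shows False
proof -
  interpret lipschitz_transport F lborel R L by fact
  obtain n y s W C \<psi> where n: "0 < (n::nat)" "0 < s" "C > 0"
    and W: "\<And>i. i < n \<Longrightarrow> open (W i)"
    and \<psi>im: "\<And>i. i < n \<Longrightarrow> \<psi> i ` ball y s = W i"
    and F\<psi>: "\<And>i u. i < n \<Longrightarrow> u \<in> ball y s \<Longrightarrow> F (\<psi> i u) = u"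
    and \<psi>l: "\<And>i u u'. i < n \<Longrightarrow> u \<in> ball y s \<Longrightarrow> u' \<in> ball y s \<Longrightarrow> norm (\<psi> i u - \<psi> i u') \<le> C * norm (u - u')"
    and \<psi>m: "\<And>V. compact V \<Longrightarrow> V \<subseteq> ball y s \<Longrightarrow> measure R V = (\<Sum>i<n. measure lborel (\<psi> i ` V))"
    and \<psi>c: "\<And>i V. i < n \<Longrightarrow> compact V \<Longrightarrow> V \<subseteq> ball y s \<Longrightarrow> measure lborel (\<psi> i ` V) \<le> 2 * measure lborel V"
    by (rule sheet_inverses) (rule that)
  show False
  proof (rule no_chart_decomposition[OF T row e, of "ball y s" "{..<n}" "C + L" 2 \<psi> "\<lambda>_. 1" "\<lambda>_. False"])
    fix j assume j: "j \<in> {..<n}"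
    show "bilip_chart (C + L) 2 (ball y s) (\<psi> j)"
      unfolding bilip_chart_def
    proof (intro conjI ballI allI impI)
      fix u u' assume u: "u \<in> ball y s" "u' \<in> ball y s"
      have "norm (\<psi> j u - \<psi> j u') \<le> C * norm (u - u')" using \<psi>l j u by auto
      also have "\<dots> \<le> (C + L) * norm (u - u')" using L by (intro mult_right_mono) auto
      finally show "norm (\<psi> j u - \<psi> j u') \<le> (C + L) * norm (u - u')" .
      have "norm (u - u') \<le> L * norm (\<psi> j u - \<psi> j u')" using lip[of "\<psi> j u" "\<psi> j u'"] F\<psi> j u by simp
      also have "\<dots> \<le> (C + L) * norm (\<psi> j u - \<psi> j u')" using n by (intro mult_right_mono) auto
      finally show "norm (u - u') \<le> (C + L) * norm (\<psi> j u - \<psi> j u')" .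
    qed (use W \<psi>im \<psi>c j in auto)
  qed (use n L \<psi>m in auto)
qed

text \<open>With \<open>W 0\<close> as domain, the sum over sheets is solved for the sheet
  \<open>0\<close>: \<open>R\<close> of \<open>V\<close> is the volume of its \<open>F\<close>-image
  minus the \<open>R\<close>-measures of its transfers to the other sheets. The latter land in
  \<open>W j\<close>, disjoint from \<open>W 0\<close>, and are the far charts.\<close>

theorem no_transport_from_row_measure:
  assumes "lipschitz_transport F R lborel L" and row: "row_property R e" and e: "norm e = 1"
  shows False
proof -
  interpret lipschitz_transport F R lborel L by fact
  obtain n y s W C \<psi> where n: "0 < (n::nat)" "0 < s" "C > 0"
    and W: "\<And>i. i < n \<Longrightarrow> open (W i)" and Wd: "\<And>i j. i < n \<Longrightarrow> j < n \<Longrightarrow> i \<noteq> j \<Longrightarrow> W i \<inter> W j = {}"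
    and W0: "W 0 \<noteq> {}" and FW: "\<And>i. i < n \<Longrightarrow> F ` W i = ball y s"
    and \<psi>im: "\<And>i. i < n \<Longrightarrow> \<psi> i ` ball y s = W i"
    and F\<psi>: "\<And>i u. i < n \<Longrightarrow> u \<in> ball y s \<Longrightarrow> F (\<psi> i u) = u" and \<psi>F: "\<And>i x. i < n \<Longrightarrow> x \<in> W i \<Longrightarrow> \<psi> i (F x) = x"
    and \<psi>l: "\<And>i u u'. i < n \<Longrightarrow> u \<in> ball y s \<Longrightarrow> u' \<in> ball y s \<Longrightarrow> norm (\<psi> i u - \<psi> i u') \<le> C * norm (u - u')"
    and \<psi>m: "\<And>V. compact V \<Longrightarrow> V \<subseteq> ball y s \<Longrightarrow> measure lborel V = (\<Sum>i<n. measure R (\<psi> i ` V))"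
    and \<psi>c: "\<And>i V. i < n \<Longrightarrow> compact V \<Longrightarrow> V \<subseteq> ball y s \<Longrightarrow> measure lborel (\<psi> i ` V) \<le> 2 * measure lborel V"
    by (rule sheet_inverses) (rule that)
  define \<phi> where "\<phi> j x = (if j = 0 then F x else \<psi> j (F x))" for j x
  \<comment> \<open>A transfer first applies \<open>F\<close>, with Lipschitz volume factor, and
    then an inverse sheet, with factor 2.\<close>
  define M where "M = 2 * (5 * L) ^ DIM('a)"
  define \<Lambda> where "\<Lambda> = C * L + C + L"
  have Fs: "F x \<in> ball y s" if "x \<in> W 0" for x using FW[of 0] n that by blast
  have inv0: "norm (x - x') \<le> C * norm (F x - F x')" if "x \<in> W 0" "x' \<in> W 0" for x x'
    using \<psi>l[of 0 "F x" "F x'"] \<psi>F[of 0] that Fs n by simp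
  have Fc: "measure lborel (F ` V) \<le> (5 * L) ^ DIM('a) * measure lborel V" if "compact V" for V
    by (rule lipschitz_image_content) (use lip L that in auto)
  have "C * L > 0" using n L by simp
  have up: "k * norm (z::'a) \<le> \<Lambda> * norm z" if "k \<le> \<Lambda>" for k z using that by (intro mult_right_mono) auto
  have le: "L \<le> \<Lambda>" "C \<le> \<Lambda>" "C * L \<le> \<Lambda>" using \<open>C * L > 0\<close> n L by (auto simp: \<Lambda>_def)
  show False
  proof (rule no_chart_decomposition[OF S row e, of "W 0" "{..<n}" \<Lambda> M \<phi> "\<lambda>j. if j = 0 then 1 else - 1" "\<lambda>j. j \<noteq> 0"])
    fix j assume j: "j \<in> {..<n}"
    show "bilip_chart \<Lambda> M (W 0) (\<phi> j)"
    proof (cases "j = 0")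
      case True
      then have \<phi>: "\<phi> j = F" by (simp add: \<phi>_def fun_eq_iff)
      show ?thesis unfolding bilip_chart_def \<phi>
      proof (intro conjI ballI allI impI)
        fix x x' assume x: "x \<in> W 0" "x' \<in> W 0"
        show "norm (F x - F x') \<le> \<Lambda> * norm (x - x')" using lip[of x x'] up[OF le(1), of "x - x'"] by linarith
        show "norm (x - x') \<le> \<Lambda> * norm (F x - F x')" using inv0[OF x] up[OF le(2), of "F x - F x'"] by linarith
      next
        fix V :: "'a set" assume "compact V"
        have "0 \<le> (5 * L) ^ DIM('a) * measure lborel V" using L by simp
        then show "measure lborel (F ` V) \<le> M * measure lborel V"
          using Fc[OF \<open>compact V\<close>] unfolding M_def by linarith
      qed (use FW n in auto)
    next
      case False
      then have \<phi>: "\<phi> j = (\<lambda>x. \<psi> j (F x))" by (simp add: \<phi>_def fun_eq_iff)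
      have jn: "j < n" using j by simp
      show ?thesis unfolding bilip_chart_def \<phi>
      proof (intro conjI ballI allI impI)
        have "(\<lambda>x. \<psi> j (F x)) ` W 0 = W j" using FW[of 0] \<psi>im[OF jn] n by (metis image_image)
        then show "open ((\<lambda>x. \<psi> j (F x)) ` W 0)" using W[OF jn] by simp
      next
        fix x x' assume x: "x \<in> W 0" "x' \<in> W 0"
        have "norm (\<psi> j (F x) - \<psi> j (F x')) \<le> C * norm (F x - F x')" by (rule \<psi>l[OF jn Fs[OF x(1)] Fs[OF x(2)]])
        also have "\<dots> \<le> C * (L * norm (x - x'))" using lip n by (intro mult_left_mono) auto
        finally show "norm (\<psi> j (F x) - \<psi> j (F x')) \<le> \<Lambda> * norm (x - x')"
          using up[OF le(3), of "x - x'"] by (simp add: mult.assoc)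
        have "norm (F x - F x') \<le> L * norm (\<psi> j (F x) - \<psi> j (F x'))"
          using lip[of "\<psi> j (F x)" "\<psi> j (F x')"] F\<psi>[OF jn] Fs x by simp
        then have "C * norm (F x - F x') \<le> C * (L * norm (\<psi> j (F x) - \<psi> j (F x')))" using n by (intro mult_left_mono) auto
        then show "norm (x - x') \<le> \<Lambda> * norm (\<psi> j (F x) - \<psi> j (F x'))"
          using inv0[OF x] up[OF le(3), of "\<psi> j (F x) - \<psi> j (F x')"] by (simp add: mult.assoc)
      next
        fix V assume V: "compact V" "V \<subseteq> W 0"
        have "measure lborel (\<psi> j ` F ` V) \<le> 2 * measure lborel (F ` V)"
          by (rule \<psi>c[OF jn compact_continuous_image[OF cont V(1)]]) (use Fs V(2) in auto)
        then show "measure lborel ((\<lambda>x. \<psi> j (F x)) ` V) \<le> M * measure lborel V"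
          using Fc[OF V(1)] by (simp add: image_image M_def)
      qed
    qed
    show "\<phi> j ` W 0 \<inter> W 0 = {}" if "j \<noteq> 0"
    proof -
      have "\<phi> j ` W 0 \<subseteq> W j" using \<psi>im[of j] Fs j that by (auto simp: \<phi>_def)
      then show ?thesis using Wd[of j 0] j that n by auto
    qed
  next
    fix V assume V: "compact V" "V \<subseteq> W 0"
    have "measure lborel (F ` V) = (\<Sum>i<n. measure R (\<psi> i ` F ` V))"
      by (rule \<psi>m[OF compact_continuous_image[OF cont V(1)]]) (use Fs V(2) in auto)
    also have "\<dots> = measure R (\<psi> 0 ` F ` V) + (\<Sum>i\<in>{..<n} - {0}. measure R (\<psi> i ` F ` V))"
      using n by (intro sum.remove) auto
    also have "\<psi> 0 ` F ` V = V"
    proof -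
      have "\<psi> 0 (F x) = x" if "x \<in> V" for x using \<psi>F[of 0 x] n V that by auto
      then show ?thesis by (simp add: image_image)
    qed
    also have "(\<Sum>i\<in>{..<n} - {0}. measure R (\<psi> i ` F ` V)) = (\<Sum>i\<in>{..<n} - {0}. measure R (\<phi> i ` V))"
    proof (rule sum.cong[OF refl])
      fix i assume "i \<in> {..<n} - {0}"
      then have "\<phi> i ` V = \<psi> i ` F ` V" by (auto simp: \<phi>_def image_image)
      then show "measure R (\<psi> i ` F ` V) = measure R (\<phi> i ` V)" by simp
    qed
    finally have eq: "measure lborel (F ` V) = measure R V + (\<Sum>i\<in>{..<n} - {0}. measure R (\<phi> i ` V))" .
    have "(\<Sum>j<n. (if j = 0 then 1 else - 1) * measure (if j \<noteq> 0 then R else lborel) (\<phi> j ` V))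
      = measure lborel (\<phi> 0 ` V) + (\<Sum>j\<in>{..<n} - {0}. - measure R (\<phi> j ` V))"
      using n by (subst sum.remove[of _ 0]) (auto intro!: sum.cong)
    also have "\<phi> 0 ` V = F ` V" by (simp add: \<phi>_def)
    finally show "measure R V = (\<Sum>j<n. (if j = 0 then 1 else - 1) * measure (if j \<noteq> 0 then R else lborel) (\<phi> j ` V))"
      using eq by (simp add: sum_negf)
  qed (use n L W W0 le \<open>C * L > 0\<close> in \<open>auto simp: M_def\<close>)
qed

section \<open>A measure oscillating along thin rows\<close>

lemma measure_density_near_constant:
  fixes \<rho> :: "'a::euclidean_space \<Rightarrow> real"
  assumes \<rho>[measurable]: "\<rho> \<in> borel_measurable borel" and \<rho>12: "\<And>y. 1 \<le> \<rho> y \<and> \<rho> y \<le> 2"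
    and E[measurable]: "E \<in> sets borel" "bounded E" and G[measurable]: "G \<in> sets borel"
    and c: "1 \<le> c" "c \<le> 2" and "0 \<le> a"
    and near: "\<And>y. y \<in> E - G \<Longrightarrow> \<bar>\<rho> y - c\<bar> \<le> a"
  shows "\<bar>measure (density lborel (\<lambda>y. ennreal (\<rho> y))) E - c * measure lborel E\<bar> \<le> a * measure lborel E + measure lborel (E \<inter> G)"
proof -
  have fin: "emeasure lborel E < \<infinity>" by (rule emeasure_bounded_finite[OF E(2)])
  have p: "0 \<le> \<rho> y" "\<bar>\<rho> y\<bar> \<le> 2" for y using \<rho>12[of y] by auto
  have iE: "integrable lborel (\<lambda>y. indicator E y :: real)"
    using fin by (intro integrable_real_indicator) (auto simp: E)
  have finG: "emeasure lborel (E \<inter> G) < \<infinity>"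
    using fin emeasure_mono[of "E \<inter> G" E lborel] by (auto simp: order.strict_trans1)
  have iG: "integrable lborel (\<lambda>y. indicator (E \<inter> G) y :: real)"
    using finG by (intro integrable_real_indicator) auto
  have i\<rho>: "integrable lborel (\<lambda>y. \<rho> y * indicator E y)"
    by (rule Bochner_Integration.integrable_bound[OF integrable_mult_right[OF iE, of 2]])
       (use p in \<open>auto simp: indicator_def\<close>)
  have "measure (density lborel (\<lambda>y. ennreal (\<rho> y))) E = (\<integral>y. \<rho> y * indicator E y \<partial>lborel)"
  proof -
    have "emeasure (density lborel (\<lambda>y. ennreal (\<rho> y))) E = (\<integral>\<^sup>+ y. ennreal (\<rho> y) * indicator E y \<partial>lborel)"
      by (rule emeasure_density) auto
    also have "\<dots> = (\<integral>\<^sup>+ y. ennreal (\<rho> y * indicator E y) \<partial>lborel)"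
      by (rule nn_integral_cong) (auto simp: indicator_def)
    also have "\<dots> = ennreal (\<integral>y. \<rho> y * indicator E y \<partial>lborel)"
      by (rule nn_integral_eq_integral[OF i\<rho>]) (use p in \<open>auto simp: indicator_def\<close>)
    finally have eq: "emeasure (density lborel (\<lambda>y. ennreal (\<rho> y))) E = ennreal (\<integral>y. \<rho> y * indicator E y \<partial>lborel)" .
    have "0 \<le> (\<integral>y. \<rho> y * indicator E y \<partial>lborel)"
      by (rule integral_nonneg_AE) (use p in \<open>auto simp: indicator_def\<close>)
    then show ?thesis unfolding measure_def eq by simp
  qed
  moreover have "c * measure lborel E = (\<integral>y. c * indicator E y \<partial>lborel)" by (simp add: E)
  ultimately have "measure (density lborel (\<lambda>y. ennreal (\<rho> y))) E - c * measure lborel E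
     = (\<integral>y. \<rho> y * indicator E y - c * indicator E y \<partial>lborel)"
    using Bochner_Integration.integral_diff[OF i\<rho> integrable_mult_right[OF iE, of c]] by simp
  also have "\<bar>\<dots>\<bar> \<le> (\<integral>y. a * indicator E y + indicator (E \<inter> G) y \<partial>lborel)"
    unfolding real_norm_def[symmetric]
  proof (rule Bochner_Integration.integral_norm_bound_integral)
    show "integrable lborel (\<lambda>y. \<rho> y * indicator E y - c * indicator E y)"
      by (intro Bochner_Integration.integrable_diff i\<rho> integrable_mult_right iE)
    show "integrable lborel (\<lambda>y. a * indicator E y + indicator (E \<inter> G) y)"
      by (intro Bochner_Integration.integrable_add integrable_mult_right iE iG)
    fix y :: 'a
    \<comment> \<open>Both values lie between 1 and 2, so an exceptional point costs at most 1 and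
      the exceptional set at most its volume.\<close>
    have "\<bar>\<rho> y - c\<bar> \<le> 1" using \<rho>12[of y] c by (auto simp: abs_le_iff)
    then show "norm (\<rho> y * indicator E y - c * indicator E y) \<le> a * indicator E y + indicator (E \<inter> G) y"
      using near[of y] \<open>0 \<le> a\<close> by (auto simp: indicator_def)
  qed
  also have "\<dots> = a * measure lborel E + measure lborel (E \<inter> G)"
    using iE iG E by (subst Bochner_Integration.integral_add) auto
  finally show ?thesis .
qed

definition row_balls :: "'a::euclidean_space \<Rightarrow> 'a \<Rightarrow> real \<Rightarrow> nat \<Rightarrow> real \<Rightarrow> 'a set" where
  "row_balls e x l N s = (\<Union>i\<le>N. cball (x + (real i * l) *\<^sub>R e) s)"

lemma compact_row_balls: "compact (row_balls e x l N s)"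
  unfolding row_balls_def by (intro compact_UN) auto

text \<open>Continuity together with constancy far out gives uniform continuity, which is what makes
  the density almost constant at the scale of the next row.\<close>

definition tame_density :: "('a::euclidean_space \<Rightarrow> real) \<Rightarrow> bool" where
  "tame_density \<rho> \<longleftrightarrow> continuous_on UNIV \<rho> \<and> (\<forall>y. 1 \<le> \<rho> y \<and> \<rho> y \<le> 2) \<and> (\<exists>B. \<forall>y. B < norm y \<longrightarrow> \<rho> y = 1)"

lemma tame_density_uniformly_continuous:
  fixes \<rho> :: "'a::euclidean_space \<Rightarrow> real"
  assumes "tame_density \<rho>" "a > 0"
  obtains \<eta> where "\<eta> > 0" "\<And>y z. norm (y - z) \<le> \<eta> \<Longrightarrow> \<bar>\<rho> y - \<rho> z\<bar> \<le> a"
proof -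
  obtain B where B: "\<And>y. B < norm y \<Longrightarrow> \<rho> y = 1" and c: "continuous_on UNIV \<rho>"
    using assms(1) unfolding tame_density_def by blast
  have "uniformly_continuous_on (cball 0 (B + 1)) \<rho>"
    by (rule compact_uniformly_continuous[OF continuous_on_subset[OF c]]) auto
  then obtain d where d: "d > 0" "\<And>y z. y \<in> cball 0 (B + 1) \<Longrightarrow> z \<in> cball 0 (B + 1) \<Longrightarrow> dist z y < d \<Longrightarrow> dist (\<rho> z) (\<rho> y) < a"
    using assms(2) unfolding uniformly_continuous_on_def by metis
  show thesis
  proof (rule that[of "min (d / 2) (1 / 2)"])
    fix y z :: 'a assume yz: "norm (y - z) \<le> min (d / 2) (1 / 2)"
    show "\<bar>\<rho> y - \<rho> z\<bar> \<le> a"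
    proof (cases "norm y \<le> B + 1 \<and> norm z \<le> B + 1")
      case True
      then show ?thesis using d(2)[of z y] yz d(1) by (auto simp: dist_norm)
    next
      case False
      then have "B < norm y \<and> B < norm z"
        using yz norm_triangle_ineq2[of y z] norm_triangle_ineq2[of z y] by (auto simp: norm_minus_commute)
      then show ?thesis using B assms(2) by simp
    qed
  qed (use d in auto)
qed

text \<open>The values 2 and 1 are prescribed on the balls of radius \<open>l / 4\<close> and the
  old density outside the balls of radius \<open>l / 3\<close>. These closed sets are disjoint since
  centres are at least \<open>l\<close> apart, and Tietze's theorem interpolates within the bounds 1
  and 2.\<close>

lemma insert_row:
  fixes \<rho> :: "'a::euclidean_space \<Rightarrow> real"
  assumes \<rho>: "tame_density \<rho>" and e: "norm e = 1" and l: "l > 0"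
  obtains \<rho>' where "tame_density \<rho>'" "\<And>y. y \<notin> row_balls e x l N (l / 3) \<Longrightarrow> \<rho>' y = \<rho> y"
    "\<And>i y. i \<le> N \<Longrightarrow> y \<in> cball (x + (real i * l) *\<^sub>R e) (l / 4) \<Longrightarrow> \<rho>' y = (if even i then 2 else 1)"
proof -
  define c where "c i = x + (real i * l) *\<^sub>R e" for i
  have dc: "dist (c i) (c j) \<ge> l" if "i \<noteq> j" for i j
  proof -
    have "c i - c j = ((real i - real j) * l) *\<^sub>R e" by (simp add: c_def algebra_simps)
    then have "dist (c i) (c j) = \<bar>real i - real j\<bar> * l" using e l by (simp add: dist_norm abs_mult)
    moreover have "1 * l \<le> \<bar>real i - real j\<bar> * l" using that l by (intro mult_right_mono) auto
    ultimately show ?thesis by simp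
  qed
  have same: "i = j" if "y \<in> cball (c i) (l / 4)" "y \<in> cball (c j) (l / 4)" for i j y
    using dc[of i j] that dist_triangle2[of "c i" "c j" y] l by (cases "i = j") auto
  define A where "A p = (\<Union>i\<in>{i. i \<le> N \<and> even i = p}. cball (c i) (l / 4))" for p
  define D where "D = - (\<Union>i\<in>{..N}. ball (c i) (l / 3))"
  have cl: "closed (A p)" "closed D" for p unfolding A_def D_def by (auto intro!: closed_UN)
  define f where "f y = (if y \<in> A True then 2 else if y \<in> A False then 1 else \<rho> y)" for y
  have dis: "y \<notin> A True" if "y \<in> A False" for y using that same unfolding A_def by blast
  have disD: "y \<notin> A p" if "y \<in> D" for y p
  proof
    assume "y \<in> A p"
    then obtain i where "i \<le> N" "dist (c i) y \<le> l / 4" unfolding A_def by auto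
    then have "y \<in> ball (c i) (l / 3)" using l by simp
    then show False using that \<open>i \<le> N\<close> unfolding D_def by blast
  qed
  have c\<rho>: "continuous_on UNIV \<rho>" and \<rho>12: "\<And>y. 1 \<le> \<rho> y \<and> \<rho> y \<le> 2" using \<rho> by (auto simp: tame_density_def)
  have "continuous_on (A True \<union> (A False \<union> D)) f"
  proof (intro continuous_on_closed_Un closed_Un cl)
    show "continuous_on (A True) f" by (rule continuous_on_eq[of _ "\<lambda>_. 2"]) (auto simp: f_def)
    show "continuous_on (A False) f" by (rule continuous_on_eq[of _ "\<lambda>_. 1"]) (use dis in \<open>auto simp: f_def\<close>)
    show "continuous_on D f"
      by (rule continuous_on_eq[of _ \<rho>]) (use disD in \<open>auto simp: f_def intro: continuous_on_subset[OF c\<rho>]\<close>)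
  qed
  moreover have "closedin (top_of_set UNIV) (A True \<union> (A False \<union> D))" using cl by (simp add: closed_Un)
  moreover have "f y \<in> cbox 1 2" if "y \<in> A True \<union> (A False \<union> D)" for y using \<rho>12[of y] by (auto simp: f_def)
  ultimately obtain g where g: "continuous_on UNIV g" "\<And>y. y \<in> A True \<union> (A False \<union> D) \<Longrightarrow> g y = f y"
    "\<And>y. y \<in> UNIV \<Longrightarrow> g y \<in> cbox 1 2"
    using Tietze_closed_interval_1[of "A True \<union> (A False \<union> D)" f UNIV 1 2] by auto
  have off: "g y = \<rho> y" if "y \<notin> row_balls e x l N (l / 3)" for y
  proof -
    have "(\<Union>i\<in>{..N}. ball (c i) (l / 3)) \<subseteq> row_balls e x l N (l / 3)"
      unfolding row_balls_def c_def using ball_subset_cball by blast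
    then have "y \<in> D" using that unfolding D_def by blast
    then show ?thesis using g(2)[of y] disD by (simp add: f_def)
  qed
  show thesis
  proof (rule that[OF _ off])
    obtain B where B: "\<And>y. B < norm y \<Longrightarrow> \<rho> y = 1" using \<rho> unfolding tame_density_def by blast
    obtain B' where B': "\<And>y. y \<in> row_balls e x l N (l / 3) \<Longrightarrow> norm y \<le> B'"
      using compact_imp_bounded[OF compact_row_balls] unfolding bounded_iff by metis
    have "g y = 1" if "max B B' < norm y" for y using off[of y] B[of y] B'[of y] that by force
    then have "\<exists>B. \<forall>y. B < norm y \<longrightarrow> g y = 1" by blast
    then show "tame_density g" unfolding tame_density_def using g(1,3) by auto
    fix i y assume i: "i \<le> N" "y \<in> cball (x + (real i * l) *\<^sub>R e) (l / 4)"
    then have "y \<in> A (even i)" unfolding A_def c_def by auto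
    then show "g y = (if even i then 2 else 1)" using g(2)[of y] dis[of y] by (cases "even i") (auto simp: f_def)
  qed
qed

text \<open>The only place where the dimension has to be at least two.\<close>
lemma row_balls_content:
  fixes e :: "'a::euclidean_space"
  assumes "DIM('a) \<ge> 2" "0 < t" "0 < N"
  shows "measure lborel (row_balls e x (t / real N) N (t / real N / 3)) \<le> 2 * unit_ball_vol (real DIM('a)) * t ^ DIM('a) / real N"
proof -
  define d where "d = DIM('a)"
  define l where "l = t / real N"
  define v where "v = unit_ball_vol (real d)"
  have l: "l > 0" "v > 0" using assms by (auto simp: l_def v_def unit_ball_vol_pos)
  have "measure lborel (row_balls e x l N (l / 3)) \<le> (\<Sum>i\<le>N. measure lborel (cball (x + (real i * l) *\<^sub>R e) (l / 3)))"
    unfolding row_balls_def by (intro measure_UNION_le) auto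
  also have "\<dots> = (real N + 1) * (v * (l / 3) ^ d)" using l by (simp add: content_cball v_def d_def)
  also have "\<dots> \<le> (2 * real N) * (v * l ^ d)"
    using assms l by (intro mult_mono power_mono) auto
  also have "l ^ d = t ^ d / real N ^ d" by (simp add: l_def power_divide)
  also have "(2 * real N) * (v * (t ^ d / real N ^ d)) \<le> (2 * real N) * (v * (t ^ d / real N ^ 2))"
    using assms l by (intro mult_left_mono divide_left_mono power_increasing) (auto simp: d_def)
  also have "\<dots> = 2 * v * t ^ d / real N" using assms by (simp add: power2_eq_square)
  finally show ?thesis by (simp add: l_def v_def d_def)
qed

lemma row_step:
  fixes \<rho> :: "'a::euclidean_space \<Rightarrow> real"
  assumes d: "DIM('a) \<ge> 2" and \<rho>: "tame_density \<rho>" and e: "norm e = 1" and t: "t > 0" and "\<delta> > 0" "a > 0"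
  obtains \<rho>' N where "tame_density \<rho>'" "0 < N" "1 / real N < a" "t / real N < a"
    "\<And>y z. norm (y - z) \<le> (t / real N) / a \<Longrightarrow> \<bar>\<rho> y - \<rho> z\<bar> \<le> a"
    "measure lborel (row_balls e x (t / real N) N (t / real N / 3)) \<le> \<delta>"
    "\<And>y. y \<notin> row_balls e x (t / real N) N (t / real N / 3) \<Longrightarrow> \<rho>' y = \<rho> y"
    "\<And>i y. i \<le> N \<Longrightarrow> y \<in> cball (x + (real i * (t / real N)) *\<^sub>R e) (t / real N / 4) \<Longrightarrow> \<rho>' y = (if even i then 2 else 1)"
proof -
  obtain \<eta> where \<eta>: "\<eta> > 0" "\<And>y z. norm (y - z) \<le> \<eta> \<Longrightarrow> \<bar>\<rho> y - \<rho> z\<bar> \<le> a"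
    using tame_density_uniformly_continuous[OF \<rho> \<open>a > 0\<close>] by blast
  define v where "v = unit_ball_vol (real DIM('a))"
  \<comment> \<open>One lower bound for each requirement: fine subdivision, small spacing, small
    oscillation of the old density at distance \<open>l / a\<close>, and small volume of the
    row.\<close>
  obtain N :: nat where N: "max (max (1 / a) (t / a)) (max (t / (a * \<eta>)) (2 * v * t ^ DIM('a) / \<delta>)) < real N"
    using reals_Archimedean2 by blast
  have "0 < 1 / a" using \<open>a > 0\<close> by simp
  then have "0 < real N" using N by linarith
  then have N0: "0 < N" by simp
  have b: "1 / a < real N" "t / a < real N" "t / (a * \<eta>) < real N" "2 * v * t ^ DIM('a) / \<delta> < real N" using N by auto
  have l: "t / real N > 0" using t N0 by simp
  obtain \<rho>' where \<rho>': "tame_density \<rho>'" "\<And>y. y \<notin> row_balls e x (t / real N) N (t / real N / 3) \<Longrightarrow> \<rho>' y = \<rho> y"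
    "\<And>i y. i \<le> N \<Longrightarrow> y \<in> cball (x + (real i * (t / real N)) *\<^sub>R e) (t / real N / 4) \<Longrightarrow> \<rho>' y = (if even i then 2 else 1)"
    using insert_row[OF \<rho> e l] by blast
  show thesis
  proof (rule that[OF \<rho>'(1) N0 _ _ _ _ \<rho>'(2,3)])
    show "1 / real N < a" "t / real N < a" using b N0 \<open>a > 0\<close> by (auto simp: field_simps)
    have "(t / real N) / a \<le> \<eta>" using b(3) N0 \<open>a > 0\<close> \<eta>(1) by (simp add: field_simps)
    then show "\<bar>\<rho> y - \<rho> z\<bar> \<le> a" if "norm (y - z) \<le> (t / real N) / a" for y z using \<eta>(2)[of y z] that by linarith
    have "2 * v * t ^ DIM('a) / real N \<le> \<delta>" using b(4) N0 \<open>\<delta> > 0\<close> by (simp add: field_simps)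
    then show "measure lborel (row_balls e x (t / real N) N (t / real N / 3)) \<le> \<delta>"
      using row_balls_content[OF d t N0, of e x] by (simp add: v_def)
  qed
qed

text \<open>
  The rows are inserted one after the other at a dense sequence of positions \<open>(x, t)\<close>, each so thin that it
  spoils none of the earlier ones.
\<close>
theorem row_measure_exists:
  fixes e :: "'a::euclidean_space"
  assumes d: "DIM('a) \<ge> 2" and e: "norm e = 1"
  obtains R :: "'a measure" where "comparable R" "row_property R e"
proof -
  obtain D :: "('a \<times> real) set" where D: "countable D" "\<And>X. open X \<Longrightarrow> X \<noteq> {} \<Longrightarrow> \<exists>d\<in>D. d \<in> X"
    by (rule countable_dense_setE) blast
  define D' where "D' = {d\<in>D. snd d > 0}"
  have D': "\<exists>d\<in>D'. d \<in> X" if "open X" "X \<noteq> {}" "X \<subseteq> UNIV \<times> {0<..}" for X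
    using D(2)[OF that(1,2)] that(3) unfolding D'_def by fastforce
  have "countable D'" using D(1) unfolding D'_def by (rule countable_subset[rotated]) auto
  have "D' \<noteq> {}" using D'[of "UNIV \<times> {0<..}"] by (auto simp: open_Times)
  \<comment> \<open>The second component of the decoded pair is ignored, so each position recurs at
    arbitrarily late stages; this gives \<open>pdense\<close> with any prescribed lower bound on the
    index and hence any tolerance.\<close>
  define p where "p k = from_nat_into D' (fst (prod_decode k))" for k
  have pD: "p k \<in> D'" for k unfolding p_def by (rule from_nat_into[OF \<open>D' \<noteq> {}\<close>])
  have tp: "snd (p k) > 0" for k using pD[of k] by (simp add: D'_def)
  have pdense: "\<exists>k\<ge>K. p k \<in> X" if X: "open X" "X \<noteq> {}" "X \<subseteq> UNIV \<times> {0<..}" for X K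
  proof -
    obtain w where w: "w \<in> D'" "w \<in> X" using D'[OF X] by blast
    define k where "k = prod_encode (to_nat_on D' w, K)"
    have "K \<le> k" unfolding k_def by (rule le_prod_encode_2)
    moreover have "p k = w" unfolding p_def k_def using \<open>countable D'\<close> w(1) by simp
    ultimately show ?thesis using w(2) by blast
  qed
  define a where "a k = 1 / real (Suc k)" for k
  have a: "a k > 0" for k by (simp add: a_def)
  define l where "l k N = snd (p k) / real N" for k and N :: nat
  define H where "H k N = row_balls e (fst (p k)) (l k N) N (l k N / 3)" for k N
  \<comment> \<open>A state holds the density, the volume budget of the next row and the last number
    of cells. Budgets are at least halved each time, so all rows after stage \<open>k\<close> have
    total volume at most \<open>l k N' ^ DIM('a) * a k\<close> and cannot spoil row
    \<open>k\<close>.\<close>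
  define Rel where "Rel k u u' \<longleftrightarrow> (case u of (\<rho>, \<delta>, N) \<Rightarrow> case u' of (\<rho>', \<delta>', N') \<Rightarrow>
     0 < N' \<and> 1 / real N' < a k \<and> l k N' < a k \<and> (\<forall>y z. norm (y - z) \<le> l k N' / a k \<longrightarrow> \<bar>\<rho> y - \<rho> z\<bar> \<le> a k) \<and>
     measure lborel (H k N') \<le> \<delta> \<and> (\<forall>y. y \<notin> H k N' \<longrightarrow> \<rho>' y = \<rho> y) \<and>
     (\<forall>i\<le>N'. \<forall>y\<in>cball (fst (p k) + (real i * l k N') *\<^sub>R e) (l k N' / 4). \<rho>' y = (if even i then 2 else 1)) \<and>
     \<delta>' \<le> \<delta> / 2 \<and> \<delta>' \<le> l k N' ^ DIM('a) * a k / 2)" for k and u u' :: "('a \<Rightarrow> real) \<times> real \<times> nat"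
  define Good where "Good u \<longleftrightarrow> (case u of (\<rho>, \<delta>, N) \<Rightarrow> tame_density \<rho> \<and> \<delta> > 0)" for u :: "('a \<Rightarrow> real) \<times> real \<times> nat"
  have "\<exists>f. \<forall>n. Good (f n) \<and> Rel n (f n) (f (Suc n))"
  proof (rule dependent_nat_choice)
    show "\<exists>u. Good u"
      by (rule exI[of _ "(\<lambda>_. 1, 1, 0)"]) (auto simp: Good_def tame_density_def)
  next
    fix u k assume "Good u"
    obtain \<rho> \<delta> N where u: "u = (\<rho>, \<delta>, N)" by (cases u)
    have \<rho>: "tame_density \<rho>" "\<delta> > 0" using \<open>Good u\<close> by (auto simp: Good_def u)
    obtain \<rho>' N' where "tame_density \<rho>'" "0 < N'" "1 / real N' < a k" "snd (p k) / real N' < a k"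
      "\<And>y z. norm (y - z) \<le> (snd (p k) / real N') / a k \<Longrightarrow> \<bar>\<rho> y - \<rho> z\<bar> \<le> a k"
      "measure lborel (row_balls e (fst (p k)) (snd (p k) / real N') N' (snd (p k) / real N' / 3)) \<le> \<delta>"
      "\<And>y. y \<notin> row_balls e (fst (p k)) (snd (p k) / real N') N' (snd (p k) / real N' / 3) \<Longrightarrow> \<rho>' y = \<rho> y"
      "\<And>i y. i \<le> N' \<Longrightarrow> y \<in> cball (fst (p k) + (real i * (snd (p k) / real N')) *\<^sub>R e) (snd (p k) / real N' / 4) \<Longrightarrow> \<rho>' y = (if even i then 2 else 1)"
      by (rule row_step[OF d \<rho>(1) e tp \<rho>(2) a, of k k "fst (p k)"]) (rule that)
    note N' = this[folded l_def, folded H_def]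
    define \<delta>' where "\<delta>' = min (\<delta> / 2) (l k N' ^ DIM('a) * a k / 2)"
    have "l k N' > 0" using tp N'(2) by (simp add: l_def)
    then have "\<delta>' > 0" using \<rho>(2) a by (simp add: \<delta>'_def)
    then show "\<exists>u'. Good u' \<and> Rel k u u'"
      using N' by (intro exI[of _ "(\<rho>', \<delta>', N')"]) (auto simp: Good_def Rel_def u \<delta>'_def)
  qed
  then obtain f where f: "\<And>n. Good (f n)" "\<And>n. Rel n (f n) (f (Suc n))" by blast
  define \<rho> where "\<rho> n = fst (f n)" for n
  define \<delta> where "\<delta> n = fst (snd (f n))" for n
  define N where "N n = snd (snd (f (Suc n)))" for n
  define L where "L n = l n (N n)" for n
  define G where "G n = H n (N n)" for n
  have fe: "f n = (\<rho> n, \<delta> n, snd (snd (f n)))" for n by (simp add: \<rho>_def \<delta>_def)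
  have tame: "tame_density (\<rho> n)" "\<delta> n > 0" for n using f(1)[of n] by (subst (asm) fe, simp add: Good_def)+
  have rel: "0 < N n" "1 / real (N n) < a n" "L n < a n"
     "\<And>y z. norm (y - z) \<le> L n / a n \<Longrightarrow> \<bar>\<rho> n y - \<rho> n z\<bar> \<le> a n"
     "measure lborel (G n) \<le> \<delta> n" "\<And>y. y \<notin> G n \<Longrightarrow> \<rho> (Suc n) y = \<rho> n y"
     "\<And>i y. i \<le> N n \<Longrightarrow> y \<in> cball (fst (p n) + (real i * L n) *\<^sub>R e) (L n / 4) \<Longrightarrow> \<rho> (Suc n) y = (if even i then 2 else 1)"
     "\<delta> (Suc n) \<le> \<delta> n / 2" "\<delta> (Suc n) \<le> L n ^ DIM('a) * a n / 2" for n
  proof -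
    have "Rel n (\<rho> n, \<delta> n, snd (snd (f n))) (\<rho> (Suc n), \<delta> (Suc n), N n)"
      using f(2)[of n] fe[of n] fe[of "Suc n"] by (simp add: N_def)
    then show "0 < N n" "1 / real (N n) < a n" "L n < a n"
     "\<And>y z. norm (y - z) \<le> L n / a n \<Longrightarrow> \<bar>\<rho> n y - \<rho> n z\<bar> \<le> a n"
     "measure lborel (G n) \<le> \<delta> n" "\<And>y. y \<notin> G n \<Longrightarrow> \<rho> (Suc n) y = \<rho> n y"
     "\<And>i y. i \<le> N n \<Longrightarrow> y \<in> cball (fst (p n) + (real i * L n) *\<^sub>R e) (L n / 4) \<Longrightarrow> \<rho> (Suc n) y = (if even i then 2 else 1)"
     "\<delta> (Suc n) \<le> \<delta> n / 2" "\<delta> (Suc n) \<le> L n ^ DIM('a) * a n / 2"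
      unfolding Rel_def L_def G_def by auto
  qed
  have Lp: "L n > 0" for n using tp[of n] rel(1)[of n] by (simp add: L_def l_def)
  have cG: "compact (G n)" for n unfolding G_def H_def by (rule compact_row_balls)
  have fG: "emeasure lborel (G n) = ennreal (measure lborel (G n))" for n
    using emeasure_bounded_finite[OF compact_imp_bounded[OF cG]] by (simp add: emeasure_eq_ennreal_measure less_top[symmetric])
  \<comment> \<open>The points whose density may still change at stage \<open>k\<close> or
    later.\<close>
  define E where "E k = (\<Union>j. G (j + k))" for k
  have Eb[measurable]: "E k \<in> sets borel" for k unfolding E_def using cG by (intro sets.countable_UN) (auto simp: borel_compact)
  have dk: "\<delta> (j + k) \<le> \<delta> k * (1 / 2) ^ j" for j k
  proof (induction j)
    case (Suc j)
    then show ?case using rel(8)[of "j + k"] by simp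
  qed simp
  have Em: "emeasure lborel (E k) \<le> ennreal (2 * \<delta> k)" for k
  proof -
    have sm: "summable (\<lambda>j. \<delta> k * (1 / 2) ^ j)" by (intro summable_mult summable_geometric) simp
    have "emeasure lborel (E k) \<le> (\<Sum>j. emeasure lborel (G (j + k)))"
      unfolding E_def by (rule emeasure_subadditive_countably) (use cG in \<open>auto simp: borel_compact\<close>)
    also have "\<dots> \<le> (\<Sum>j. ennreal (\<delta> k * (1 / 2) ^ j))"
      unfolding fG using rel(5) dk by (intro suminf_le ennreal_leI) (auto intro: order_trans)
    also have "\<dots> = ennreal (\<Sum>j. \<delta> k * (1 / 2) ^ j)"
      by (rule suminf_ennreal2) (use sm tame(2) in \<open>auto simp: less_imp_le\<close>)
    also have "(\<Sum>j. \<delta> k * (1 / 2) ^ j) = 2 * \<delta> k" by (simp add: suminf_mult suminf_geometric)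
    finally show ?thesis .
  qed
  have Emeas: "measure lborel (B \<inter> E k) \<le> 2 * \<delta> k" if "B \<in> sets borel" for k B
  proof -
    have "emeasure lborel (B \<inter> E k) \<le> emeasure lborel (E k)" by (rule emeasure_mono) auto
    also have "\<dots> \<le> ennreal (2 * \<delta> k)" by (rule Em)
    finally have "enn2real (emeasure lborel (B \<inter> E k)) \<le> enn2real (ennreal (2 * \<delta> k))" by (rule enn2real_mono) simp
    then show ?thesis using tame(2)[of k] by (simp add: measure_def)
  qed
  \<comment> \<open>Truncation keeps the bounds at points where the sequence fails to converge and
    \<open>lim\<close> has an arbitrary value. Off \<open>E k\<close> the sequence is eventually
    constant and the truncation does nothing.\<close>
  define r where "r y = max 1 (min 2 (lim (\<lambda>n. \<rho> n y)))" for y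
  have \<rho>meas[measurable]: "\<rho> n \<in> borel_measurable borel" for n
    using tame(1)[of n] by (intro borel_measurable_continuous_onI) (simp add: tame_density_def)
  have rmeas[measurable]: "r \<in> borel_measurable borel" unfolding r_def by measurable
  have r12: "1 \<le> r y \<and> r y \<le> 2" for y by (simp add: r_def)
  have req: "r y = \<rho> k y" if y: "y \<notin> E k" for y k
  proof -
    have "\<rho> (j + k) y = \<rho> k y" for j
    proof (induction j)
      case (Suc j)
      have "y \<notin> G (j + k)" using y unfolding E_def by blast
      then show ?case using rel(6)[of y "j + k"] Suc by simp
    qed simp
    then have "(\<lambda>n. \<rho> (n + k) y) \<longlonglongrightarrow> \<rho> k y" by simp
    then have "(\<lambda>n. \<rho> n y) \<longlonglongrightarrow> \<rho> k y" by (rule LIMSEQ_offset)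
    then have "lim (\<lambda>n. \<rho> n y) = \<rho> k y" by (rule limI)
    then show ?thesis using tame(1)[of k] by (auto simp: r_def tame_density_def max_def min_def order_antisym)
  qed
  define R where "R = density lborel (\<lambda>y. ennreal (r y))"
  have "comparable R" unfolding comparable_def
  proof (intro conjI ballI)
    show "sets R = sets borel" by (simp add: R_def)
    fix B :: "'a set" assume B[measurable]: "B \<in> sets borel"
    have e1: "emeasure R B = (\<integral>\<^sup>+ y. ennreal (r y) * indicator B y \<partial>lborel)"
      unfolding R_def by (rule emeasure_density) auto
    have "emeasure lborel B = (\<integral>\<^sup>+ y. indicator B y \<partial>lborel)" by simp
    also have "\<dots> \<le> (\<integral>\<^sup>+ y. ennreal (r y) * indicator B y \<partial>lborel)"
      using r12 by (intro nn_integral_mono) (auto simp: indicator_def)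
    finally show "emeasure lborel B \<le> emeasure R B" by (simp add: e1)
    have "(\<integral>\<^sup>+ y. ennreal (r y) * indicator B y \<partial>lborel) \<le> (\<integral>\<^sup>+ y. 2 * indicator B y \<partial>lborel)"
    proof (rule nn_integral_mono)
      fix y
      have "ennreal (r y) \<le> ennreal 2" using r12[of y] by (intro ennreal_leI) auto
      then show "ennreal (r y) * indicator B y \<le> 2 * indicator B y" by (auto simp: indicator_def)
    qed
    also have "\<dots> = 2 * emeasure lborel B" by (simp add: nn_integral_cmult)
    finally show "emeasure R B \<le> 2 * emeasure lborel B" by (simp add: e1)
  qed
  moreover have "row_property R e" unfolding row_property_def
  proof (intro allI impI)
    fix Q :: "('a \<times> real) set" and \<epsilon> :: real
    assume Q: "open Q" "Q \<noteq> {}" "Q \<subseteq> UNIV \<times> {0<..}" and "\<epsilon> > 0"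
    obtain K :: nat where K: "1 / \<epsilon> < real K" using reals_Archimedean2 by blast
    obtain k where k: "K \<le> k" "p k \<in> Q" using pdense[OF Q] by blast
    have "1 / \<epsilon> < real (Suc k)" using K k(1) by linarith
    then have ak: "a k < \<epsilon>" using \<open>\<epsilon> > 0\<close> by (simp add: a_def field_simps)
    have E1: "measure lborel (B \<inter> E (Suc k)) \<le> \<epsilon> * L k ^ DIM('a)" if "B \<in> sets borel" for B
    proof -
      have "measure lborel (B \<inter> E (Suc k)) \<le> 2 * \<delta> (Suc k)" by (rule Emeas[OF that])
      also have "\<dots> \<le> a k * L k ^ DIM('a)" using rel(9)[of k] by (simp add: mult.commute)
      also have "\<dots> \<le> \<epsilon> * L k ^ DIM('a)" using ak Lp[of k] by (intro mult_right_mono) auto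
      finally show ?thesis .
    qed
    define x where "x = fst (p k)"
    show "\<exists>x t N l. (x, t) \<in> Q \<and> 0 < N \<and> l = t / real N \<and> l < \<epsilon> \<and> 1 / real N < \<epsilon> \<and>
       (\<forall>i\<le>N. \<bar>measure R (cball (x + (real i * l) *\<^sub>R e) (l / 4))
            - (if even i then 2 else 1) * measure lborel (cball x (l / 4))\<bar> \<le> \<epsilon> * l ^ DIM('a)) \<and>
       (\<forall>q. \<exists>c. 0 \<le> c \<and> c \<le> 2 \<and> (\<forall>E\<in>sets borel. E \<subseteq> cball q (l / \<epsilon>) \<longrightarrow>
            (\<forall>i\<le>N. E \<inter> cball (x + (real i * l) *\<^sub>R e) (l / 3) = {}) \<longrightarrow>
            \<bar>measure R E - c * measure lborel E\<bar> \<le> \<epsilon> * (measure lborel E + l ^ DIM('a))))"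
    proof (rule exI[of _ x], rule exI[of _ "snd (p k)"], rule exI[of _ "N k"], rule exI[of _ "L k"], intro conjI)
      show "(x, snd (p k)) \<in> Q" using k(2) by (simp add: x_def)
      show "0 < N k" by (rule rel(1))
      show "L k = snd (p k) / real (N k)" by (simp add: L_def l_def)
      show "L k < \<epsilon>" "1 / real (N k) < \<epsilon>" using rel(2,3)[of k] ak by auto
      show "\<forall>i\<le>N k. \<bar>measure R (cball (x + (real i * L k) *\<^sub>R e) (L k / 4))
            - (if even i then 2 else 1) * measure lborel (cball x (L k / 4))\<bar> \<le> \<epsilon> * L k ^ DIM('a)"
      proof (intro allI impI)
        fix i assume i: "i \<le> N k"
        define B where "B = cball (x + (real i * L k) *\<^sub>R e) (L k / 4)"
        define c :: real where "c = (if even i then 2 else 1)"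
        have "\<bar>measure R B - c * measure lborel B\<bar> \<le> 0 * measure lborel B + measure lborel (B \<inter> E (Suc k))"
          unfolding R_def
        proof (rule measure_density_near_constant[OF rmeas r12])
          show "\<bar>r y - c\<bar> \<le> 0" if "y \<in> B - E (Suc k)" for y
            using req[of y "Suc k"] rel(7)[OF i, of y] that by (simp add: B_def x_def c_def)
        qed (auto simp: B_def c_def)
        also have "\<dots> \<le> \<epsilon> * L k ^ DIM('a)" using E1[of B] by (simp add: B_def)
        also have "measure lborel B = measure lborel (cball x (L k / 4))"
          using Lp[of k] by (simp add: B_def content_cball)
        finally show "\<bar>measure R (cball (x + (real i * L k) *\<^sub>R e) (L k / 4))
            - (if even i then 2 else 1) * measure lborel (cball x (L k / 4))\<bar> \<le> \<epsilon> * L k ^ DIM('a)"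
          by (simp add: B_def c_def)
      qed
      show "\<forall>q. \<exists>c. 0 \<le> c \<and> c \<le> 2 \<and> (\<forall>E\<in>sets borel. E \<subseteq> cball q (L k / \<epsilon>) \<longrightarrow>
            (\<forall>i\<le>N k. E \<inter> cball (x + (real i * L k) *\<^sub>R e) (L k / 3) = {}) \<longrightarrow>
            \<bar>measure R E - c * measure lborel E\<bar> \<le> \<epsilon> * (measure lborel E + L k ^ DIM('a)))"
      proof
        fix q
        \<comment> \<open>The constant for the ball about \<open>q\<close> is the value there of the
          density before row \<open>k\<close>. It varies little at distance
          \<open>L k / \<epsilon>\<close>, and off the row and off \<open>E (Suc k)\<close> it has
          not been changed since.\<close>
        have c: "1 \<le> \<rho> k q" "\<rho> k q \<le> 2" using tame(1)[of k] by (auto simp: tame_density_def)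
        show "\<exists>c. 0 \<le> c \<and> c \<le> 2 \<and> (\<forall>E\<in>sets borel. E \<subseteq> cball q (L k / \<epsilon>) \<longrightarrow>
            (\<forall>i\<le>N k. E \<inter> cball (x + (real i * L k) *\<^sub>R e) (L k / 3) = {}) \<longrightarrow>
            \<bar>measure R E - c * measure lborel E\<bar> \<le> \<epsilon> * (measure lborel E + L k ^ DIM('a)))"
        proof (intro exI[of _ "\<rho> k q"] conjI ballI impI)
          fix B assume B: "B \<in> sets borel" "B \<subseteq> cball q (L k / \<epsilon>)"
            "\<forall>i\<le>N k. B \<inter> cball (x + (real i * L k) *\<^sub>R e) (L k / 3) = {}"
          have BG: "y \<notin> G k" if "y \<in> B" for y
            using B(3) that unfolding G_def H_def row_balls_def L_def[symmetric] x_def by blast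
          have "\<bar>measure R B - \<rho> k q * measure lborel B\<bar> \<le> \<epsilon> * measure lborel B + measure lborel (B \<inter> E (Suc k))"
            unfolding R_def
          proof (rule measure_density_near_constant[OF rmeas r12 B(1)])
            show "bounded B" by (rule bounded_subset[OF bounded_cball B(2)])
            fix y assume y: "y \<in> B - E (Suc k)"
            have "r y = \<rho> k y" using req[of y "Suc k"] rel(6)[of y k] BG[of y] y by simp
            moreover have "norm (y - q) \<le> L k / \<epsilon>" using B(2) y by (auto simp: dist_norm norm_minus_commute)
            then have "norm (y - q) \<le> L k / a k"
              using divide_left_mono[of "a k" \<epsilon> "L k"] ak Lp[of k] a[of k] \<open>\<epsilon> > 0\<close> by simp
            then have "\<bar>\<rho> k y - \<rho> k q\<bar> \<le> a k" by (rule rel(4))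
            ultimately show "\<bar>r y - \<rho> k q\<bar> \<le> \<epsilon>" using ak by simp
          qed (use c \<open>\<epsilon> > 0\<close> in auto)
          also have "\<dots> \<le> \<epsilon> * measure lborel B + \<epsilon> * L k ^ DIM('a)" using E1[OF B(1)] by simp
          finally show "\<bar>measure R B - \<rho> k q * measure lborel B\<bar> \<le> \<epsilon> * (measure lborel B + L k ^ DIM('a))"
            by (simp add: distrib_left)
        qed (use c in auto)
      qed
    qed
  qed
  ultimately show thesis by (rule that)
qed

section \<open>Limits of maps between nets\<close>

definition scaled_count :: "'a::euclidean_space set \<Rightarrow> real \<Rightarrow> 'a set \<Rightarrow> real" where
  "scaled_count X r A = real (card {x\<in>X. x /\<^sub>R r \<in> A}) / r ^ DIM('a)"

text \<open>The rescaled counting measures of \<open>X\<close> converge vaguely to \<open>S\<close>, in portmanteau form.\<close>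
definition has_profile :: "(nat \<Rightarrow> real) \<Rightarrow> 'a::euclidean_space set \<Rightarrow> 'a measure \<Rightarrow> bool" where
  "has_profile r X S \<longleftrightarrow>
     (\<forall>K \<epsilon>. compact K \<longrightarrow> \<epsilon> > 0 \<longrightarrow> (\<forall>\<^sub>F n in sequentially. scaled_count X (r n) K \<le> measure S K + \<epsilon>)) \<and>
     (\<forall>N \<epsilon>. open N \<longrightarrow> bounded N \<longrightarrow> \<epsilon> > 0 \<longrightarrow> (\<forall>\<^sub>F n in sequentially. measure S N - \<epsilon> \<le> scaled_count X (r n) N))"

lemma has_profile_subseq: "has_profile r X S \<Longrightarrow> strict_mono k \<Longrightarrow> has_profile (\<lambda>n. r (k n)) X S"
  unfolding has_profile_def using eventually_subseq by blast

text \<open>Stated for all bounded Borel \<open>B\<close> inside \<open>N\<close>, because it is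
  applied to closed neighbourhoods, to their preimages and to unions of cells.\<close>

lemma comparable_outer_regular:
  assumes S: "comparable S" and A: "compact A" and "\<epsilon> > 0"
  obtains N where "open N" "A \<subseteq> N" "\<And>B. B \<in> sets borel \<Longrightarrow> bounded B \<Longrightarrow> B \<subseteq> N \<Longrightarrow> measure S B \<le> measure S A + \<epsilon>"
proof -
  have "\<epsilon> / 2 > 0" using \<open>\<epsilon> > 0\<close> by simp
  then obtain N where N: "open N" "A \<subseteq> N" "emeasure lborel (N - A) < ennreal (\<epsilon> / 2)"
    using outer_regular_lborel[OF borel_compact[OF A]] by metis
  show thesis
  proof (rule that[OF N(1,2)])
    fix B assume B: "B \<in> sets borel" "bounded B" "B \<subseteq> N"
    have sS: "sets S = sets borel" using S by (simp add: comparable_def)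
    have AB: "A \<in> sets borel" by (rule borel_compact[OF A])
    have BA: "B - A \<in> sets borel" "bounded (B - A)" using B AB by (auto intro: bounded_subset)
    have fB: "A \<union> (B - A) \<in> fmeasurable S"
      using comparable_fmeasurable[OF S] A B AB compact_imp_bounded[OF A] BA by (intro comparable_fmeasurable[OF S]) auto
    have "measure S B \<le> measure S (A \<union> (B - A))"
      by (rule measure_mono_fmeasurable[OF _ _ fB]) (use B sS in auto)
    also have "\<dots> \<le> measure S A + measure S (B - A)"
      by (rule measure_Un_le) (use sS AB BA in auto)
    also have "measure S (B - A) \<le> 2 * measure lborel (B - A)" by (rule comparable_measure(2)[OF S BA(2,1)])
    also have "measure lborel (B - A) \<le> \<epsilon> / 2"
    proof -
      have "emeasure lborel (B - A) \<le> emeasure lborel (N - A)" using B(3) N(1) AB by (intro emeasure_mono) auto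
      also have "\<dots> \<le> ennreal (\<epsilon> / 2)" using N(3) by simp
      finally have "enn2real (emeasure lborel (B - A)) \<le> enn2real (ennreal (\<epsilon> / 2))" by (rule enn2real_mono) simp
      then show ?thesis using \<open>\<epsilon> > 0\<close> by (simp add: measure_def)
    qed
    finally show "measure S B \<le> measure S A + \<epsilon>" by simp
  qed
qed

lemma compact_neighbourhood: "compact K \<Longrightarrow> compact (\<Union>x\<in>K. cball x (\<eta>::real))" for K :: "'a::euclidean_space set"
proof -
  assume K: "compact K"
  have "(\<Union>x\<in>K. cball x \<eta>) = {x + y | x y. x \<in> K \<and> y \<in> cball 0 \<eta>}"
  proof (intro equalityI subsetI)
    fix z assume "z \<in> (\<Union>x\<in>K. cball x \<eta>)"
    then obtain x where "x \<in> K" "dist x z \<le> \<eta>" by auto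
    then show "z \<in> {x + y | x y. x \<in> K \<and> y \<in> cball 0 \<eta>}"
      by (intro CollectI exI[of _ x] exI[of _ "z - x"]) (auto simp: dist_norm norm_minus_commute)
  next
    fix z assume "z \<in> {x + y | x y. x \<in> K \<and> y \<in> cball 0 \<eta>}"
    then obtain x y where "z = x + y" "x \<in> K" "norm y \<le> \<eta>" by auto
    then show "z \<in> (\<Union>x\<in>K. cball x \<eta>)" by (intro UN_I[of x]) (auto simp: dist_norm)
  qed
  then show ?thesis using compact_sums[OF K compact_cball[of 0 \<eta>]] by simp
qed

text \<open>Rescalings of \<open>g\<close> subconverge to a Lipschitz \<open>F\<close>. The growth
  bound relative to \<open>x0\<close> makes \<open>F\<close> proper, so preimages of compact sets
  are compact and nothing escapes to infinity; comparing point counts through \<open>g\<close> and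
  through its inverse gives the two inequalities between measures.\<close>

theorem transport_limit:
  fixes X X' :: "'a::euclidean_space set"
  assumes fin: "\<And>b. finite (X \<inter> cball 0 b)" "\<And>b. finite (X' \<inter> cball 0 b)"
    and r: "filterlim r at_top sequentially" "\<And>n. r n \<ge> 1"
    and S: "comparable S" and T: "comparable T" and XS: "has_profile r X S" and XT: "has_profile r X' T"
    and g: "bij_betw g X X'" and L: "L \<ge> 1" and lip: "\<And>x y. x \<in> X \<Longrightarrow> y \<in> X \<Longrightarrow> norm (g x - g y) \<le> L * norm (x - y)"
    and x0: "x0 \<in> X" and C: "C > 0" and grow: "\<And>x. x \<in> X \<Longrightarrow> norm (x - x0) \<le> C * norm (g x - g x0)"
    and dense: "\<And>y. \<exists>x\<in>X. norm (x - y) \<le> D"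
  obtains F where "lipschitz_transport F S T L"
proof -
  obtain \<pi> where \<pi>: "\<And>y. \<pi> y \<in> X" "\<And>y. norm (\<pi> y - y) \<le> D" using dense by metis
  have D0: "D \<ge> 0" using \<pi>(2)[of 0] norm_ge_zero order_trans by blast
  \<comment> \<open>Rounding to a net point extends \<open>g\<close> to the whole space; the defect
    of at most \<open>2 * L * D / r n\<close> in the Lipschitz bound vanishes in the limit.\<close>
  define f where "f n x = g (\<pi> (r n *\<^sub>R x)) /\<^sub>R r n" for n x
  have rp: "r n > 0" for n using r(2)[of n] by linarith
  have inv0: "(\<lambda>n. c / r n) \<longlonglongrightarrow> 0" for c :: real
    by (rule real_tendsto_divide_at_top[OF tendsto_const r(1)])
  have flip: "norm (f n x - f n y) \<le> L * norm (x - y) + 2 * L * D / r n" for n x y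
  proof -
    have "norm (p - q) \<le> norm (p - u) + norm (u - w) + norm (q - w)" for p q u w :: 'a by norm
    then have "norm (\<pi> (r n *\<^sub>R x) - \<pi> (r n *\<^sub>R y)) \<le> norm (\<pi> (r n *\<^sub>R x) - r n *\<^sub>R x) + norm (r n *\<^sub>R x - r n *\<^sub>R y) + norm (\<pi> (r n *\<^sub>R y) - r n *\<^sub>R y)" .
    also have "norm (r n *\<^sub>R x - r n *\<^sub>R y) = r n * norm (x - y)" using rp[of n] by (simp flip: scaleR_diff_right)
    finally have "norm (\<pi> (r n *\<^sub>R x) - \<pi> (r n *\<^sub>R y)) \<le> r n * norm (x - y) + 2 * D"
      using \<pi>(2)[of "r n *\<^sub>R x"] \<pi>(2)[of "r n *\<^sub>R y"] by linarith
    then have "L * norm (\<pi> (r n *\<^sub>R x) - \<pi> (r n *\<^sub>R y)) \<le> L * (r n * norm (x - y) + 2 * D)" using L by (intro mult_left_mono) auto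
    then have "norm (g (\<pi> (r n *\<^sub>R x)) - g (\<pi> (r n *\<^sub>R y))) \<le> L * (r n * norm (x - y) + 2 * D)"
      using lip[OF \<pi>(1) \<pi>(1), of "r n *\<^sub>R x" "r n *\<^sub>R y"] by linarith
    moreover have "norm (f n x - f n y) = norm (g (\<pi> (r n *\<^sub>R x)) - g (\<pi> (r n *\<^sub>R y))) / r n"
      using rp[of n] by (simp add: f_def divide_inverse mult.commute flip: scaleR_diff_right)
    ultimately have "norm (f n x - f n y) \<le> L * (r n * norm (x - y) + 2 * D) / r n"
      using rp[of n] by (simp add: divide_right_mono)
    also have "\<dots> = L * norm (x - y) + 2 * L * D / r n" using rp[of n] by (simp add: field_simps)
    finally show ?thesis .
  qed
  obtain F k where k: "strict_mono (k :: nat \<Rightarrow> nat)" and F: "\<And>x. (\<lambda>n. f (k n) x) \<longlonglongrightarrow> F x"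
    and Flip: "\<And>x y. norm (F x - F y) \<le> L * norm (x - y)"
  proof (rule almost_lipschitz_convergent_subsequence[of f L "\<lambda>n. 2 * L * D / r n" "norm (g (\<pi> 0))"])
    show "norm (f n 0) \<le> norm (g (\<pi> 0))" for n
      using r(2)[of n] mult_left_le_one_le[of "norm (g (\<pi> 0))" "inverse (r n)"] by (simp add: f_def inverse_le_1_iff)
  qed (use flip inv0 L in \<open>auto intro: that\<close>)
  define s where "s n = r (k n)" for n
  have s_eq: "s = (\<lambda>n. r (k n))" by (simp add: s_def fun_eq_iff)
  have s: "filterlim s at_top sequentially" "\<And>n. s n \<ge> 1" "\<And>n. s n > 0"
    using filterlim_compose[OF r(1) filterlim_subseq[OF k]] r(2) rp by (auto simp: s_eq)
  have sinv: "(\<lambda>n. c / s n) \<longlonglongrightarrow> 0" for c :: real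
    by (rule real_tendsto_divide_at_top[OF tendsto_const s(1)])
  have sX: "has_profile s X S" "has_profile s X' T"
    using has_profile_subseq[OF XS k] has_profile_subseq[OF XT k] unfolding s_eq .
  have near: "\<forall>\<^sub>F n in sequentially. \<forall>x\<in>X. norm (x /\<^sub>R s n) \<le> b \<longrightarrow> norm (g x /\<^sub>R s n - F (x /\<^sub>R s n)) < \<eta>" if "\<eta> > 0" for b \<eta>
  proof -
    have "\<forall>\<^sub>F n in sequentially. \<forall>x\<in>cball 0 b. norm (f (k n) x - F x) < \<eta> / 2"
    proof (rule almost_lipschitz_uniform_limit[where \<epsilon> = "\<lambda>n. 2 * L * D / s n" and L = L])
      show "norm (f (k n) x - f (k n) y) \<le> L * norm (x - y) + 2 * L * D / s n" for n x y using flip by (simp add: s_def)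
    qed (use sinv L F Flip that in auto)
    moreover have "\<forall>\<^sub>F n in sequentially. L * D / s n < \<eta> / 2"
      using sinv[of "L * D"] that by (intro order_tendstoD) auto
    ultimately show ?thesis
    proof eventually_elim
      case (elim n)
      show ?case
      proof (intro ballI impI)
        fix x assume x: "x \<in> X" "norm (x /\<^sub>R s n) \<le> b"
        have "norm (f (k n) (x /\<^sub>R s n) - F (x /\<^sub>R s n)) < \<eta> / 2" using elim(1) x(2) by simp
        moreover have "norm (g x /\<^sub>R s n - f (k n) (x /\<^sub>R s n)) \<le> L * D / s n"
        proof -
          have "f (k n) (x /\<^sub>R s n) = g (\<pi> x) /\<^sub>R s n" using s(3)[of n] by (simp add: f_def s_def)
          then have "norm (g x /\<^sub>R s n - f (k n) (x /\<^sub>R s n)) = norm (g x - g (\<pi> x)) / s n"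
            using s(3)[of n] by (simp add: divide_inverse mult.commute flip: scaleR_diff_right)
          moreover have "norm (g x - g (\<pi> x)) \<le> L * D"
          proof -
            have "norm (g x - g (\<pi> x)) \<le> L * norm (x - \<pi> x)" by (rule lip[OF x(1) \<pi>(1)])
            also have "\<dots> \<le> L * D" using \<pi>(2)[of x] L by (intro mult_left_mono) (auto simp: norm_minus_commute)
            finally show ?thesis .
          qed
          ultimately show ?thesis using s(3)[of n] by (simp add: divide_right_mono)
        qed
        ultimately have "norm (f (k n) (x /\<^sub>R s n) - F (x /\<^sub>R s n)) < \<eta> / 2" "norm (g x /\<^sub>R s n - f (k n) (x /\<^sub>R s n)) < \<eta> / 2"
          using elim(2) by linarith+
        moreover have "norm (u - w) \<le> norm (u - v) + norm (v - w)" for u v w :: 'a by norm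
        from this[of "g x /\<^sub>R s n" "F (x /\<^sub>R s n)" "f (k n) (x /\<^sub>R s n)"]
        have "norm (g x /\<^sub>R s n - F (x /\<^sub>R s n)) \<le> norm (g x /\<^sub>R s n - f (k n) (x /\<^sub>R s n)) + norm (f (k n) (x /\<^sub>R s n) - F (x /\<^sub>R s n))" .
        ultimately have "norm (g x /\<^sub>R s n - F (x /\<^sub>R s n)) < \<eta> / 2 + \<eta> / 2" by linarith
        then show "norm (g x /\<^sub>R s n - F (x /\<^sub>R s n)) < \<eta>" by simp
      qed
    qed
  qed
  \<comment> \<open>Under rescaling the base point tends to the origin, so \<open>grow\<close>
    becomes a bound relative to \<open>0\<close> while its constant \<open>C\<close>
    persists.\<close>
  have proper: "norm x \<le> C * norm (F x)" for x
  proof (rule LIMSEQ_le)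
    define e where "e = D + norm x0 + C * norm (g x0)"
    show "(\<lambda>n. norm x - e / s n) \<longlonglongrightarrow> norm x" using tendsto_diff[OF tendsto_const sinv[of e], of "norm x"] by simp
    show "(\<lambda>n. C * norm (f (k n) x)) \<longlonglongrightarrow> C * norm (F x)" by (intro tendsto_intros F)
    have "norm x - e / s n \<le> C * norm (f (k n) x)" for n
    proof -
      define y where "y = \<pi> (s n *\<^sub>R x)"
      have "s n * norm x \<le> norm y + D" using \<pi>(2)[of "s n *\<^sub>R x"] s(3)[of n] norm_triangle_ineq2[of "s n *\<^sub>R x" y]
        by (simp add: y_def norm_minus_commute)
      moreover have "norm y \<le> norm (y - x0) + norm x0" by norm
      moreover have "norm (y - x0) \<le> C * norm (g y - g x0)" using grow \<pi>(1) by (simp add: y_def)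
      moreover have "C * norm (g y - g x0) \<le> C * (norm (g y) + norm (g x0))" using C norm_triangle_ineq4 by (intro mult_left_mono) auto
      ultimately have "s n * norm x \<le> C * norm (g y) + e" by (simp add: e_def algebra_simps)
      moreover have "norm (g y) = s n * norm (f (k n) x)" using s(3)[of n] by (simp add: f_def s_def y_def)
      ultimately have "s n * norm x \<le> C * (s n * norm (f (k n) x)) + e" by (simp only:)
      moreover have "s n * (norm x - e / s n) = s n * norm x - e" using s(3)[of n] by (simp add: right_diff_distrib)
      moreover have "s n * (C * norm (f (k n) x)) = C * (s n * norm (f (k n) x))" by simp
      ultimately have "s n * (norm x - e / s n) \<le> s n * (C * norm (f (k n) x))" by linarith
      then show ?thesis using s(3)[of n] by (simp add: mult_le_cancel_left_pos)
    qed
    then show "\<exists>N. \<forall>n\<ge>N. norm x - e / s n \<le> C * norm (f (k n) x)" by blast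
  qed
  have cF: "continuous_on A F" for A
    by (rule lipschitz_on_continuous_on[of L]) (use Flip L in \<open>auto intro!: lipschitz_onI simp: dist_norm\<close>)
  have clF: "closed (F -` K)" if "closed K" for K using cF[of UNIV] that by (simp add: closed_vimage continuous_on_closed_vimage)
  have opF: "open (F -` K)" if "open K" for K using cF[of UNIV] that by (simp add: open_vimage)
  have comF: "compact (F -` K)" if cK: "compact K" for K
  proof -
    obtain b where b: "\<And>y. y \<in> K \<Longrightarrow> norm y \<le> b" using compact_imp_bounded[OF cK] unfolding bounded_iff by blast
    have "norm x \<le> C * b" if "F x \<in> K" for x
      using proper[of x] mult_left_mono[OF b[OF that], of C] C by linarith
    then have "bounded (F -` K)" unfolding bounded_iff by auto
    then show ?thesis using clF[OF compact_imp_closed[OF cK]] by (simp add: compact_eq_bounded_closed)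
  qed
  have finX: "finite {x\<in>X. x /\<^sub>R s n \<in> A}" if bA: "bounded A" for n A
  proof -
    obtain b where b: "\<And>y. y \<in> A \<Longrightarrow> norm y \<le> b" using bA unfolding bounded_iff by blast
    have "norm x \<le> s n * b" if "x /\<^sub>R s n \<in> A" for x using b[OF that] s(3)[of n] by (simp add: field_simps)
    then show ?thesis by (intro finite_subset[OF _ fin(1)[of "s n * b"]]) auto
  qed
  have finX': "finite {x\<in>X'. x /\<^sub>R s n \<in> A}" if bA: "bounded A" for n A
  proof -
    obtain b where b: "\<And>y. y \<in> A \<Longrightarrow> norm y \<le> b" using bA unfolding bounded_iff by blast
    have "norm x \<le> s n * b" if "x /\<^sub>R s n \<in> A" for x using b[OF that] s(3)[of n] by (simp add: field_simps)
    then show ?thesis by (intro finite_subset[OF _ fin(2)[of "s n * b"]]) auto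
  qed
  have sb: "sets S = sets borel" "sets T = sets borel" using S T by (auto simp: comparable_def)
  \<comment> \<open>Net points near the preimage of \<open>K\<close> are sent injectively to points
    near \<open>K\<close>. An open set is used on the source side and a compact one on the target
    side, matching the two halves of \<open>has_profile\<close>.\<close>
  have up: "measure S (F -` K) \<le> measure T K" if K: "compact K" for K
  proof (rule field_le_epsilon)
    fix e :: real assume "e > 0"
    define \<epsilon> where "\<epsilon> = e / 3"
    have "\<epsilon> > 0" using \<open>e > 0\<close> by (simp add: \<epsilon>_def)
    obtain N where N: "open N" "K \<subseteq> N" "\<And>B. B \<in> sets borel \<Longrightarrow> bounded B \<Longrightarrow> B \<subseteq> N \<Longrightarrow> measure T B \<le> measure T K + \<epsilon>"
      using comparable_outer_regular[OF T K \<open>\<epsilon> > 0\<close>] by blast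
    obtain \<eta> where \<eta>: "\<eta> > 0" "(\<Union>x\<in>K. cball x \<eta>) \<subseteq> N"
      using compact_subset_open_imp_cball_epsilon_subset[OF K N(1,2)] by blast
    define K' where "K' = (\<Union>x\<in>K. cball x \<eta>)"
    have K': "compact K'" unfolding K'_def by (rule compact_neighbourhood[OF K])
    obtain b where b: "\<And>x. x \<in> F -` K \<Longrightarrow> norm x \<le> b" using compact_imp_bounded[OF comF[OF K]] unfolding bounded_iff by blast
    define U where "U = F -` (\<Union>x\<in>K. ball x (\<eta> / 2)) \<inter> ball 0 (b + 1)"
    have "open U" unfolding U_def by (intro open_Int opF open_UN) auto
    have "bounded U" unfolding U_def by (rule bounded_subset[OF bounded_ball]) auto
    have AU: "F -` K \<subseteq> U"
    proof
      fix x assume x: "x \<in> F -` K"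
      have "F x \<in> ball (F x) (\<eta> / 2)" using \<eta>(1) by simp
      then have "F x \<in> (\<Union>x\<in>K. ball x (\<eta> / 2))" using x by blast
      then show "x \<in> U" using b[OF x] by (simp add: U_def)
    qed
    have SU: "measure S (F -` K) \<le> measure S U"
      using comF[OF K] \<open>open U\<close> \<open>bounded U\<close> sb
      by (intro measure_mono_fmeasurable[OF AU] comparable_fmeasurable[OF S]) (auto simp: borel_compact)
    have "\<forall>\<^sub>F n in sequentially. measure S U - \<epsilon> \<le> scaled_count X (s n) U"
      using sX(1) \<open>open U\<close> \<open>bounded U\<close> \<open>\<epsilon> > 0\<close> unfolding has_profile_def by blast
    moreover have "\<forall>\<^sub>F n in sequentially. scaled_count X' (s n) K' \<le> measure T K' + \<epsilon>"
      using sX(2) K' \<open>\<epsilon> > 0\<close> unfolding has_profile_def by blast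
    moreover have "\<forall>\<^sub>F n in sequentially. \<forall>x\<in>X. norm (x /\<^sub>R s n) \<le> b + 1 \<longrightarrow> norm (g x /\<^sub>R s n - F (x /\<^sub>R s n)) < \<eta> / 2"
      using near[of "\<eta> / 2" "b + 1"] \<eta>(1) by simp
    ultimately have "\<forall>\<^sub>F n in sequentially. measure S (F -` K) \<le> measure T K' + 2 * \<epsilon>"
    proof eventually_elim
      case (elim n)
      have "card {x\<in>X. x /\<^sub>R s n \<in> U} \<le> card {x\<in>X'. x /\<^sub>R s n \<in> K'}"
      proof (rule card_inj_on_le[of g])
        show "inj_on g {x\<in>X. x /\<^sub>R s n \<in> U}" using g by (auto simp: bij_betw_def intro: inj_on_subset)
        show "g ` {x\<in>X. x /\<^sub>R s n \<in> U} \<subseteq> {x\<in>X'. x /\<^sub>R s n \<in> K'}"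
        proof clarify
          fix x assume x: "x \<in> X" "x /\<^sub>R s n \<in> U"
          then obtain z where z: "z \<in> K" "dist z (F (x /\<^sub>R s n)) < \<eta> / 2" by (auto simp: U_def)
          have "norm (x /\<^sub>R s n) \<le> b + 1" using x(2) by (auto simp: U_def)
          then have "norm (g x /\<^sub>R s n - F (x /\<^sub>R s n)) < \<eta> / 2" using elim(3) x(1) by blast
          then have "dist z (g x /\<^sub>R s n) \<le> \<eta>"
            using z(2) dist_triangle[of z "g x /\<^sub>R s n" "F (x /\<^sub>R s n)"] by (simp add: dist_norm norm_minus_commute)
          moreover have "g x \<in> X'" using g x(1) by (auto simp: bij_betw_def)
          ultimately show "g x \<in> X' \<and> g x /\<^sub>R s n \<in> K'" using z(1) unfolding K'_def by auto
        qed
        show "finite {x\<in>X'. x /\<^sub>R s n \<in> K'}" by (rule finX'[OF compact_imp_bounded[OF K']])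
      qed
      then have "scaled_count X (s n) U \<le> scaled_count X' (s n) K'"
        unfolding scaled_count_def using s(3)[of n] by (intro divide_right_mono) auto
      then show ?case using elim SU by linarith
    qed
    then have "measure S (F -` K) \<le> measure T K' + 2 * \<epsilon>" by (auto dest: eventually_happens)
    moreover have "measure T K' \<le> measure T K + \<epsilon>"
      using N(3)[of K'] K' \<eta>(2) by (simp add: K'_def borel_compact compact_imp_bounded)
    ultimately show "measure S (F -` K) \<le> measure T K + e" by (simp add: \<epsilon>_def)
  qed
  have low: "measure T K \<le> measure S (F -` K)" if K: "compact K" for K
  proof (rule field_le_epsilon)
    fix e :: real assume "e > 0"
    define \<epsilon> where "\<epsilon> = e / 3"
    have "\<epsilon> > 0" using \<open>e > 0\<close> by (simp add: \<epsilon>_def)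
    obtain N where N: "open N" "F -` K \<subseteq> N" "\<And>B. B \<in> sets borel \<Longrightarrow> bounded B \<Longrightarrow> B \<subseteq> N \<Longrightarrow> measure S B \<le> measure S (F -` K) + \<epsilon>"
      using comparable_outer_regular[OF S comF[OF K] \<open>\<epsilon> > 0\<close>] by blast
    \<comment> \<open>Upper semicontinuity of preimages: the compact set \<open>Q\<close> has an
      image that misses \<open>K\<close>, hence misses a neighbourhood of \<open>K\<close>, and the
      preimage of a thin neighbourhood of \<open>K\<close> stays in \<open>N\<close>.\<close>
    define Q where "Q = F -` (\<Union>x\<in>K. cball x 1) - N"
    have "compact Q" unfolding Q_def using comF[OF compact_neighbourhood[OF K]] N(1) by (rule compact_diff)
    then have "open (- F ` Q)" by (intro open_Compl compact_imp_closed compact_continuous_image cF)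
    moreover have "K \<subseteq> - F ` Q" using N(2) unfolding Q_def by blast
    ultimately obtain \<eta>0 where \<eta>0: "\<eta>0 > 0" "(\<Union>x\<in>K. cball x \<eta>0) \<subseteq> - F ` Q"
      using compact_subset_open_imp_cball_epsilon_subset[OF K] by blast
    define \<eta> where "\<eta> = min \<eta>0 1"
    have \<eta>: "0 < \<eta>" "\<eta> \<le> \<eta>0" "\<eta> \<le> 1" using \<eta>0 by (auto simp: \<eta>_def)
    define K' where "K' = (\<Union>x\<in>K. cball x \<eta>)"
    have K': "compact K'" unfolding K'_def by (rule compact_neighbourhood[OF K])
    have FK': "F -` K' \<subseteq> N"
    proof
      fix x assume "x \<in> F -` K'"
      then obtain z where z: "z \<in> K" "dist z (F x) \<le> \<eta>" unfolding K'_def by auto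
      then have "F x \<in> cball z \<eta>0" "F x \<in> cball z 1" using \<eta> by auto
      then have "F x \<in> - F ` Q" "x \<in> F -` (\<Union>x\<in>K. cball x 1)" using \<eta>0(2) z(1) by blast+
      then show "x \<in> N" unfolding Q_def by blast
    qed
    define U where "U = (\<Union>x\<in>K. ball x (\<eta> / 2))"
    have "open U" unfolding U_def by auto
    have "U \<subseteq> K'" unfolding U_def K'_def using \<eta>(1) by (force simp: less_imp_le)
    then have "bounded U" using K' bounded_subset compact_imp_bounded by blast
    then obtain b where b: "\<And>y. y \<in> U \<Longrightarrow> norm y \<le> b" unfolding bounded_iff by blast
    \<comment> \<open>By \<open>grow\<close>, rescaled inverse images of points of \<open>U\<close>
      have norm at most \<open>B\<close> at every scale, so the uniform estimate \<open>near\<close>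
      covers them.\<close>
    define B where "B = C * (b + norm (g x0)) + norm x0"
    have KU: "K \<subseteq> U"
    proof
      fix x assume "x \<in> K"
      moreover have "x \<in> ball x (\<eta> / 2)" using \<eta>(1) by simp
      ultimately show "x \<in> U" unfolding U_def by blast
    qed
    have TU: "measure T K \<le> measure T U"
      using K \<open>open U\<close> \<open>bounded U\<close> sb
      by (intro measure_mono_fmeasurable[OF KU] comparable_fmeasurable[OF T]) (auto simp: borel_compact)
    have "\<forall>\<^sub>F n in sequentially. measure T U - \<epsilon> \<le> scaled_count X' (s n) U"
      using sX(2) \<open>open U\<close> \<open>bounded U\<close> \<open>\<epsilon> > 0\<close> unfolding has_profile_def by blast
    moreover have "\<forall>\<^sub>F n in sequentially. scaled_count X (s n) (F -` K') \<le> measure S (F -` K') + \<epsilon>"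
      using sX(1) comF[OF K'] \<open>\<epsilon> > 0\<close> unfolding has_profile_def by blast
    moreover have "\<forall>\<^sub>F n in sequentially. \<forall>x\<in>X. norm (x /\<^sub>R s n) \<le> B \<longrightarrow> norm (g x /\<^sub>R s n - F (x /\<^sub>R s n)) < \<eta> / 2"
      using near[of "\<eta> / 2" B] \<eta>(1) by simp
    ultimately have "\<forall>\<^sub>F n in sequentially. measure T K \<le> measure S (F -` K') + 2 * \<epsilon>"
    proof eventually_elim
      case (elim n)
      define h where "h = inv_into X g"
      have h: "h x' \<in> X" "g (h x') = x'" if "x' \<in> X'" for x'
        using g that by (auto simp: h_def bij_betw_def inv_into_into f_inv_into_f)
      have "card {x\<in>X'. x /\<^sub>R s n \<in> U} \<le> card {x\<in>X. x /\<^sub>R s n \<in> F -` K'}"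
      proof (rule card_inj_on_le[of h])
        show "inj_on h {x\<in>X'. x /\<^sub>R s n \<in> U}" by (rule inj_onI) (metis (no_types, lifting) h(2) mem_Collect_eq)
        show "h ` {x\<in>X'. x /\<^sub>R s n \<in> U} \<subseteq> {x\<in>X. x /\<^sub>R s n \<in> F -` K'}"
        proof clarify
          fix x' assume x': "x' \<in> X'" "x' /\<^sub>R s n \<in> U"
          define x where "x = h x'"
          have x: "x \<in> X" "g x = x'" using h[OF x'(1)] by (auto simp: x_def)
          obtain z where z: "z \<in> K" "dist z (x' /\<^sub>R s n) < \<eta> / 2" using x'(2) by (auto simp: U_def)
          have nx': "norm x' \<le> s n * b" using b[OF x'(2)] s(3)[of n] by (simp add: field_simps)
          have "norm x \<le> norm (x - x0) + norm x0" by norm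
          also have "norm (x - x0) \<le> C * norm (x' - g x0)" using grow[OF x(1)] x(2) by simp
          also have "C * norm (x' - g x0) \<le> C * (s n * b + norm (g x0))"
            using C nx' norm_triangle_ineq4[of x' "g x0"] by (intro mult_left_mono) auto
          finally have "norm x \<le> C * (s n * b + norm (g x0)) + norm x0" by simp
          also have "\<dots> \<le> C * (s n * b + s n * norm (g x0)) + s n * norm x0"
            using C s(2)[of n] by (intro add_mono mult_left_mono mult_right_mono[of 1 "s n", simplified]) auto
          also have "\<dots> = s n * B" by (simp add: B_def algebra_simps)
          finally have "norm (x /\<^sub>R s n) \<le> B" using s(3)[of n] by (simp add: field_simps)
          then have "norm (x' /\<^sub>R s n - F (x /\<^sub>R s n)) < \<eta> / 2" using elim(3) x by blast
          then have "dist z (F (x /\<^sub>R s n)) \<le> \<eta>"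
            using z(2) dist_triangle[of z "F (x /\<^sub>R s n)" "x' /\<^sub>R s n"] by (simp add: dist_norm)
          then show "h x' \<in> X \<and> h x' /\<^sub>R s n \<in> F -` K'" using z(1) x(1) unfolding K'_def x_def[symmetric] by auto
        qed
        show "finite {x\<in>X. x /\<^sub>R s n \<in> F -` K'}" by (rule finX[OF compact_imp_bounded[OF comF[OF K']]])
      qed
      then have "scaled_count X' (s n) U \<le> scaled_count X (s n) (F -` K')"
        unfolding scaled_count_def using s(3)[of n] by (intro divide_right_mono) auto
      then show ?case using elim TU by linarith
    qed
    then have "measure T K \<le> measure S (F -` K') + 2 * \<epsilon>" by (auto dest: eventually_happens)
    moreover have "measure S (F -` K') \<le> measure S (F -` K) + \<epsilon>"
      using N(3)[OF _ _ FK'] comF[OF K'] by (simp add: borel_compact compact_imp_bounded)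
    ultimately show "measure T K \<le> measure S (F -` K) + e" by (simp add: \<epsilon>_def)
  qed
  have "emeasure S (F -` K) = emeasure T K" if K: "compact K" for K
  proof -
    have "F -` K \<in> fmeasurable S" "K \<in> fmeasurable T"
      using comF[OF K] K by (auto intro!: comparable_fmeasurable S T simp: borel_compact compact_imp_bounded)
    then show ?thesis using up[OF K] low[OF K] by (simp add: emeasure_eq_measure2)
  qed
  then have "lipschitz_transport F S T L" by unfold_locales (use L Flip S T in auto)
  then show thesis by (rule that)
qed

section \<open>Nets with a prescribed asymptotic density\<close>

text \<open>
  Stage \<open>n\<close> of the net lives on the cubical annulus between \<open>2^(n\<^sup>2-n) = net_side n\<close> and
  \<open>2^(n\<^sup>2+n) = net_side (n + 1)\<close>, cut into cubes of side \<open>net_side n\<close>. Rescaled by \<open>net_scale n = 2^(n\<^sup>2)\<close> these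
  become the cubes \<open>net_cell n \<kappa>\<close> of side \<open>2^-n\<close> in the annulus between \<open>2^-n\<close> and \<open>2^n\<close>; the
  \<open>core_indices\<close> belong to the cubes at the origin, which are covered by earlier stages.
\<close>
definition net_scale :: "nat \<Rightarrow> real" where "net_scale n = 2 ^ (n * n)"

definition net_side :: "nat \<Rightarrow> int" where "net_side n = 2 ^ (n * n - n)"

definition net_cell :: "nat \<Rightarrow> ('n \<Rightarrow> int) \<Rightarrow> (real ^ 'n) set" where
  "net_cell n \<kappa> = {x. \<forall>i. of_int (\<kappa> i) \<le> 2 ^ n * x $ i \<and> 2 ^ n * x $ i < of_int (\<kappa> i) + 1}"

definition cube_indices :: "nat \<Rightarrow> ('n \<Rightarrow> int) set" where
  "cube_indices n = {\<kappa>. \<forall>i. - (4 ^ n) \<le> \<kappa> i \<and> \<kappa> i < 4 ^ n}"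

definition core_indices :: "('n \<Rightarrow> int) set" where
  "core_indices = {\<kappa>. \<forall>i. - 1 \<le> \<kappa> i \<and> \<kappa> i < 1}"

lemma net_side_pos: "net_side n > 0" by (simp add: net_side_def)

lemma net_scale_eq: "net_scale n = 2 ^ n * of_int (net_side n)"
proof -
  have "n * n = n + (n * n - n)" by (cases n) auto
  then have "(2::real) ^ (n * n) = 2 ^ n * 2 ^ (n * n - n)" by (metis power_add)
  then show ?thesis by (simp add: net_scale_def net_side_def)
qed

text \<open>This fits the stages together: the full cube of stage \<open>n\<close> has exactly the
  extent of the core of stage \<open>n + 1\<close>.\<close>

lemma net_side_Suc: "net_side (Suc n) = 4 ^ n * net_side n"
proof -
  have "Suc n * Suc n - Suc n = 2 * n + (n * n - n)" by (cases n) auto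
  then have "(2::int) ^ (Suc n * Suc n - Suc n) = (2 ^ 2) ^ n * 2 ^ (n * n - n)" by (metis power_add power_mult)
  then show ?thesis by (simp add: net_side_def)
qed

lemma net_side_mono: "n \<le> m \<Longrightarrow> net_side n \<le> net_side m"
proof (induction rule: dec_induct)
  case (step k)
  have "1 * net_side k \<le> 4 ^ k * net_side k" using net_side_pos[of k] by (intro mult_right_mono) auto
  then show ?case using step.IH by (simp add: net_side_Suc)
qed simp

text \<open>In the original coordinates the cells are half-open with integer corners. So they tile
  exactly, and each contains the same number of lattice points.\<close>

lemma scaled_mem_cell:
  "x /\<^sub>R net_scale n \<in> net_cell n \<kappa> \<longleftrightarrow> (\<forall>i. of_int (net_side n * \<kappa> i) \<le> x $ i \<and> x $ i < of_int (net_side n * (\<kappa> i + 1)))"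
proof -
  have p: "real_of_int (net_side n) > 0" using net_side_pos[of n] by simp
  have "2 ^ n * ((x /\<^sub>R net_scale n) $ i) = x $ i / of_int (net_side n)" for i
    by (simp add: net_scale_eq field_simps)
  then show ?thesis unfolding net_cell_def using p by (simp add: pos_le_divide_eq pos_divide_less_eq mult.commute)
qed

lemma mem_cell_floor: "x \<in> net_cell n (\<lambda>i. \<lfloor>2 ^ n * x $ i\<rfloor>)"
  unfolding net_cell_def by (simp add: floor_correct)

lemma cell_unique: "x \<in> net_cell n \<kappa> \<Longrightarrow> \<kappa> = (\<lambda>i. \<lfloor>2 ^ n * x $ i\<rfloor>)"
proof
  fix i assume "x \<in> net_cell n \<kappa>"
  then have "\<lfloor>2 ^ n * x $ i\<rfloor> = \<kappa> i" by (intro floor_unique) (auto simp: net_cell_def)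
  then show "\<kappa> i = \<lfloor>2 ^ n * x $ i\<rfloor>" by simp
qed

lemma cell_disjoint: "\<kappa> \<noteq> \<mu> \<Longrightarrow> net_cell n \<kappa> \<inter> net_cell n \<mu> = {}"
  using cell_unique by blast

lemma cell_borel: "net_cell n (\<kappa> :: 'n::finite \<Rightarrow> int) \<in> sets borel"
proof -
  have "net_cell n \<kappa> = (\<Inter>i. {x. of_int (\<kappa> i) \<le> 2 ^ n * x $ i} \<inter> {x. 2 ^ n * x $ i < of_int (\<kappa> i) + 1})"
    by (auto simp: net_cell_def)
  moreover have "closed {x::real^'n. of_int (\<kappa> i) \<le> 2 ^ n * x $ i}" "open {x::real^'n. 2 ^ n * x $ i < of_int (\<kappa> i) + 1}" for i
    by (auto intro!: closed_Collect_le open_Collect_less continuous_intros)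
  ultimately show ?thesis by (auto intro!: sets.countable_INT)
qed

lemma cell_diameter:
  fixes x y :: "real ^ 'n"
  assumes "x \<in> net_cell n \<kappa>" "y \<in> net_cell n \<kappa>"
  shows "dist x y \<le> real CARD('n) / 2 ^ n"
proof -
  have "\<bar>(x - y) $ i\<bar> \<le> 1 / 2 ^ n" for i
  proof -
    have "\<bar>2 ^ n * x $ i - 2 ^ n * y $ i\<bar> \<le> 1"
    proof -
      have "of_int (\<kappa> i) \<le> 2 ^ n * x $ i" "2 ^ n * x $ i < of_int (\<kappa> i) + 1"
        "of_int (\<kappa> i) \<le> 2 ^ n * y $ i" "2 ^ n * y $ i < of_int (\<kappa> i) + 1"
        using assms unfolding net_cell_def by auto
      then show ?thesis by linarith
    qed
    then have "2 ^ n * \<bar>x $ i - y $ i\<bar> \<le> 1" by (simp add: abs_mult flip: right_diff_distrib)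
    then show ?thesis by (simp add: field_simps)
  qed
  then have "(\<Sum>i\<in>UNIV. \<bar>(x - y) $ i\<bar>) \<le> (\<Sum>i\<in>(UNIV :: 'n set). 1 / 2 ^ n)" by (rule sum_mono)
  then show ?thesis using norm_le_l1_cart[of "x - y"] by (simp add: dist_norm)
qed

lemma cell_bounded: "bounded (net_cell n \<kappa> :: (real ^ 'n) set)"
  unfolding bounded_def using cell_diameter
  by (metis (no_types, lifting) all_not_in_conv)

lemma cell_content: "measure lborel (net_cell n \<kappa> :: (real ^ 'n) set) = (1 / 2 ^ n) ^ CARD('n)"
proof -
  define a :: "real ^ 'n" where "a = (\<chi> i. of_int (\<kappa> i) / 2 ^ n)"
  define b :: "real ^ 'n" where "b = (\<chi> i. (of_int (\<kappa> i) + 1) / 2 ^ n)"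
  have s: "box a b \<subseteq> net_cell n \<kappa>" "net_cell n \<kappa> \<subseteq> cbox a b"
    by (auto simp: net_cell_def mem_box_cart a_def b_def field_simps less_imp_le)
  have f: "B \<in> fmeasurable lborel" if "B \<in> sets borel" "bounded B" for B :: "(real ^ 'n) set"
    using emeasure_bounded_finite[OF that(2)] that(1) by (auto simp: fmeasurable_def)
  have ab: "a \<bullet> i \<le> b \<bullet> i" if "i \<in> Basis" for i
    using that by (auto simp: Basis_vec_def a_def b_def inner_axis divide_right_mono)
  have "cbox a b \<noteq> {}" using ab by (simp add: box_ne_empty)
  then have c: "measure lborel (cbox a b) = (1 / 2 ^ n) ^ CARD('n)"
    by (simp add: content_cbox_cart a_def b_def flip: diff_divide_distrib)
  have "measure lborel (box a b) = measure lborel (cbox a b)"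
    by (simp add: measure_lborel_box_eq measure_lborel_cbox_eq)
  moreover have "measure lborel (box a b) \<le> measure lborel (net_cell n \<kappa>)"
    by (rule measure_mono_fmeasurable[OF s(1)]) (auto intro!: f cell_borel cell_bounded)
  moreover have "measure lborel (net_cell n \<kappa>) \<le> measure lborel (cbox a b)"
    by (rule measure_mono_fmeasurable[OF s(2)]) (auto intro!: f simp: cell_borel)
  ultimately show ?thesis using c by linarith
qed

lemma card_functions_into: "card {\<kappa>. \<forall>i. \<kappa> i \<in> A i} = (\<Prod>i\<in>UNIV. card (A i))" for A :: "'n::finite \<Rightarrow> int set"
proof -
  have "{\<kappa>. \<forall>i. \<kappa> i \<in> A i} = (\<Pi>\<^sub>E i\<in>UNIV. A i)" by (auto simp: PiE_def Pi_def)
  then show ?thesis by (simp add: card_PiE)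
qed

lemma finite_functions_into: "(\<And>i. finite (A i)) \<Longrightarrow> finite {\<kappa>. \<forall>i. \<kappa> i \<in> A i}" for A :: "'n::finite \<Rightarrow> int set"
proof -
  assume "\<And>i. finite (A i)"
  moreover have "{\<kappa>. \<forall>i. \<kappa> i \<in> A i} = (\<Pi>\<^sub>E i\<in>UNIV. A i)" by (auto simp: PiE_def Pi_def)
  ultimately show ?thesis by (simp add: finite_PiE)
qed

lemma cube_indices_card: "finite (cube_indices n :: ('n::finite \<Rightarrow> int) set)" "card (cube_indices n :: ('n \<Rightarrow> int) set) = (2 * 4 ^ n) ^ CARD('n)"
proof -
  have e: "cube_indices n = {\<kappa>::'n \<Rightarrow> int. \<forall>i. \<kappa> i \<in> {- (4 ^ n)..<4 ^ n}}" by (auto simp: cube_indices_def)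
  show "finite (cube_indices n :: ('n \<Rightarrow> int) set)" unfolding e by (rule finite_functions_into) simp
  show "card (cube_indices n :: ('n \<Rightarrow> int) set) = (2 * 4 ^ n) ^ CARD('n)"
    unfolding e card_functions_into by (simp add: nat_mult_distrib nat_power_eq)
qed

lemma core_indices_card: "finite (core_indices :: ('n::finite \<Rightarrow> int) set)" "card (core_indices :: ('n \<Rightarrow> int) set) = 2 ^ CARD('n)"
proof -
  have e: "core_indices = {\<kappa>::'n \<Rightarrow> int. \<forall>i. \<kappa> i \<in> {- 1..<1}}" by (auto simp: core_indices_def)
  show "finite (core_indices :: ('n \<Rightarrow> int) set)" unfolding e by (rule finite_functions_into) simp
  show "card (core_indices :: ('n \<Rightarrow> int) set) = 2 ^ CARD('n)" unfolding e card_functions_into by simp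
qed

lemma cell_index_bound:
  assumes "x \<in> net_cell n \<kappa>" "norm x \<le> b" "b + 1 \<le> 2 ^ n"
  shows "\<kappa> \<in> cube_indices n"
proof -
  have "- (4 ^ n) \<le> \<kappa> i \<and> \<kappa> i < 4 ^ n" for i
  proof -
    have xi: "\<bar>x $ i\<bar> \<le> 2 ^ n - 1" using component_le_norm_cart[of x i] assms(2,3) by linarith
    have "\<bar>2 ^ n * x $ i\<bar> \<le> 2 ^ n * (2 ^ n - 1)" unfolding abs_mult using xi by (simp add: mult_left_mono)
    moreover have "(2::real) ^ n * (2 ^ n - 1) = 4 ^ n - 2 ^ n" by (simp add: right_diff_distrib flip: power_mult_distrib)
    moreover have "(2::real) ^ n \<ge> 1" by simp
    ultimately have "- (4 ^ n) \<le> 2 ^ n * x $ i - 1" "2 ^ n * x $ i < 4 ^ n" by linarith+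
    moreover have "of_int (\<kappa> i) \<le> 2 ^ n * x $ i" "2 ^ n * x $ i < of_int (\<kappa> i) + 1" using assms(1) by (auto simp: net_cell_def)
    ultimately have "- (4 ^ n) < real_of_int (\<kappa> i)" "real_of_int (\<kappa> i) < 4 ^ n" by linarith+
    then have "real_of_int (- (4 ^ n)) < of_int (\<kappa> i)" "real_of_int (\<kappa> i) < of_int (4 ^ n)" by simp_all
    then show ?thesis unfolding of_int_less_iff by auto
  qed
  then show ?thesis by (simp add: cube_indices_def)
qed

definition cell_count :: "(real ^ 'n) set \<Rightarrow> nat \<Rightarrow> ('n \<Rightarrow> int) \<Rightarrow> real" where
  "cell_count X n \<kappa> = real (card {x\<in>X. x /\<^sub>R net_scale n \<in> net_cell n \<kappa>})"

text \<open>Cells shrink in diameter, so a compact set is enclosed in the cells it meets, and an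
  open set is exhausted by the cells that meet a large compact subset. It remains to sum the
  counting errors over a set of cells.\<close>

lemma profile_from_cell_counts:
  fixes X :: "(real ^ 'n) set"
  assumes S: "comparable S" and fin: "\<And>b. finite (X \<inter> cball 0 b)"
    and upper: "\<And>n \<kappa>. cell_count X n \<kappa> \<le> 2 * of_int (net_side n) ^ CARD('n)"
    and exact: "\<And>n \<kappa>. \<kappa> \<in> cube_indices n - core_indices \<Longrightarrow> \<bar>cell_count X n \<kappa> - net_scale n ^ CARD('n) * measure S (net_cell n \<kappa>)\<bar> \<le> 1"
  shows "has_profile net_scale X S"
proof -
  define d where "d = CARD('n)"
  have d0: "d > 0" by (simp add: d_def)
  \<comment> \<open>The first term is an error of 1 for each of the \<open>(2 * 4 ^ n) ^ d\<close>
    cells, the second the trivial bound on the \<open>2 ^ d\<close> core cells, both divided by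
    \<open>net_scale n ^ d\<close>. The first tends to 0 since \<open>2 ^ (n * n)\<close> outgrows
    \<open>4 ^ n\<close>.\<close>
  define err :: "nat \<Rightarrow> real" where "err n = (2 * 4 ^ n / 2 ^ (n * n)) ^ d + 2 * (2 / 2 ^ n) ^ d" for n :: nat
  have "(\<lambda>n::nat. 2 * 4 ^ n / 2 ^ (n * n) :: real) \<longlonglongrightarrow> 0" by real_asymp
  moreover have "(\<lambda>n::nat. 2 / 2 ^ n :: real) \<longlonglongrightarrow> 0" by real_asymp
  ultimately have "err \<longlonglongrightarrow> 0 ^ d + 2 * 0 ^ d" unfolding err_def by (intro tendsto_intros)
  then have err0: "err \<longlonglongrightarrow> 0" using d0 by (simp add: zero_power)
  have sp: "net_scale n > 0" for n by (simp add: net_scale_def)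
  have sS: "sets S = sets borel" using S by (simp add: comparable_def)
  have cfm: "net_cell n \<kappa> \<in> fmeasurable S" for n and \<kappa> :: "'n \<Rightarrow> int"
    by (rule comparable_fmeasurable[OF S cell_bounded cell_borel])
  have Sle: "net_scale n ^ d * measure S (net_cell n \<kappa>) \<le> 2 * of_int (net_side n) ^ d" for n and \<kappa> :: "'n \<Rightarrow> int"
  proof -
    have "measure S (net_cell n \<kappa>) \<le> 2 * (1 / 2 ^ n) ^ d"
      using comparable_measure(2)[OF S cell_bounded cell_borel, of n \<kappa>] by (simp add: cell_content d_def)
    then have "net_scale n ^ d * measure S (net_cell n \<kappa>) \<le> net_scale n ^ d * (2 * (1 / 2 ^ n) ^ d)"
      using sp[of n] by (intro mult_left_mono) auto
    also have "\<dots> = 2 * of_int (net_side n) ^ d" by (simp add: net_scale_eq power_mult_distrib power_divide)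
    finally show ?thesis .
  qed
  have each: "\<bar>cell_count X n \<kappa> - net_scale n ^ d * measure S (net_cell n \<kappa>)\<bar> \<le> 1 + (if \<kappa> \<in> core_indices then 2 * of_int (net_side n) ^ d else 0)"
    if "\<kappa> \<in> cube_indices n" for n \<kappa>
  proof (cases "\<kappa> \<in> core_indices")
    case True
    have "0 \<le> net_scale n ^ d * measure S (net_cell n \<kappa>)" "0 \<le> cell_count X n \<kappa>" using sp[of n] by (auto simp: cell_count_def)
    then have "\<bar>cell_count X n \<kappa> - net_scale n ^ d * measure S (net_cell n \<kappa>)\<bar> \<le> 2 * of_int (net_side n) ^ d"
      using Sle[of n \<kappa>] upper[of n \<kappa>] unfolding d_def by linarith
    then show ?thesis using True by simp
  next
    case False
    then show ?thesis using exact[of \<kappa> n] that by (simp add: d_def)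
  qed
  have sum: "\<bar>(\<Sum>\<kappa>\<in>J. cell_count X n \<kappa>) - net_scale n ^ d * measure S (\<Union>\<kappa>\<in>J. net_cell n \<kappa>)\<bar> \<le> net_scale n ^ d * err n"
    if J: "J \<subseteq> cube_indices n" for J n
  proof -
    have fJ: "finite J" using J cube_indices_card(1) finite_subset by blast
    have "measure S (\<Union>\<kappa>\<in>J. net_cell n \<kappa>) = (\<Sum>\<kappa>\<in>J. measure S (net_cell n \<kappa>))"
    proof (rule measure_UNION'[OF fJ cfm])
      show "pairwise (\<lambda>i j. disjnt (net_cell n i) (net_cell n j)) J"
        unfolding pairwise_def disjnt_def using cell_disjoint by blast
    qed
    then have "(\<Sum>\<kappa>\<in>J. cell_count X n \<kappa>) - net_scale n ^ d * measure S (\<Union>\<kappa>\<in>J. net_cell n \<kappa>)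
       = (\<Sum>\<kappa>\<in>J. cell_count X n \<kappa> - net_scale n ^ d * measure S (net_cell n \<kappa>))"
      by (simp add: sum_distrib_left sum_subtractf)
    also have "\<bar>\<dots>\<bar> \<le> (\<Sum>\<kappa>\<in>J. 1 + (if \<kappa> \<in> core_indices then 2 * of_int (net_side n) ^ d else 0))"
      by (rule order_trans[OF sum_abs sum_mono]) (use each J in blast)
    also have "\<dots> = real (card J) + real (card (J \<inter> core_indices)) * (2 * of_int (net_side n) ^ d)"
      using fJ by (simp add: sum.distrib sum.If_cases Int_def)
    also have "\<dots> \<le> real (card (cube_indices n :: ('n \<Rightarrow> int) set)) + real (card (core_indices :: ('n \<Rightarrow> int) set)) * (2 * of_int (net_side n) ^ d)"
      using net_side_pos[of n] J by (intro add_mono mult_right_mono of_nat_mono card_mono cube_indices_card core_indices_card) auto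
    also have "\<dots> = (2 * 4 ^ n) ^ d + 2 ^ d * (2 * of_int (net_side n) ^ d)"
      by (simp add: cube_indices_card core_indices_card d_def)
    also have "\<dots> = net_scale n ^ d * err n"
    proof -
      have "net_scale n * (2 * 4 ^ n / 2 ^ (n * n)) = 2 * 4 ^ n" by (simp add: net_scale_def)
      then have "net_scale n ^ d * (2 * 4 ^ n / 2 ^ (n * n)) ^ d = (2 * 4 ^ n) ^ d"
        by (metis power_mult_distrib)
      moreover have "net_scale n * (2 / 2 ^ n) = 2 * of_int (net_side n)" by (simp add: net_scale_eq)
      then have "net_scale n ^ d * (2 / 2 ^ n) ^ d = (2 * of_int (net_side n)) ^ d"
        by (metis power_mult_distrib)
      ultimately show ?thesis by (simp add: err_def distrib_left power_mult_distrib)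
    qed
    finally show ?thesis .
  qed
  have finc: "finite {x\<in>X. x /\<^sub>R net_scale n \<in> A}" if "bounded A" for n A
  proof -
    obtain b where b: "\<forall>y\<in>A. norm y \<le> b" using \<open>bounded A\<close> unfolding bounded_iff by blast
    have "norm x \<le> net_scale n * b" if "x /\<^sub>R net_scale n \<in> A" for x using bspec[OF b that] sp[of n] by (simp add: field_simps)
    then show ?thesis by (intro finite_subset[OF _ fin[of "net_scale n * b"]]) auto
  qed
  have small: "\<forall>\<^sub>F n in sequentially. real CARD('n) / 2 ^ n < \<delta>" "\<forall>\<^sub>F n::nat in sequentially. b + 1 \<le> 2 ^ n" if "\<delta> > 0" for \<delta> b :: real
  proof -
    have "(\<lambda>n::nat. real CARD('n) / 2 ^ n) \<longlonglongrightarrow> 0" by real_asymp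
    then show "\<forall>\<^sub>F n in sequentially. real CARD('n) / 2 ^ n < \<delta>" using that by (rule order_tendstoD)
    have "filterlim (\<lambda>n::nat. 2 ^ n :: real) at_top sequentially" by real_asymp
    then show "\<forall>\<^sub>F n::nat in sequentially. b + 1 \<le> 2 ^ n" by (simp add: filterlim_at_top)
  qed
  show ?thesis unfolding has_profile_def
  proof (intro conjI allI impI)
    fix K :: "(real ^ 'n) set" and \<epsilon> :: real assume K: "compact K" and "\<epsilon> > 0"
    have "\<epsilon> / 2 > 0" using \<open>\<epsilon> > 0\<close> by simp
    then obtain N where N: "open N" "K \<subseteq> N" "\<And>B. B \<in> sets borel \<Longrightarrow> bounded B \<Longrightarrow> B \<subseteq> N \<Longrightarrow> measure S B \<le> measure S K + \<epsilon> / 2"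
      using comparable_outer_regular[OF S K] by metis
    obtain \<delta> where \<delta>: "\<delta> > 0" "(\<Union>x\<in>K. cball x \<delta>) \<subseteq> N"
      using compact_subset_open_imp_cball_epsilon_subset[OF K N(1,2)] by blast
    obtain b where b: "\<forall>y\<in>K. norm y \<le> b" using compact_imp_bounded[OF K] unfolding bounded_iff by blast
    have "\<forall>\<^sub>F n in sequentially. err n < \<epsilon> / 2" using err0 \<open>\<epsilon> / 2 > 0\<close> by (rule order_tendstoD)
    then show "\<forall>\<^sub>F n in sequentially. scaled_count X (net_scale n) K \<le> measure S K + \<epsilon>"
      using small(1)[OF \<delta>(1)] small(2)[OF \<delta>(1), of b]
    proof eventually_elim
      case (elim n)
      define J where "J = {\<kappa>. net_cell n \<kappa> \<inter> K \<noteq> {}}"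
      have J: "J \<subseteq> cube_indices n" using cell_index_bound[OF _ _ elim(3)] b unfolding J_def by blast
      have fJ: "finite J" using J cube_indices_card(1) finite_subset by blast
      have JN: "(\<Union>\<kappa>\<in>J. net_cell n \<kappa>) \<subseteq> N"
      proof
        fix y assume "y \<in> (\<Union>\<kappa>\<in>J. net_cell n \<kappa>)"
        then obtain \<kappa> x where "y \<in> net_cell n \<kappa>" "x \<in> net_cell n \<kappa>" "x \<in> K" unfolding J_def by blast
        then have "y \<in> cball x \<delta>" using cell_diameter[of x n \<kappa> y] elim(2) by simp
        then show "y \<in> N" using \<delta>(2) \<open>x \<in> K\<close> by blast
      qed
      have "{x\<in>X. x /\<^sub>R net_scale n \<in> K} \<subseteq> (\<Union>\<kappa>\<in>J. {x\<in>X. x /\<^sub>R net_scale n \<in> net_cell n \<kappa>})"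
        using mem_cell_floor unfolding J_def by blast
      then have "card {x\<in>X. x /\<^sub>R net_scale n \<in> K} \<le> card (\<Union>\<kappa>\<in>J. {x\<in>X. x /\<^sub>R net_scale n \<in> net_cell n \<kappa>})"
        by (intro card_mono finite_UN_I fJ finc cell_bounded)
      also have "\<dots> \<le> (\<Sum>\<kappa>\<in>J. card {x\<in>X. x /\<^sub>R net_scale n \<in> net_cell n \<kappa>})" by (rule card_UN_le[OF fJ])
      finally have "real (card {x\<in>X. x /\<^sub>R net_scale n \<in> K}) \<le> (\<Sum>\<kappa>\<in>J. cell_count X n \<kappa>)"
        unfolding cell_count_def of_nat_sum[symmetric] by (rule of_nat_mono)
      also have "\<dots> \<le> net_scale n ^ d * measure S (\<Union>\<kappa>\<in>J. net_cell n \<kappa>) + net_scale n ^ d * err n"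
        using sum[OF J] by linarith
      also have "\<dots> = net_scale n ^ d * (measure S (\<Union>\<kappa>\<in>J. net_cell n \<kappa>) + err n)" by (simp add: distrib_left)
      finally have "scaled_count X (net_scale n) K \<le> measure S (\<Union>\<kappa>\<in>J. net_cell n \<kappa>) + err n"
        using sp[of n] by (simp add: scaled_count_def d_def pos_divide_le_eq mult.commute)
      moreover have "measure S (\<Union>\<kappa>\<in>J. net_cell n \<kappa>) \<le> measure S K + \<epsilon> / 2"
        by (rule N(3)[OF _ _ JN]) (use fJ in \<open>auto intro!: sets.finite_UN cell_borel cell_bounded\<close>)
      ultimately show ?case using elim(1) by linarith
    qed
  next
    fix N :: "(real ^ 'n) set" and \<epsilon> :: real assume N: "open N" "bounded N" and "\<epsilon> > 0"
    have "\<epsilon> / 4 > 0" "\<epsilon> / 2 > 0" using \<open>\<epsilon> > 0\<close> by auto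
    obtain K where K: "closed K" "K \<subseteq> N" "N - K \<in> lmeasurable" "emeasure lebesgue (N - K) < ennreal (\<epsilon> / 4)"
      using sets_lebesgue_inner_closed[OF _ \<open>\<epsilon> / 4 > 0\<close>, of N] N(1) by auto
    have cK: "compact K" using K(1,2) N(2) bounded_subset compact_eq_bounded_closed by blast
    have NK: "measure S N \<le> measure S K + \<epsilon> / 2"
    proof -
      have b: "N - K \<in> sets borel" "bounded (N - K)" using N K(1) by (auto intro: bounded_subset)
      have "measure S (N - K) \<le> 2 * measure lborel (N - K)" by (rule comparable_measure(2)[OF S b(2,1)])
      also have "measure lborel (N - K) \<le> \<epsilon> / 4"
      proof -
        have "emeasure lborel (N - K) \<le> ennreal (\<epsilon> / 4)" using K(4) b(1) by simp
        then show ?thesis unfolding measure_def using \<open>\<epsilon> / 4 > 0\<close> by (intro enn2real_leI) auto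
      qed
      finally have "measure S (N - K) \<le> \<epsilon> / 2" by simp
      moreover have "measure S (K \<union> (N - K)) \<le> measure S K + measure S (N - K)"
        by (rule measure_Un_le) (use b cK sS in \<open>auto simp: borel_compact\<close>)
      moreover have "K \<union> (N - K) = N" using K(2) by blast
      ultimately show ?thesis by simp
    qed
    obtain \<delta> where \<delta>: "\<delta> > 0" "(\<Union>x\<in>K. cball x \<delta>) \<subseteq> N"
      using compact_subset_open_imp_cball_epsilon_subset[OF cK N(1) K(2)] by blast
    obtain b where b: "\<forall>y\<in>K. norm y \<le> b" using compact_imp_bounded[OF cK] unfolding bounded_iff by blast
    have "\<forall>\<^sub>F n in sequentially. err n < \<epsilon> / 2" using err0 \<open>\<epsilon> / 2 > 0\<close> by (rule order_tendstoD)
    then show "\<forall>\<^sub>F n in sequentially. measure S N - \<epsilon> \<le> scaled_count X (net_scale n) N"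
      using small(1)[OF \<delta>(1)] small(2)[OF \<delta>(1), of b]
    proof eventually_elim
      case (elim n)
      define J where "J = {\<kappa>. net_cell n \<kappa> \<inter> K \<noteq> {}}"
      have J: "J \<subseteq> cube_indices n" using cell_index_bound[OF _ _ elim(3)] b unfolding J_def by blast
      have fJ: "finite J" using J cube_indices_card(1) finite_subset by blast
      have JN: "(\<Union>\<kappa>\<in>J. net_cell n \<kappa>) \<subseteq> N"
      proof
        fix y assume "y \<in> (\<Union>\<kappa>\<in>J. net_cell n \<kappa>)"
        then obtain \<kappa> x where "y \<in> net_cell n \<kappa>" "x \<in> net_cell n \<kappa>" "x \<in> K" unfolding J_def by blast
        then have "y \<in> cball x \<delta>" using cell_diameter[of x n \<kappa> y] elim(2) by simp
        then show "y \<in> N" using \<delta>(2) \<open>x \<in> K\<close> by blast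
      qed
      have KJ: "K \<subseteq> (\<Union>\<kappa>\<in>J. net_cell n \<kappa>)" using mem_cell_floor unfolding J_def by blast
      have "(\<Sum>\<kappa>\<in>J. card {x\<in>X. x /\<^sub>R net_scale n \<in> net_cell n \<kappa>}) = card (\<Union>\<kappa>\<in>J. {x\<in>X. x /\<^sub>R net_scale n \<in> net_cell n \<kappa>})"
        using cell_disjoint by (intro card_UN_disjoint[symmetric] fJ ballI finc cell_bounded impI) blast
      also have "\<dots> \<le> card {x\<in>X. x /\<^sub>R net_scale n \<in> N}"
        using JN by (intro card_mono finc N(2)) blast
      finally have "(\<Sum>\<kappa>\<in>J. cell_count X n \<kappa>) \<le> real (card {x\<in>X. x /\<^sub>R net_scale n \<in> N})"
        unfolding cell_count_def of_nat_sum[symmetric] by (rule of_nat_mono)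
      then have "net_scale n ^ d * (measure S (\<Union>\<kappa>\<in>J. net_cell n \<kappa>) - err n) \<le> real (card {x\<in>X. x /\<^sub>R net_scale n \<in> N})"
        using sum[OF J] by (simp add: right_diff_distrib)
      then have "measure S (\<Union>\<kappa>\<in>J. net_cell n \<kappa>) - err n \<le> scaled_count X (net_scale n) N"
        using sp[of n] by (simp add: scaled_count_def d_def pos_le_divide_eq mult.commute)
      moreover have "measure S K \<le> measure S (\<Union>\<kappa>\<in>J. net_cell n \<kappa>)"
        using cK sS fJ by (intro measure_mono_fmeasurable[OF KJ] fmeasurable.finite_UN cfm) (auto simp: borel_compact)
      ultimately show ?case using elim(1) NK by linarith
    qed
  qed
qed


section \<open>The integer lattice and its enrichment to a net\<close>

lemma integer_points_of_int: "z \<in> integer_points \<Longrightarrow> \<exists>f. z = (\<chi> i. of_int (f i))"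
proof -
  assume "z \<in> integer_points"
  then have "z = (\<chi> i. of_int \<lfloor>z $ i\<rfloor>)" by (simp add: integer_points_def vec_eq_iff)
  then show ?thesis by (rule exI[of _ "\<lambda>i. \<lfloor>z $ i\<rfloor>"])
qed

lemma integer_cell:
  "{z\<in>integer_points. z /\<^sub>R net_scale n \<in> net_cell n \<kappa>}
     = (\<lambda>f. \<chi> i. of_int (f i)) ` {f. \<forall>i. f i \<in> {net_side n * \<kappa> i..<net_side n * (\<kappa> i + 1)}}" (is "?L = ?R")
proof
  show "?L \<subseteq> ?R"
  proof
    fix z assume z: "z \<in> ?L"
    then obtain f where f: "z = (\<chi> i. of_int (f i))" using integer_points_of_int by blast
    have "real_of_int (net_side n * \<kappa> i) \<le> of_int (f i) \<and> real_of_int (f i) < of_int (net_side n * (\<kappa> i + 1))" for i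
      using z unfolding scaled_mem_cell f by simp
    then have "f \<in> {f. \<forall>i. f i \<in> {net_side n * \<kappa> i..<net_side n * (\<kappa> i + 1)}}"
      unfolding of_int_le_iff of_int_less_iff by simp
    then show "z \<in> ?R" using f by blast
  qed
  show "?R \<subseteq> ?L"
  proof
    fix z assume "z \<in> ?R"
    then obtain f where f: "z = (\<chi> i. of_int (f i))" "\<And>i. net_side n * \<kappa> i \<le> f i \<and> f i < net_side n * (\<kappa> i + 1)" by auto
    have "real_of_int (net_side n * \<kappa> i) \<le> of_int (f i) \<and> real_of_int (f i) < of_int (net_side n * (\<kappa> i + 1))" for i
      unfolding of_int_le_iff of_int_less_iff by (rule f(2))
    then show "z \<in> ?L" unfolding f(1) by (simp add: scaled_mem_cell integer_points_def)
  qed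
qed

lemma integer_cell_card:
  "finite {z\<in>integer_points. z /\<^sub>R net_scale n \<in> net_cell n (\<kappa> :: 'n::finite \<Rightarrow> int)}"
  "card {z\<in>integer_points. z /\<^sub>R net_scale n \<in> net_cell n \<kappa>} = nat (net_side n) ^ CARD('n)"
proof -
  have inj: "inj_on (\<lambda>f. \<chi> i. real_of_int (f i)) A" for A :: "('n \<Rightarrow> int) set"
    by (rule inj_onI) (simp add: vec_eq_iff fun_eq_iff)
  show "finite {z\<in>integer_points. z /\<^sub>R net_scale n \<in> net_cell n \<kappa>}"
    unfolding integer_cell by (intro finite_imageI finite_functions_into) simp
  have "card {f. \<forall>i. f i \<in> {net_side n * \<kappa> i..<net_side n * (\<kappa> i + 1)}} = (\<Prod>i\<in>(UNIV :: 'n set). nat (net_side n))"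
    unfolding card_functions_into by (simp add: algebra_simps)
  then show "card {z\<in>integer_points. z /\<^sub>R net_scale n \<in> net_cell n \<kappa>} = nat (net_side n) ^ CARD('n)"
    unfolding integer_cell card_image[OF inj] by simp
qed

lemma integer_points_locally_finite: "finite ((integer_points :: (real ^ 'n) set) \<inter> cball 0 b)"
proof (rule finite_subset)
  show "finite ((\<lambda>f. \<chi> i. real_of_int (f i)) ` {f :: 'n \<Rightarrow> int. \<forall>i. f i \<in> {- \<lceil>\<bar>b\<bar>\<rceil>..\<lceil>\<bar>b\<bar>\<rceil>}})"
    by (intro finite_imageI finite_functions_into) simp
  show "(integer_points :: (real ^ 'n) set) \<inter> cball 0 b
    \<subseteq> (\<lambda>f. \<chi> i. real_of_int (f i)) ` {f :: 'n \<Rightarrow> int. \<forall>i. f i \<in> {- \<lceil>\<bar>b\<bar>\<rceil>..\<lceil>\<bar>b\<bar>\<rceil>}}"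
  proof
    fix z :: "real ^ 'n" assume z: "z \<in> integer_points \<inter> cball 0 b"
    then obtain f where f: "z = (\<chi> i. of_int (f i))" using integer_points_of_int by blast
    have "f i \<in> {- \<lceil>\<bar>b\<bar>\<rceil>..\<lceil>\<bar>b\<bar>\<rceil>}" for i
    proof -
      have "norm z \<le> b" using z by simp
      then have "\<bar>z $ i\<bar> \<le> \<bar>b\<bar>" using component_le_norm_cart[of z i] by linarith
      then have "\<bar>real_of_int (f i)\<bar> \<le> \<bar>b\<bar>" by (simp add: f)
      then have "real_of_int (f i) \<le> of_int \<lceil>\<bar>b\<bar>\<rceil>" "- of_int \<lceil>\<bar>b\<bar>\<rceil> \<le> real_of_int (f i)"
        using le_of_int_ceiling[of "\<bar>b\<bar>"] by linarith+
      then have "f i \<le> \<lceil>\<bar>b\<bar>\<rceil>" "- \<lceil>\<bar>b\<bar>\<rceil> \<le> f i" by linarith+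
      then show ?thesis by simp
    qed
    then show "z \<in> (\<lambda>f. \<chi> i. real_of_int (f i)) ` {f :: 'n \<Rightarrow> int. \<forall>i. f i \<in> {- \<lceil>\<bar>b\<bar>\<rceil>..\<lceil>\<bar>b\<bar>\<rceil>}}"
      using f by blast
  qed
qed

lemma integer_points_profile: "has_profile net_scale (integer_points :: (real ^ 'n) set) lborel"
proof (rule profile_from_cell_counts[OF comparable_lborel integer_points_locally_finite])
  fix n and \<kappa> :: "'n \<Rightarrow> int"
  have c: "cell_count integer_points n \<kappa> = of_int (net_side n) ^ CARD('n)"
    using net_side_pos[of n] by (simp add: cell_count_def integer_cell_card)
  then show "cell_count integer_points n \<kappa> \<le> 2 * of_int (net_side n) ^ CARD('n)" using net_side_pos[of n] by simp
  have "net_scale n ^ CARD('n) * measure lborel (net_cell n \<kappa>) = of_int (net_side n) ^ CARD('n)"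
    by (simp add: cell_content net_scale_eq power_mult_distrib power_divide)
  then show "\<bar>cell_count integer_points n \<kappa> - net_scale n ^ CARD('n) * measure lborel (net_cell n \<kappa>)\<bar> \<le> 1" by (simp add: c)
qed

text \<open>A cell of an earlier stage lies, in original coordinates, within the core cube of every
  later stage. Hence choices made in the annuli are independent of one another.\<close>

lemma annulus_cells_disjoint:
  fixes \<kappa> \<mu> :: "'n::finite \<Rightarrow> int"
  assumes "\<kappa> \<in> cube_indices n - core_indices" "\<mu> \<in> cube_indices m - core_indices"
    and z: "z /\<^sub>R net_scale n \<in> net_cell n \<kappa>" "z /\<^sub>R net_scale m \<in> net_cell m \<mu>"
  shows "n = m \<and> \<kappa> = \<mu>"
proof -
  have less: False if "n < m" "\<kappa> \<in> cube_indices n" "\<mu> \<notin> core_indices" "z /\<^sub>R net_scale n \<in> net_cell n \<kappa>" "z /\<^sub>R net_scale m \<in> net_cell m \<mu>"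
    for n m and \<kappa> \<mu> :: "'n \<Rightarrow> int"
  proof -
    have "- 1 \<le> \<mu> i \<and> \<mu> i < 1" for i
    proof -
      have \<kappa>: "- (4 ^ n) \<le> \<kappa> i" "\<kappa> i + 1 \<le> 4 ^ n" using that(2) by (auto simp: cube_indices_def dest: spec[of _ i])
      have le: "net_side n * 4 ^ n \<le> net_side m" using net_side_mono[of "Suc n" m] that(1) by (simp add: net_side_Suc mult.commute)
      have "net_side n * (- (4 ^ n)) \<le> net_side n * \<kappa> i" "net_side n * (\<kappa> i + 1) \<le> net_side n * 4 ^ n"
        by (intro mult_left_mono \<kappa> less_imp_le net_side_pos)+
      then have b: "- net_side m \<le> net_side n * \<kappa> i" "net_side n * (\<kappa> i + 1) \<le> net_side m" using le by linarith+
      have "real_of_int (net_side n * \<kappa> i) \<le> z $ i" "z $ i < of_int (net_side n * (\<kappa> i + 1))"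
        "real_of_int (net_side m * \<mu> i) \<le> z $ i" "z $ i < of_int (net_side m * (\<mu> i + 1))"
        using that(4,5) unfolding scaled_mem_cell by auto
      then have "real_of_int (net_side m * \<mu> i) < of_int (net_side n * (\<kappa> i + 1))" "real_of_int (net_side n * \<kappa> i) < of_int (net_side m * (\<mu> i + 1))"
        by linarith+
      then have "net_side m * \<mu> i < net_side m * 1" "net_side m * (- 1) < net_side m * (\<mu> i + 1)" using b by linarith+
      then show ?thesis using net_side_pos[of m] unfolding mult_less_cancel_left_pos[OF net_side_pos[of m]] by auto
    qed
    then show False using that(3) by (simp add: core_indices_def)
  qed
  have "n = m" using less[of n m \<kappa> \<mu>] less[of m n \<mu> \<kappa>] assms by (cases n m rule: linorder_cases) auto
  moreover have "\<kappa> = \<mu>" using z cell_disjoint[of \<kappa> \<mu> n] \<open>n = m\<close> by blast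
  ultimately show ?thesis by blast
qed

text \<open>The lattice already realises density 1. The excess, between 0 and 1, is realised by
  copies of selected lattice points shifted by half a unit in every coordinate; both kinds of points
  lie in a half-integer grid, which keeps them separated.\<close>

theorem net_with_profile:
  fixes S :: "(real ^ 'n) measure"
  assumes S: "comparable S"
  obtains Y where "delone Y" "\<And>b. finite (Y \<inter> cball 0 b)" "has_profile net_scale Y S"
    "integer_points \<subseteq> Y"
proof -
  define d where "d = CARD('n)"
  define Z where "Z n \<kappa> = {z\<in>integer_points. z /\<^sub>R net_scale n \<in> net_cell n \<kappa>}" for n and \<kappa> :: "'n \<Rightarrow> int"
  define h :: "real ^ 'n" where "h = (\<chi> i. 1 / 2)"
  \<comment> \<open>The number of extra points in a cell. The bounds 1 and 2 on the density say that
    it is neither negative nor larger than the number of lattice points available for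
    shifting.\<close>
  define t where "t n \<kappa> = nat \<lfloor>net_scale n ^ d * measure S (net_cell n \<kappa>)\<rfloor> - nat (net_side n) ^ d" for n and \<kappa> :: "'n \<Rightarrow> int"
  have cZ: "finite (Z n \<kappa>)" "card (Z n \<kappa>) = nat (net_side n) ^ d" for n \<kappa>
    unfolding Z_def d_def by (rule integer_cell_card)+
  have sr: "real (nat (net_side n) ^ d) = of_int (net_side n) ^ d" for n using net_side_pos[of n] by simp
  have m: "of_int (net_side n) ^ d \<le> net_scale n ^ d * measure S (net_cell n \<kappa>)" "net_scale n ^ d * measure S (net_cell n \<kappa>) \<le> 2 * of_int (net_side n) ^ d" for n \<kappa>
  proof -
    have s: "net_scale n ^ d * (1 / 2 ^ n) ^ d = of_int (net_side n) ^ d" by (simp add: net_scale_eq power_mult_distrib power_divide)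
    have p: "0 \<le> net_scale n ^ d" by (simp add: net_scale_def)
    have "(1 / 2 ^ n) ^ d \<le> measure S (net_cell n \<kappa>)" "measure S (net_cell n \<kappa>) \<le> 2 * (1 / 2 ^ n) ^ d"
      using comparable_measure[OF S cell_bounded cell_borel, of n \<kappa>] by (simp_all add: cell_content d_def)
    from this[THEN mult_left_mono[OF _ p]]
    show "of_int (net_side n) ^ d \<le> net_scale n ^ d * measure S (net_cell n \<kappa>)" "net_scale n ^ d * measure S (net_cell n \<kappa>) \<le> 2 * of_int (net_side n) ^ d"
      using s by auto
  qed
  have tle: "t n \<kappa> \<le> card (Z n \<kappa>)" for n \<kappa>
  proof -
    have "real (nat \<lfloor>net_scale n ^ d * measure S (net_cell n \<kappa>)\<rfloor>) \<le> 2 * of_int (net_side n) ^ d"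
      using m[of n \<kappa>] by (simp add: net_scale_def) linarith
    then have "nat \<lfloor>net_scale n ^ d * measure S (net_cell n \<kappa>)\<rfloor> \<le> 2 * nat (net_side n) ^ d" using sr[of n] by linarith
    then show ?thesis by (simp add: t_def cZ)
  qed
  have treal: "\<bar>real (nat (net_side n) ^ d + t n \<kappa>) - net_scale n ^ d * measure S (net_cell n \<kappa>)\<bar> \<le> 1" for n \<kappa>
  proof -
    have "real (nat (net_side n) ^ d) \<le> net_scale n ^ d * measure S (net_cell n \<kappa>)" using m(1)[of n \<kappa>] sr[of n] by linarith
    then have "nat (net_side n) ^ d \<le> nat \<lfloor>net_scale n ^ d * measure S (net_cell n \<kappa>)\<rfloor>" by (simp add: le_nat_floor)
    then have "nat (net_side n) ^ d + t n \<kappa> = nat \<lfloor>net_scale n ^ d * measure S (net_cell n \<kappa>)\<rfloor>" by (simp add: t_def)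
    moreover have "0 \<le> net_scale n ^ d * measure S (net_cell n \<kappa>)" by (simp add: net_scale_def)
    ultimately show ?thesis by linarith
  qed
  have "\<forall>n \<kappa>. \<exists>A. A \<subseteq> Z n \<kappa> \<and> card A = t n \<kappa>" using tle obtain_subset_with_card_n by metis
  then obtain A where A: "\<And>n \<kappa>. A n \<kappa> \<subseteq> Z n \<kappa>" "\<And>n \<kappa>. card (A n \<kappa>) = t n \<kappa>" by metis
  define G where "G = (\<Union>n. \<Union>\<kappa>\<in>cube_indices n - core_indices. A n \<kappa>)"
  define Y where "Y = integer_points \<union> (\<lambda>z. z + h) ` G"
  have GZ: "G \<subseteq> integer_points" unfolding G_def using A(1) by (auto simp: Z_def)
  have GA: "G \<inter> Z n \<kappa> = A n \<kappa>" if \<kappa>: "\<kappa> \<in> cube_indices n - core_indices" for n \<kappa>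
  proof
    show "A n \<kappa> \<subseteq> G \<inter> Z n \<kappa>" unfolding G_def using A(1) \<kappa> by blast
    show "G \<inter> Z n \<kappa> \<subseteq> A n \<kappa>"
    proof
      fix z assume "z \<in> G \<inter> Z n \<kappa>"
      then obtain m \<mu> where m: "\<mu> \<in> cube_indices m - core_indices" "z \<in> A m \<mu>" "z \<in> Z n \<kappa>" unfolding G_def by blast
      have "z \<in> Z m \<mu>" using A(1) m(2) by blast
      then show "z \<in> A n \<kappa>" using annulus_cells_disjoint[OF \<kappa> m(1), of z] m(2,3) by (auto simp: Z_def)
    qed
  qed
  \<comment> \<open>The corners are integers and the cells half-open, so adding \<open>1 / 2\<close>
    to integer coordinates never crosses a face.\<close>
  have half: "(z + h) /\<^sub>R net_scale n \<in> net_cell n \<kappa> \<longleftrightarrow> z /\<^sub>R net_scale n \<in> net_cell n \<kappa>" if z: "z \<in> integer_points" for z n \<kappa>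
  proof -
    obtain f where f: "z = (\<chi> i. of_int (f i))" using integer_points_of_int[OF z] by blast
    have le: "real_of_int a \<le> of_int c + 1 / 2 \<longleftrightarrow> real_of_int a \<le> of_int c" for a c
    proof
      assume "real_of_int a \<le> of_int c + 1 / 2"
      then have "real_of_int a < of_int (c + 1)" by simp
      then show "real_of_int a \<le> of_int c" unfolding of_int_less_iff by simp
    qed simp
    have less: "real_of_int c + 1 / 2 < of_int b \<longleftrightarrow> real_of_int c < of_int b" for b c
    proof
      assume "real_of_int c < of_int b"
      then have "c + 1 \<le> b" by simp
      then have "real_of_int (c + 1) \<le> of_int b" unfolding of_int_le_iff .
      then show "real_of_int c + 1 / 2 < of_int b" by simp
    qed simp
    show ?thesis
      unfolding scaled_mem_cell f h_def by (simp only: vector_add_component vec_lambda_beta le less)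
  qed
  have hz: "z + h \<notin> integer_points" if z: "z \<in> integer_points" for z
  proof
    assume "z + h \<in> integer_points"
    then have "(z + h) $ undefined - z $ undefined \<in> \<int>" using z by (auto simp: integer_points_def intro: Ints_diff)
    then have "(1 / 2 :: real) \<in> \<int>" by (simp add: h_def)
    then obtain k where "(1 / 2 :: real) = of_int k" by (rule Ints_cases)
    then have "1 = 2 * real_of_int k" by simp
    then have "1 = 2 * k" by linarith
    then show False by presburger
  qed
  have count: "cell_count Y n \<kappa> = real (nat (net_side n) ^ d + card (G \<inter> Z n \<kappa>))" for n \<kappa>
  proof -
    have "{y\<in>Y. y /\<^sub>R net_scale n \<in> net_cell n \<kappa>} = Z n \<kappa> \<union> (\<lambda>z. z + h) ` (G \<inter> Z n \<kappa>)"
      unfolding Y_def Z_def using half GZ by auto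
    moreover have "Z n \<kappa> \<inter> (\<lambda>z. z + h) ` (G \<inter> Z n \<kappa>) = {}" unfolding Z_def using hz by auto
    moreover have "card ((\<lambda>z. z + h) ` (G \<inter> Z n \<kappa>)) = card (G \<inter> Z n \<kappa>)" by (intro card_image inj_onI) simp
    ultimately show ?thesis unfolding cell_count_def using cZ[of n \<kappa>] by (simp add: card_Un_disjoint)
  qed
  have fin: "finite (Y \<inter> cball 0 b)" for b
  proof (rule finite_subset)
    show "finite ((integer_points \<inter> cball 0 b) \<union> (\<lambda>z. z + h) ` (integer_points \<inter> cball 0 (b + norm h)))"
      using integer_points_locally_finite by blast
    have "norm z \<le> b + norm h" if "norm (z + h) \<le> b" for z using norm_triangle_ineq4[of "z + h" h] that by simp
    then show "Y \<inter> cball 0 b \<subseteq> (integer_points \<inter> cball 0 b) \<union> (\<lambda>z. z + h) ` (integer_points \<inter> cball 0 (b + norm h))"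
      unfolding Y_def using GZ by auto
  qed
  have "has_profile net_scale Y S"
  proof (rule profile_from_cell_counts[OF S fin])
    fix n and \<kappa> :: "'n \<Rightarrow> int"
    have "card (G \<inter> Z n \<kappa>) \<le> nat (net_side n) ^ d" using card_mono[OF cZ(1), of "G \<inter> Z n \<kappa>" n \<kappa>] cZ(2) by auto
    then have "real (nat (net_side n) ^ d + card (G \<inter> Z n \<kappa>)) \<le> real (2 * nat (net_side n) ^ d)" by (intro of_nat_mono) simp
    also have "real (2 * nat (net_side n) ^ d) = 2 * of_int (net_side n) ^ d" by (simp only: of_nat_mult of_nat_numeral sr)
    finally show "cell_count Y n \<kappa> \<le> 2 * of_int (net_side n) ^ CARD('n)" by (simp only: count d_def)
    assume "\<kappa> \<in> cube_indices n - core_indices"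
    then have "cell_count Y n \<kappa> = real (nat (net_side n) ^ d + t n \<kappa>)" using count[of n \<kappa>] GA A(2) by simp
    then show "\<bar>cell_count Y n \<kappa> - net_scale n ^ CARD('n) * measure S (net_cell n \<kappa>)\<bar> \<le> 1"
      using treal[of n \<kappa>] by (simp add: d_def)
  qed
  moreover have "delone Y" unfolding delone_def
  proof (intro conjI)
    \<comment> \<open>Coordinates of net points are half-integers, so distinct points differ by at
      least \<open>1 / 2\<close> in some coordinate and cannot share a ball of radius
      \<open>1 / 8\<close>.\<close>
    have coord: "2 * (y $ i) \<in> \<int>" if "y \<in> Y" for y i
      using that GZ unfolding Y_def by (auto simp: integer_points_def h_def distrib_left subset_iff)
    have "x = y" if x: "x \<in> Y \<inter> cball c (1 / 8)" and y: "y \<in> Y \<inter> cball c (1 / 8)" for x y c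
    proof -
      have "dist x y \<le> 1 / 4" using x y dist_triangle2[of x y c] by (auto simp: dist_commute)
      have "x $ i = y $ i" for i
      proof -
        have "\<bar>x $ i - y $ i\<bar> \<le> 1 / 4"
          using component_le_norm_cart[of "x - y" i] \<open>dist x y \<le> 1 / 4\<close> by (simp add: dist_norm)
        then have lt: "\<bar>2 * (x $ i) - 2 * (y $ i)\<bar> < 1" by linarith
        have "2 * (x $ i) - 2 * (y $ i) \<in> \<int>" using coord x y by (intro Ints_diff) auto
        then have "2 * (x $ i) - 2 * (y $ i) = 0" using lt by (rule Ints_nonzero_abs_less1)
        then show ?thesis by simp
      qed
      then show ?thesis by (simp add: vec_eq_iff)
    qed
    then show "\<exists>s>0. \<forall>c. \<forall>x\<in>Y \<inter> cball c s. \<forall>y\<in>Y \<inter> cball c s. x = y" by (intro exI[of _ "1 / 8"]) auto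
    have "Y \<inter> cball c (real CARD('n)) \<noteq> {}" for c :: "real ^ 'n"
    proof -
      define z :: "real ^ 'n" where "z = (\<chi> i. of_int \<lfloor>c $ i\<rfloor>)"
      have "z \<in> Y" unfolding Y_def z_def by (simp add: integer_points_def)
      moreover have "\<bar>(c - z) $ i\<bar> \<le> 1" for i unfolding z_def by simp linarith
      then have "(\<Sum>i\<in>UNIV. \<bar>(c - z) $ i\<bar>) \<le> (\<Sum>i\<in>(UNIV :: 'n set). 1)" by (rule sum_mono)
      then have "dist c z \<le> real CARD('n)" using norm_le_l1_cart[of "c - z"] by (simp add: dist_norm)
      ultimately show ?thesis by auto
    qed
    then show "\<exists>S>0. \<forall>c. Y \<inter> cball c S \<noteq> {}" by (intro exI[of _ "real CARD('n)"]) auto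
  qed
  ultimately show thesis using that[of Y] fin by (auto simp: Y_def)
qed

text \<open>Serves both directions, with the lattice as source or as target. The pointwise Lipschitz
  inverse enters through its constant at \<open>g 0\<close>, which supplies the growth bound;
  lattice points in \<open>X\<close> supply the base point \<open>0\<close> and density with
  constant \<open>CARD('n)\<close>.\<close>

lemma net_map_transport:
  assumes fin: "\<And>b. finite (X \<inter> cball 0 b)" "\<And>b. finite (X' \<inter> cball 0 b)"
    and S: "comparable S" and T: "comparable T" and XS: "has_profile net_scale X S" and XT: "has_profile net_scale X' T"
    and sub: "integer_points \<subseteq> (X :: (real ^ 'n) set)"
    and g: "bij_betw g X X'" and lip: "lipschitz_map X g" and inv: "pointwise_lipschitz X' (inv_into X g)"
  obtains F L where "lipschitz_transport F S T L"
proof -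
  obtain L0 where L0: "L0 > 0" "L0-lipschitz_on X g" using lip unfolding lipschitz_map_def by blast
  define L where "L = max 1 L0"
  have "(0 :: real ^ 'n) \<in> X" using sub by (auto simp: integer_points_def)
  then have g0: "g 0 \<in> X'" using g by (auto simp: bij_betw_def)
  then obtain C where C: "C > 0" "\<And>x. x \<in> X' \<Longrightarrow> dist (inv_into X g x) (inv_into X g (g 0)) \<le> C * dist x (g 0)"
    using inv unfolding pointwise_lipschitz_def lipschitz_at_def by blast
  have ii: "inv_into X g (g x) = x" if "x \<in> X" for x
    using g that by (simp add: bij_betw_def inv_into_f_f)
  obtain F where "lipschitz_transport F S T L"
  proof (rule transport_limit[OF fin _ _ S T XS XT g, of L 0 C "real CARD('n)"])
    show "filterlim net_scale at_top sequentially" unfolding net_scale_def by real_asymp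
    show "1 \<le> net_scale n" for n by (simp add: net_scale_def)
    show "1 \<le> L" by (simp add: L_def)
    show "norm (g x - g y) \<le> L * norm (x - y)" if "x \<in> X" "y \<in> X" for x y
    proof -
      have "norm (g x - g y) \<le> L0 * norm (x - y)" using lipschitz_onD[OF L0(2) that] by (simp add: dist_norm)
      also have "\<dots> \<le> L * norm (x - y)" by (intro mult_right_mono) (auto simp: L_def)
      finally show ?thesis .
    qed
    show "norm (x - 0) \<le> C * norm (g x - g 0)" if "x \<in> X" for x
    proof -
      have "g x \<in> X'" using g that by (auto simp: bij_betw_def)
      then show ?thesis using C(2)[of "g x"] ii[OF that] ii[OF \<open>0 \<in> X\<close>] by (simp add: dist_norm)
    qed
    show "\<exists>x\<in>X. norm (x - y) \<le> real CARD('n)" for y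
    proof
      define z :: "real ^ 'n" where "z = (\<chi> i. of_int \<lfloor>y $ i\<rfloor>)"
      show "z \<in> X" using sub by (auto simp: z_def integer_points_def)
      have "\<bar>(z - y) $ i\<bar> \<le> 1" for i unfolding z_def by simp linarith
      then have "(\<Sum>i\<in>UNIV. \<bar>(z - y) $ i\<bar>) \<le> (\<Sum>i\<in>(UNIV :: 'n set). 1)" by (rule sum_mono)
      then show "norm (z - y) \<le> real CARD('n)" using norm_le_l1_cart[of "z - y"] by simp
    qed
  qed (use \<open>0 \<in> X\<close> C in auto)
  then show thesis by (rule that)
qed

theorem theorem1p5:
  assumes "CARD('n::finite) \<ge> 2"
  shows "\<exists>Y :: (real ^ 'n) set. delone Y \<and>
    \<not> (\<exists>f :: real ^ 'n \<Rightarrow> real ^ 'n. bij_betw f Y integer_points \<and>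
          lipschitz_map Y f \<and> pointwise_co_lipschitz Y integer_points f) \<and>
    \<not> (\<exists>f :: real ^ 'n \<Rightarrow> real ^ 'n. bij_betw f Y integer_points \<and>
          pointwise_lipschitz Y f \<and> co_lipschitz Y integer_points f)"
proof -
  define e :: "real ^ 'n" where "e = axis undefined 1"
  have e: "norm e = 1" by (simp add: e_def)
  obtain R where R: "comparable R" "row_property R e"
    using row_measure_exists[of e] assms e by auto
  obtain Y where Y: "delone Y" "\<And>b. finite (Y \<inter> cball 0 b)" "has_profile net_scale Y R" "integer_points \<subseteq> Y"
    using net_with_profile[OF R(1)] by blast
  have False if f: "bij_betw f Y integer_points" "lipschitz_map Y f" "pointwise_co_lipschitz Y integer_points f"
    for f :: "real ^ 'n \<Rightarrow> real ^ 'n"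
  proof -
    obtain F L where "lipschitz_transport F R lborel L"
      using net_map_transport[OF Y(2) integer_points_locally_finite R(1) comparable_lborel Y(3) integer_points_profile Y(4) f(1,2)]
        f(3) unfolding pointwise_co_lipschitz_def by blast
    then show False using no_transport_from_row_measure[OF _ R(2) e] by blast
  qed
  moreover have False if f: "bij_betw f Y integer_points" "pointwise_lipschitz Y f" "co_lipschitz Y integer_points f"
    for f :: "real ^ 'n \<Rightarrow> real ^ 'n"
  proof -
    \<comment> \<open>In this case the globally Lipschitz map is the inverse, from the lattice to
      the net, so the two measures exchange their sides.\<close>
    define g where "g = inv_into Y f"
    have g: "bij_betw g integer_points Y" unfolding g_def by (rule bij_betw_inv_into[OF f(1)])
    have "inv_into integer_points g y = f y" if "y \<in> Y" for y
    proof (rule inv_into_f_eq)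
      show "inj_on g integer_points" using g by (simp add: bij_betw_def)
      show "f y \<in> integer_points" using f(1) that by (auto simp: bij_betw_def)
      show "g (f y) = y" using f(1) that by (simp add: g_def bij_betw_def inv_into_f_f)
    qed
    then have "pointwise_lipschitz Y (inv_into integer_points g)"
      using f(2) unfolding pointwise_lipschitz_def lipschitz_at_def by simp
    moreover have "lipschitz_map integer_points g" using f(3) unfolding co_lipschitz_def g_def by blast
    ultimately obtain F L where "lipschitz_transport F lborel R L"
      using net_map_transport[OF integer_points_locally_finite Y(2) comparable_lborel R(1) integer_points_profile Y(3) order_refl g]
      by blast
    then show False using no_transport_to_row_measure[OF _ R(2) e] by blast
  qed
  ultimately show ?thesis using Y(1) by blast
qed

end
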